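(* Let $m\geq n\geq 2$, $K\geq 1$, let $\omega\in\Lambda^n(\mathbb{R}^m)$ be a nonzero $n$-covector, identified with the corresponding constant coefficient $n$-volume form on $\mathbb{R}^m$, and let $f\colon\mathbb{R}^n\to\mathbb{R}^m$ be a nonconstant $K$-quasiregular $\omega$-curve. Then $f$ has fast growth of order $\varepsilon$ for some $\varepsilon=\varepsilon(n,K,\omega)>0$, that is, $$\liminf_{r\to\infty}\frac{1}{r^\varepsilon}\int_{B^n(r)}f^*\omega>0.$$
   Context: $B^n(r)\subset\mathbb{R}^n$ is the open ball of radius $r$ centered at the origin. Notation such as $\varepsilon=\varepsilon(n,K,\omega)$ means that the constant depends only on the listed data. $\mathbb{R}^n$, $\mathbb{R}^m$ carry their Euclidean metrics and standard orientations. A smooth $n$-form on $\mathbb{R}^m$ is an $n$-volume form if it is closed and pointwise nonvanishing. The comass norm of $\omega$ at a point $x$ is $\|\omega_x\|=\max\{|\omega_x(v_1,\ldots,v_n)| : v_1,\ldots,v_n \text{ unit vectors}\}$. A continuous map $f\colon\mathbb{R}^n\to\mathbb{R}^m$ is a $K$-quasiregular $\omega$-curve if $f\in W^{1,n}_{\mathrm{loc}}(\mathbb{R}^n,\mathbb{R}^m)$ and $(\|\omega\|\circ f)\|Df\|^n\leq K(\star f^*\omega)$ almost everywhere in $\mathbb{R}^n$, where $\|Df\|$ is the operator norm of the weak differential $Df$, $f^*$ is the a.e. defined pullback by $Df$, and $(\star f^*\omega)$ is the function with $(\star f^*\omega)\,\mathrm{vol}_{\mathbb{R}^n}=f^*\omega$.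 *)

theory Defs
  imports "HOL-Analysis.Analysis"
begin

section \<open>Covectors and differential forms\<close>

text \<open>
  An \<open>n\<close>-covector takes a family of \<open>n = CARD('n)\<close> vectors indexed by the type \<open>'n\<close>, the
  same type that indexes the coordinates of the domain \<open>real^'n\<close>.  Hence no ordering of \<open>'n\<close> has
  to be chosen: reordering \<open>'n\<close> changes the standard orientation of \<open>real^'n\<close> and the reading of
  a covector on \<open>n\<close>-tuples by the same sign.
\<close>

definition covector :: "(('n::finite \<Rightarrow> 'a::real_vector) \<Rightarrow> real) \<Rightarrow> bool" where
  "covector \<alpha> \<longleftrightarrow>
     (\<forall>i v. linear (\<lambda>x. \<alpha> (v(i := x)))) \<and>
     (\<forall>i j v. i \<noteq> j \<and> v i = v j \<longrightarrow> \<alpha> v = 0)"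

type_synonym ('a, 'n) form = "'a \<Rightarrow> ('n \<Rightarrow> 'a) \<Rightarrow> real"

definition constant_form :: "(('n::finite \<Rightarrow> 'a::real_vector) \<Rightarrow> real) \<Rightarrow> ('a, 'n) form" where
  "constant_form \<alpha> = (\<lambda>_. \<alpha>)"

definition comass :: "(('n::finite \<Rightarrow> 'a::real_normed_vector) \<Rightarrow> real) \<Rightarrow> real" where
  "comass \<alpha> = (SUP v\<in>{v. \<forall>i. norm (v i) = 1}. \<bar>\<alpha> v\<bar>)"

definition vol :: "('n::finite \<Rightarrow> real^'n) \<Rightarrow> real" where
  "vol v = det (\<chi> i. v i)"

definition hodge_star :: "(real^'n, 'n::finite) form \<Rightarrow> real^'n \<Rightarrow> real" where
  "hodge_star \<eta> x = (THE c. \<forall>v. \<eta> x v = c * vol v)"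

definition form_integral :: "(real^'n) set \<Rightarrow> (real^'n, 'n::finite) form \<Rightarrow> real" where
  "form_integral S \<eta> = set_lebesgue_integral lebesgue S (hodge_star \<eta>)"


section \<open>Weak differentials and Sobolev maps\<close>

definition partial_deriv :: "'n::finite \<Rightarrow> (real^'n \<Rightarrow> real) \<Rightarrow> real^'n \<Rightarrow> real" where
  "partial_deriv i \<phi> x = frechet_derivative \<phi> (at x) (axis i 1)"

primrec C_k :: "nat \<Rightarrow> (real^'n::finite \<Rightarrow> real) \<Rightarrow> bool" where
  "C_k 0 \<phi> \<longleftrightarrow> continuous_on UNIV \<phi>"
| "C_k (Suc k) \<phi> \<longleftrightarrow>
     (\<forall>x. \<phi> differentiable (at x)) \<and> (\<forall>i. C_k k (partial_deriv i \<phi>))"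

definition test_function :: "(real^'n::finite \<Rightarrow> real) \<Rightarrow> bool" where
  "test_function \<phi> \<longleftrightarrow> (\<forall>k. C_k k \<phi>) \<and> compact (closure {x. \<phi> x \<noteq> 0})"

definition Lp_loc :: "nat \<Rightarrow> (real^'n::finite \<Rightarrow> 'b::euclidean_space) \<Rightarrow> bool" where
  "Lp_loc p u \<longleftrightarrow>
     u \<in> borel_measurable lebesgue \<and>
     (\<forall>C. compact C \<longrightarrow> set_integrable lebesgue C (\<lambda>x. norm (u x) ^ p))"

text \<open>The entry \<open>D x $ j $ i\<close> is the weak derivative of the \<open>j\<close>-th component of \<open>f\<close> in
  direction \<open>i\<close>, so the matrix \<open>D x\<close> acts on tangent vectors by \<open>*v\<close>.\<close>

definition has_weak_differential ::
    "(real^'n::finite \<Rightarrow> real^'m::finite) \<Rightarrow> (real^'n \<Rightarrow> real^'n^'m) \<Rightarrow> bool" where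
  "has_weak_differential f D \<longleftrightarrow>
     Lp_loc 1 f \<and> Lp_loc 1 D \<and>
     (\<forall>\<phi> i j. test_function \<phi> \<longrightarrow>
        (LINT x|lebesgue. f x $ j * partial_deriv i \<phi> x) =
        - (LINT x|lebesgue. D x $ j $ i * \<phi> x))"

text \<open>A weak differential is unique only up to null sets; everything below depends only on its
  almost-everywhere class, so an arbitrary representative is chosen.\<close>

definition weak_differential ::
    "(real^'n::finite \<Rightarrow> real^'m::finite) \<Rightarrow> real^'n \<Rightarrow> real^'n^'m" where
  "weak_differential f = (SOME D. has_weak_differential f D)"

definition sobolev_W1_loc :: "nat \<Rightarrow> (real^'n::finite \<Rightarrow> real^'m::finite) \<Rightarrow> bool" where
  "sobolev_W1_loc p f \<longleftrightarrow>
     Lp_loc p f \<and> (\<exists>D. has_weak_differential f D) \<and> Lp_loc p (weak_differential f)"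


section \<open>Quasiregular curves\<close>

definition pullback ::
    "(real^'n::finite \<Rightarrow> real^'m::finite) \<Rightarrow> (real^'m, 'k) form \<Rightarrow> (real^'n, 'k) form" where
  "pullback f \<Omega> x v = \<Omega> (f x) (\<lambda>i. weak_differential f x *v v i)"

definition quasiregular_curve ::
    "real \<Rightarrow> (real^'m, 'n) form \<Rightarrow> (real^'n::finite \<Rightarrow> real^'m::finite) \<Rightarrow> bool" where
  "quasiregular_curve K \<Omega> f \<longleftrightarrow>
     continuous_on UNIV f \<and>
     sobolev_W1_loc CARD('n) f \<and>
     (AE x in lebesgue.
        comass (\<Omega> (f x)) * onorm (\<lambda>v. weak_differential f x *v v) ^ CARD('n)
          \<le> K * hodge_star (pullback f \<Omega>) x)"

definition fast_growth ::
    "real \<Rightarrow> (real^'m, 'n) form \<Rightarrow> (real^'n::finite \<Rightarrow> real^'m::finite) \<Rightarrow> bool" where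
  "fast_growth \<epsilon> \<Omega> f \<longleftrightarrow>
     Liminf at_top (\<lambda>r::real.
       ereal (1 / r powr \<epsilon> * form_integral (ball 0 r) (pullback f \<Omega>))) > 0"


section \<open>Top-degree covectors are multiples of the volume form\<close>

lemma covector_swap:
  assumes "covector \<alpha>" "a \<noteq> b"
  shows "\<alpha> (v \<circ> Transposition.transpose a b) = - \<alpha> v"
proof -
  have lin: "\<alpha> (w(i := x + y)) = \<alpha> (w(i := x)) + \<alpha> (w(i := y))" for w i x y
    using assms(1) unfolding covector_def by (auto dest: linear_add)
  have alt: "\<alpha> w = 0" if "w a = w b" for w
    using assms that unfolding covector_def by blast
  let ?w = "\<lambda>x y. v(a := x, b := y)"
  have fst: "\<alpha> (?w (v a + v b) y) = \<alpha> (?w (v a) y) + \<alpha> (?w (v b) y)" for y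
    using lin[of "v(b := y)" a "v a" "v b"] by (simp only: fun_upd_twist[OF assms(2)])
  have "0 = \<alpha> (?w (v a + v b) (v a + v b))"
    by (rule alt[symmetric]) (use assms(2) in auto)
  also have "\<dots> = \<alpha> (?w (v a) (v a)) + \<alpha> (?w (v b) (v a))
      + (\<alpha> (?w (v a) (v b)) + \<alpha> (?w (v b) (v b)))"
    unfolding lin[of "v(a := v a + v b)"] fst ..
  also have "\<alpha> (?w (v a) (v a)) = 0" by (rule alt) (use assms(2) in auto)
  also have "\<alpha> (?w (v b) (v b)) = 0" by (rule alt) (use assms(2) in auto)
  finally have "\<alpha> (?w (v b) (v a)) = - \<alpha> (?w (v a) (v b))" by linarith
  moreover have "?w (v b) (v a) = v \<circ> Transposition.transpose a b"
    by (auto simp: fun_eq_iff Transposition.transpose_def)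
  ultimately show ?thesis by simp
qed

lemma covector_eq_0I:
  fixes \<alpha> :: "('n::finite \<Rightarrow> real^'n) \<Rightarrow> real"
  assumes cov: "covector \<alpha>" and 0: "\<alpha> (\<lambda>i. axis i 1) = 0"
  shows "\<alpha> v = 0"
proof -
  have perm: "\<alpha> (\<lambda>i. axis (p i) 1) = 0" if "p permutes UNIV" for p :: "'n \<Rightarrow> 'n"
    using finite that
  proof (induction rule: permutes_rev_induct)
    case (swap a b p)
    then show ?case
      using covector_swap[OF cov, of a b "\<lambda>i. axis (p i) 1"] by (simp add: o_def)
  qed (use 0 in simp)
  have basis: "\<alpha> (\<lambda>i. axis (g i) 1) = 0" for g :: "'n \<Rightarrow> 'n"
  proof (cases "inj g")
    case True
    then show ?thesis
      by (intro perm) (auto intro: bij_imp_permutes inj_on_imp_bij_betw simp: bij_def finite_UNIV_inj_surj)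
  next
    case False
    then obtain i j where "i \<noteq> j" "g i = g j" by (auto simp: inj_def)
    then show ?thesis using cov unfolding covector_def by metis
  qed
  have "\<alpha> v = 0" if "\<forall>i. i \<notin> T \<longrightarrow> (\<exists>j. v i = axis j 1)" for T v
    using finite[of T] that
  proof (induction T arbitrary: v rule: finite_induct)
    case empty
    then obtain g where "v = (\<lambda>i. axis (g i) 1)" by (metis empty_iff ext)
    then show ?case using basis by simp
  next
    case (insert i T)
    have lin: "linear (\<lambda>x. \<alpha> (v(i := x)))"
      using cov unfolding covector_def by blast
    have "\<alpha> v = \<alpha> (v(i := (\<Sum>j\<in>UNIV. (v i $ j) *\<^sub>R axis j 1)))"
      using basis_expansion[of "v i"] by (simp add: scalar_mult_eq_scaleR)
    also have "\<dots> = (\<Sum>j\<in>UNIV. (v i $ j) *\<^sub>R \<alpha> (v(i := axis j 1)))"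
      by (simp only: linear_sum[OF lin] linear_scale[OF lin])
    also have "\<dots> = 0"
    proof (intro sum.neutral ballI)
      fix j
      have "\<alpha> (v(i := axis j 1)) = 0"
        using insert.prems by (intro insert.IH) auto
      then show "(v i $ j) *\<^sub>R \<alpha> (v(i := axis j 1)) = 0" by simp
    qed
    finally show ?case .
  qed
  from this[of UNIV v] show ?thesis by simp
qed

lemma vol_basis: "vol (\<lambda>i::'n::finite. axis i 1) = 1"
proof -
  have "(\<chi> i. axis i 1) = (mat 1 :: real^'n^'n)"
    by (auto simp: vec_eq_iff mat_def axis_def)
  then show ?thesis unfolding vol_def by (simp only: det_I)
qed

lemma covector_vol: "covector (vol :: ('n::finite \<Rightarrow> real^'n) \<Rightarrow> real)"
  unfolding covector_def
proof (intro conjI allI impI)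
  fix i and v :: "'n \<Rightarrow> real^'n"
  have eq: "vol (v(i := x)) = det (\<chi> k. if k = i then x else v k)" for x
    by (simp add: vol_def fun_upd_def)
  show "linear (\<lambda>x. vol (v(i := x)))"
    unfolding eq
  proof (rule linearI)
    show "det (\<chi> k. if k = i then x + y else v k) =
        det (\<chi> k. if k = i then x else v k) + det (\<chi> k. if k = i then y else v k)" for x y
      by (rule det_row_add)
    show "det (\<chi> k. if k = i then c *\<^sub>R x else v k) =
        c *\<^sub>R det (\<chi> k. if k = i then x else v k)" for c x
      unfolding scalar_mult_eq_scaleR[symmetric] real_scaleR_def by (rule det_row_mul)
  qed
next
  fix i j and v :: "'n \<Rightarrow> real^'n"
  assume "i \<noteq> j \<and> v i = v j"
  then show "vol v = 0"
    unfolding vol_def by (intro det_identical_rows[of i j]) (auto simp: row_def vec_eq_iff)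
qed

lemma covector_eq_vol:
  fixes \<alpha> :: "('n::finite \<Rightarrow> real^'n) \<Rightarrow> real"
  assumes "covector \<alpha>"
  shows "\<alpha> v = \<alpha> (\<lambda>i. axis i 1) * vol v"
proof -
  let ?c = "\<alpha> (\<lambda>i. axis i 1)"
  have "covector (\<lambda>v. \<alpha> v - ?c * vol v)"
    using assms covector_vol unfolding covector_def
    by (auto intro!: linear_compose_sub linear_compose_scale_right
             simp flip: real_scaleR_def)
  from covector_eq_0I[OF this, of v] show ?thesis by (simp add: vol_basis)
qed

lemma hodge_star_eq:
  assumes "covector (\<eta> x)"
  shows "hodge_star \<eta> x = \<eta> x (\<lambda>i. axis i 1)"
  unfolding hodge_star_def
proof (rule the_equality)
  show "\<forall>v. \<eta> x v = \<eta> x (\<lambda>i. axis i 1) * vol v"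
    using covector_eq_vol[OF assms] by blast
  show "c = \<eta> x (\<lambda>i. axis i 1)" if "\<forall>v. \<eta> x v = c * vol v" for c
    using that by (simp add: vol_basis)
qed

lemma covector_pullback:
  assumes "covector (\<Omega> (f x))"
  shows "covector (pullback f \<Omega> x)"
proof -
  let ?D = "weak_differential f x"
  have eq: "pullback f \<Omega> x (v(i := y)) = \<Omega> (f x) ((\<lambda>k. ?D *v v k)(i := ?D *v y))" for v i y
    by (auto simp: pullback_def intro!: arg_cong[where f = "\<Omega> (f x)"])
  have "linear (\<lambda>y. \<Omega> (f x) ((\<lambda>k. ?D *v v k)(i := ?D *v y)))" for v i
    using linear_compose[of "(*v) ?D" "\<lambda>y. \<Omega> (f x) ((\<lambda>k. ?D *v v k)(i := y))"] assms
    unfolding covector_def by (simp add: o_def)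
  moreover have "pullback f \<Omega> x v = 0" if "i \<noteq> j" "v i = v j" for i j v
  proof -
    have "?D *v v i = ?D *v v j" using that(2) by simp
    then show ?thesis
      using assms that(1) unfolding covector_def pullback_def
      by (elim conjE allE[of _ i] allE[of _ j] allE[of _ "\<lambda>k. ?D *v v k"]) simp
  qed
  ultimately show ?thesis unfolding covector_def eq by blast
qed

end

theory Submission
  imports Defs
begin

text \<open>
  Write \<open>J = \<omega>(\<partial>\<^sub>1 f, \<dots>, \<partial>\<^sub>n f)\<close> for the density of \<open>f\<^sup>*\<omega>\<close>.  Quasiregularity says that \<open>J\<close> and the
  energy density \<open>\<bar>Df\<bar>\<^sup>n\<close> are comparable, with constants that depend on \<open>n\<close>, \<open>K\<close> and \<open>\<omega>\<close> only; in
  particular \<open>J \<ge> 0\<close>.  Since \<open>\<omega>\<close> is constant, \<open>f\<^sup>*\<omega>\<close> is exact, and this makes the proof a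
  hole-filling argument.

  Let \<open>\<psi>\<close> be a cutoff function that is 1 on the cube \<open>Q\<^sub>r\<close> of half side \<open>r\<close>, vanishes outside \<open>Q\<^sub>2\<^sub>r\<close>
  and has a gradient of size at most a multiple of \<open>1/r\<close>.  Integration by parts turns
  \<open>\<integral>\<psi>J\<close> into an integral over the layer \<open>A = Q\<^sub>2\<^sub>r - Q\<^sub>r\<close> that contains \<open>\<bar>f - c\<bar>\<close> once and first
  derivatives of \<open>f\<close> otherwise, for an arbitrary constant \<open>c\<close> (\<open>integral_cutoff_covector\<close>).  For
  \<open>n \<ge> 2\<close> the layer is connected, and the Poincare inequality \<open>osc_layer_le\<close> on it gives the
  scale-invariant bound
  \<open>\<integral>\<^sub>Q\<^sub>r J \<le> \<integral>\<psi>J \<le> C \<integral>\<^sub>A \<bar>Df\<bar>\<^sup>n \<le> M \<integral>\<^sub>A J\<close>.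
  The right-hand side lives on the complement of \<open>Q\<^sub>r\<close>.  Adding \<open>M \<integral>\<^sub>Q\<^sub>r J\<close> to both sides shows that
  \<open>E(r) = \<integral>\<^sub>Q\<^sub>r J\<close> satisfies \<open>E(3r) \<ge> (1 + 1/M) E(r)\<close>.  Iteration yields growth of order
  \<open>log\<^sub>3 (1 + 1/M)\<close> as soon as \<open>E\<close> is positive somewhere (\<open>power_growth\<close>); if \<open>E\<close> vanished
  identically, then so would \<open>Df\<close>, and \<open>f\<close> would be constant (\<open>constant_if_weak_columns_0\<close>).

  The integration by parts needs second derivatives, so the bound \<open>\<integral>\<psi>J \<le> C \<integral>\<^sub>A \<bar>Df\<bar>\<^sup>n\<close> is first
  proved for twice differentiable maps (\<open>cutoff_integral_le\<close>) and then transferred to Sobolev maps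
  by mollification (\<open>cutoff_integral_le_sobolev\<close>).  Mollifiers serve twice: they are the test
  functions against which the weak differential is read, and the mollified differential converges
  to the weak one in the mean of order \<open>n\<close>, which is exactly the integrability in which both sides
  of the bound are continuous.
\<close>

section \<open>Covectors as multilinear maps\<close>

text \<open>The sum \<open>F T\<close> in the proof arises from \<open>\<omega> v\<close> by expanding the arguments with index in \<open>T\<close>
  in the standard basis; enlarging \<open>T\<close> does not change its value.  The expansion makes \<open>\<omega> v\<close> a
  polynomial in the coordinates, which yields bounds, measurability and the product rule.\<close>

lemma covector_expand:
  fixes \<omega> :: "('n::finite \<Rightarrow> real^'m::finite) \<Rightarrow> real"
  assumes "covector \<omega>"
  shows "\<omega> v = (\<Sum>\<sigma>\<in>UNIV. (\<Prod>j\<in>UNIV. v j $ \<sigma> j) * \<omega> (\<lambda>j. axis (\<sigma> j) 1))"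
proof -
  have lin: "linear (\<lambda>x. \<omega> (w(i := x)))" for w i
    using assms unfolding covector_def by blast
  define F where "F T = (\<Sum>\<sigma>\<in>PiE T (\<lambda>_. UNIV). (\<Prod>j\<in>T. v j $ \<sigma> j) *
      \<omega> (\<lambda>j. if j \<in> T then axis (\<sigma> j) 1 else v j))" for T
  have "F T = \<omega> v" if "finite T" for T
    using that
  proof induction
    case empty
    show ?case by (simp add: F_def)
  next
    case (insert i T)
    let ?p = "\<lambda>\<sigma> y. (\<Prod>j\<in>insert i T. v j $ (\<sigma>(i := y)) j) *
        \<omega> (\<lambda>j. if j \<in> insert i T then axis ((\<sigma>(i := y)) j) 1 else v j)"
    have "F (insert i T) = (\<Sum>(y, \<sigma>)\<in>UNIV \<times> PiE T (\<lambda>_. UNIV). 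
        ?p \<sigma> y)"
      unfolding F_def PiE_insert_eq
      by (subst sum.reindex[OF inj_combinator]) (use insert in \<open>auto simp: case_prod_unfold intro!: sum.cong\<close>)
    also have "\<dots> = (\<Sum>\<sigma>\<in>PiE T (\<lambda>_. UNIV). \<Sum>y\<in>UNIV. 
        ?p \<sigma> y)"
      unfolding sum.cartesian_product[symmetric] by (rule sum.swap)
    also have "\<dots> = F T"
      unfolding F_def
    proof (rule sum.cong[OF refl])
      fix \<sigma> :: "'n \<Rightarrow> 'm" assume "\<sigma> \<in> PiE T (\<lambda>_. UNIV)"
      define w where "w = (\<lambda>j. if j \<in> T then axis (\<sigma> j) 1 else v j)"
      have wi: "w = w(i := \<Sum>y\<in>UNIV. (v i $ y) *\<^sub>R axis y 1)"
        using insert(2) basis_expansion[of "v i"] by (auto simp: w_def scalar_mult_eq_scaleR)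
      have "(\<Sum>y\<in>UNIV. ?p \<sigma> y)
        = (\<Sum>y\<in>UNIV. v i $ y * (\<Prod>j\<in>T. v j $ \<sigma> j) * \<omega> (w(i := axis y 1)))"
      proof (rule sum.cong[OF refl])
        fix y
        have 1: "(\<Prod>j\<in>T. v j $ (\<sigma>(i := y)) j) = (\<Prod>j\<in>T. v j $ \<sigma> j)"
          by (rule prod.cong) (use insert(2) in auto)
        have 2: "(\<lambda>j. if j \<in> insert i T then axis ((\<sigma>(i := y)) j) 1 else v j) = w(i := axis y 1)"
          using insert(2) by (auto simp: w_def fun_eq_iff)
        show "?p \<sigma> y
          = v i $ y * (\<Prod>j\<in>T. v j $ \<sigma> j) * \<omega> (w(i := axis y 1))"
          unfolding 2 using insert(1,2) 1 by simp
      qed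
      also have "\<dots> = (\<Prod>j\<in>T. v j $ \<sigma> j) * \<omega> w"
        by (subst (2) wi) (simp add: linear_sum[OF lin] linear_scale[OF lin] sum_distrib_left mult_ac)
      finally show "(\<Sum>y\<in>UNIV. ?p \<sigma> y)
        = (\<Prod>j\<in>T. v j $ \<sigma> j) * \<omega> (\<lambda>j. if j \<in> T then axis (\<sigma> j) 1 else v j)"
        unfolding w_def .
    qed
    finally show ?case using insert by simp
  qed
  from this[of UNIV] show ?thesis by (simp add: F_def)
qed

definition covector_bound :: "(('n::finite \<Rightarrow> real^'m::finite) \<Rightarrow> real) \<Rightarrow> real" where
  "covector_bound \<omega> = (\<Sum>\<sigma>\<in>UNIV. \<bar>\<omega> (\<lambda>j. axis (\<sigma> j) 1)\<bar>)"

lemma covector_bound_nonneg: "covector_bound \<omega> \<ge> 0"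
  by (simp add: covector_bound_def sum_nonneg)

lemma abs_covector_le:
  assumes "covector \<omega>"
  shows "\<bar>\<omega> v\<bar> \<le> covector_bound \<omega> * (\<Prod>j\<in>UNIV. norm (v j))"
proof -
  have "\<bar>\<omega> v\<bar> \<le> (\<Sum>\<sigma>\<in>UNIV. \<bar>(\<Prod>j\<in>UNIV. v j $ \<sigma> j) * \<omega> (\<lambda>j. axis (\<sigma> j) 1)\<bar>)"
    by (subst covector_expand[OF assms]) (rule sum_abs)
  also have "\<dots> \<le> (\<Sum>\<sigma>\<in>UNIV. (\<Prod>j\<in>UNIV. norm (v j)) * \<bar>\<omega> (\<lambda>j. axis (\<sigma> j) 1)\<bar>)"
    unfolding abs_mult abs_prod
    by (intro sum_mono mult_right_mono prod_mono) (auto simp: component_le_norm_cart)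
  finally show ?thesis by (simp add: covector_bound_def sum_distrib_left mult_ac)
qed

text \<open>Passing from \<open>w\<close> to \<open>v\<close> one argument at a time, each step changes \<open>\<omega>\<close> by its value on a tuple
  with one entry of size \<open>d\<close> and the others of size \<open>b\<close>.\<close>

lemma covector_diff_le:
  fixes \<omega> :: "('n::finite \<Rightarrow> real^'m::finite) \<Rightarrow> real" and b d :: real
  assumes cov: "covector \<omega>" and v: "\<And>j. norm (v j) \<le> b" and w: "\<And>j. norm (w j) \<le> b"
    and d: "\<And>j. norm (v j - w j) \<le> d"
  shows "\<bar>\<omega> v - \<omega> w\<bar> \<le> covector_bound \<omega> * (CARD('n) * (d * b ^ (CARD('n) - 1)))"
proof -
  define mix where "mix T = (\<lambda>j. if j \<in> T then v j else w j)" for T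
  have d0: "d \<ge> 0" using order.trans[OF norm_ge_zero d] .
  have "\<bar>\<omega> (mix T) - \<omega> w\<bar> \<le> covector_bound \<omega> * (card T * (d * b ^ (CARD('n) - 1)))"
    if "finite T" for T
    using that
  proof induction
    case empty
    then show ?case by (simp add: mix_def)
  next
    case (insert i T)
    have lin: "linear (\<lambda>x. \<omega> ((mix T)(i := x)))"
      using cov unfolding covector_def by blast
    have "mix (insert i T) = (mix T)(i := v i)" "mix T = (mix T)(i := w i)"
      using insert(2) by (auto simp: mix_def fun_eq_iff)
    hence "\<omega> (mix (insert i T)) - \<omega> (mix T) = \<omega> ((mix T)(i := v i - w i))"
      using linear_diff[OF lin] by metis
    moreover have "\<bar>\<omega> ((mix T)(i := v i - w i))\<bar> \<le> covector_bound \<omega> * (d * b ^ (CARD('n) - 1))"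
    proof -
      have "(\<Prod>j\<in>UNIV. norm (((mix T)(i := v i - w i)) j))
        = norm (v i - w i) * (\<Prod>j\<in>UNIV - {i}. norm (mix T j))"
        by (subst prod.remove[of _ i]) (auto intro!: prod.cong)
      also have "\<dots> \<le> d * (\<Prod>j\<in>UNIV - {i}. b)"
        using v w d d0 by (intro mult_mono prod_mono prod_nonneg) (auto simp: mix_def)
      also have "\<dots> = d * b ^ (CARD('n) - 1)" by (simp add: card_Diff_singleton)
      finally show ?thesis
        using abs_covector_le[OF cov] covector_bound_nonneg[of \<omega>]
        by (meson mult_left_mono order_trans)
    qed
    ultimately show ?case using insert by (simp add: algebra_simps)
  qed
  from this[of UNIV] show ?thesis by (simp add: mix_def)
qed

lemma has_derivative_covector:
  fixes \<omega> :: "('n::finite \<Rightarrow> real^'m::finite) \<Rightarrow> real" and v :: "'n \<Rightarrow> 'a::real_normed_vector \<Rightarrow> real^'m"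
  assumes cov: "covector \<omega>" and v: "\<And>j. (v j has_derivative v' j) (at x)"
  shows "((\<lambda>x. \<omega> (\<lambda>j. v j x)) has_derivative
    (\<lambda>h. \<Sum>j\<in>UNIV. \<omega> ((\<lambda>k. v k x)(j := v' j h)))) (at x)"
proof -
  have comp: "((\<lambda>x. v j x $ i) has_derivative (\<lambda>h. v' j h $ i)) (at x)" for i j
    using bounded_linear.has_derivative[OF bounded_linear_vec_nth v] .
  have "((\<lambda>x. \<Sum>\<sigma>\<in>UNIV. (\<Prod>j\<in>UNIV. v j x $ \<sigma> j) * \<omega> (\<lambda>j. axis (\<sigma> j) 1)) has_derivative
    (\<lambda>h. \<Sum>\<sigma>\<in>UNIV. (\<Sum>j\<in>UNIV. v' j h $ \<sigma> j * (\<Prod>k\<in>UNIV - {j}. v k x $ \<sigma> k))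
       * \<omega> (\<lambda>j. axis (\<sigma> j) 1))) (at x)"
    by (intro has_derivative_sum has_derivative_mult_left has_derivative_prod comp)
  moreover have "(\<Sum>\<sigma>\<in>UNIV. (\<Sum>j\<in>UNIV. v' j h $ \<sigma> j * (\<Prod>k\<in>UNIV - {j}. v k x $ \<sigma> k))
       * \<omega> (\<lambda>j. axis (\<sigma> j) 1)) = (\<Sum>j\<in>UNIV. \<omega> ((\<lambda>k. v k x)(j := v' j h)))" for h
  proof -
    have "(\<Prod>k\<in>UNIV. ((\<lambda>k. v k x)(j := v' j h)) k $ \<sigma> k)
      = v' j h $ \<sigma> j * (\<Prod>k\<in>UNIV - {j}. v k x $ \<sigma> k)" for j and \<sigma> :: "'n \<Rightarrow> 'm"
      by (subst prod.remove[of _ j]) (auto intro!: prod.cong)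
    then show ?thesis
      by (subst covector_expand[OF cov]) (simp only: sum_distrib_right, rule sum.swap)
  qed
  ultimately show ?thesis by (subst covector_expand[OF cov]) simp
qed

lemma continuous_on_covector:
  assumes "covector \<omega>" "\<And>j. continuous_on S (v j)"
  shows "continuous_on S (\<lambda>x. \<omega> (\<lambda>j. v j x :: real^'m::finite))"
  by (subst covector_expand[OF assms(1)]) (intro continuous_intros continuous_on_component assms)

lemma borel_measurable_covector:
  fixes v :: "'n::finite \<Rightarrow> 'a \<Rightarrow> real^'m::finite"
  assumes "covector \<omega>" "\<And>j. v j \<in> borel_measurable M"
  shows "(\<lambda>x. \<omega> (\<lambda>j. v j x)) \<in> borel_measurable M"
proof -
  have "(\<lambda>x. v j x $ i) \<in> borel_measurable M" for i j
    using measurable_compose[OF assms(2) borel_measurable_continuous_onI[OF continuous_on_component[OF continuous_on_id]]]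
    by simp
  then show ?thesis by (subst covector_expand[OF assms(1)]) (intro borel_measurable_sum borel_measurable_times borel_measurable_prod borel_measurable_const)
qed

lemma comass_pos:
  fixes \<omega> :: "('n::finite \<Rightarrow> real^'m::finite) \<Rightarrow> real"
  assumes cov: "covector \<omega>" and "\<omega> \<noteq> (\<lambda>_. 0)"
  shows "comass \<omega> > 0"
proof -
  obtain \<sigma> where \<sigma>: "\<omega> (\<lambda>j. axis (\<sigma> j) 1) \<noteq> 0"
  proof (rule ccontr)
    assume "\<not> thesis"
    with that have "\<omega> v = 0" for v
      by (subst covector_expand[OF cov]) (metis (no_types, lifting) mult_zero_right sum.neutral)
    with assms(2) show False by auto
  qed
  have "bdd_above ((\<lambda>v. \<bar>\<omega> v\<bar>) ` {v. \<forall>i. norm (v i) = 1})"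
    by (rule bdd_aboveI2[of _ _ "covector_bound \<omega>"])
      (metis (mono_tags, lifting) abs_covector_le[OF cov] mem_Collect_eq mult.right_neutral prod.neutral)
  hence "\<bar>\<omega> (\<lambda>j. axis (\<sigma> j) 1)\<bar> \<le> comass \<omega>"
    unfolding comass_def by (rule cSUP_upper[rotated]) (auto simp: norm_axis_1)
  with \<sigma> show ?thesis by linarith
qed

section \<open>A Caccioppoli identity for twice differentiable maps\<close>

lemma has_derivative_imp_continuous_on:
  assumes "\<And>x. (f has_derivative f' x) (at x)"
  shows "continuous_on UNIV f"
  by (rule continuous_at_imp_continuous_on) (intro ballI has_derivative_continuous[OF assms])

text \<open>Difference quotients integrate to zero because Lebesgue measure is translation invariant, and
  on a compact set they converge to the derivative under a bounded majorant.\<close>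

lemma integral_directional_derivative_eq_0:
  fixes u :: "'a::euclidean_space \<Rightarrow> real"
  assumes der: "\<And>x. (u has_derivative u' x) (at x)"
    and cont: "continuous_on UNIV (\<lambda>x. u' x e)"
    and supp: "\<And>x. norm x > R \<Longrightarrow> u x = 0"
  shows "integrable lborel (\<lambda>x. u' x e)" "(LINT x|lborel. u' x e) = 0"
proof -
  define B where "B = cball (0::'a) (R + norm e)"
  have "compact ((\<lambda>x. u' x e) ` cball 0 (R + 2 * norm e))"
    by (intro compact_continuous_image continuous_on_subset[OF cont]) auto
  then obtain M0 where "\<forall>y\<in>((\<lambda>x. u' x e) ` cball 0 (R + 2 * norm e)). norm y \<le> M0"
    using compact_imp_bounded bounded_iff by metis
  then obtain M where M: "\<And>x. norm x \<le> R + 2 * norm e \<Longrightarrow> \<bar>u' x e\<bar> \<le> M" and M0: "M \<ge> 0"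
    by (auto intro!: that[of "max 0 M0"] simp: le_max_iff_disj)
  have line: "((\<lambda>t. u (x + t *\<^sub>R e)) has_real_derivative u' (x + t *\<^sub>R e) e) (at t)" for x t
  proof -
    have "((\<lambda>t. u (x + t *\<^sub>R e)) has_derivative (\<lambda>h. u' (x + t *\<^sub>R e) (h *\<^sub>R e))) (at t)"
      by (rule has_derivative_compose[OF _ der]) (auto intro!: derivative_eq_intros)
    moreover have "u' y (h *\<^sub>R e) = u' y e * h" for y h
      using has_derivative_linear[OF der] by (simp add: linear_scale)
    ultimately show ?thesis by (simp add: has_field_derivative_def)
  qed
  define h where "h = (\<lambda>k::nat. inverse (real (Suc k)))"
  have h: "0 < h k" "h k \<le> 1" for k by (auto simp: h_def field_simps)
  have hlim: "filterlim h (at 0) sequentially"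
    unfolding filterlim_at h_def using LIMSEQ_inverse_real_of_nat by auto
  define G where "G k x = (u (x + h k *\<^sub>R e) - u x) / h k" for k x
  have Glim: "(\<lambda>k. G k x) \<longlonglongrightarrow> u' x e" for x
  proof -
    have "((\<lambda>t. (u (x + t *\<^sub>R e) - u x) / t) \<longlongrightarrow> u' x e) (at 0)"
      using line[of x 0] by (simp add: has_field_derivative_iff)
    from filterlim_compose[OF this hlim] show ?thesis by (simp add: G_def)
  qed
  have Gbound: "norm (G k x) \<le> M * indicator B x" for k x
  proof (cases "x \<in> B")
    case True
    have "\<exists>z>0. z < h k \<and> u (x + h k *\<^sub>R e) - u (x + 0 *\<^sub>R e) = (h k - 0) * u' (x + z *\<^sub>R e) e"
      by (rule MVT2[OF h(1)]) (use line in blast)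
    then obtain z where z: "z > 0" "z < h k" "G k x = u' (x + z *\<^sub>R e) e"
      using h(1)[of k] by (auto simp: G_def)
    have "norm (x + z *\<^sub>R e) \<le> norm x + z * norm e"
      using norm_triangle_ineq[of x "z *\<^sub>R e"] z by simp
    also have "\<dots> \<le> R + norm e + 1 * norm e"
      using True z h(2)[of k] by (intro add_mono mult_right_mono) (auto simp: B_def)
    finally show ?thesis using M[of "x + z *\<^sub>R e"] z True by simp
  next
    case False
    have "norm x \<le> norm (x + h k *\<^sub>R e) + h k * norm e"
      using norm_triangle_ineq4[of "x + h k *\<^sub>R e" "h k *\<^sub>R e"] h(1)[of k] by simp
    moreover have "h k * norm e \<le> norm e" using h[of k] by (simp add: mult_left_le_one_le)
    moreover have "norm x > R + norm e" using False by (simp add: B_def)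
    ultimately have "norm (x + h k *\<^sub>R e) > R" "norm x > R"
      using norm_ge_zero[of e] by linarith+
    then show ?thesis using supp False by (simp add: G_def)
  qed
  have ucont: "continuous_on UNIV u"
    by (rule has_derivative_imp_continuous_on, rule der)
  have umeas[measurable]: "u \<in> borel_measurable borel"
    using ucont by (rule borel_measurable_continuous_onI)
  have u'meas: "(\<lambda>x. u' x e) \<in> borel_measurable lborel"
    using borel_measurable_continuous_onI[OF cont] by simp
  have intB: "integrable lborel (\<lambda>x. M * indicator B x)"
    using emeasure_bounded_finite[of B] by (auto simp: B_def)
  have Gmeas: "G k \<in> borel_measurable lborel" for k
    unfolding G_def by measurable
  have uint: "integrable lborel u"
  proof -
    have "integrable lborel (\<lambda>x. indicator (cball 0 R) x *\<^sub>R u x)"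
      using borel_integrable_compact[of "cball 0 R" u] ucont continuous_on_subset[OF ucont] by auto
    moreover have "(\<lambda>x. indicator (cball 0 R) x *\<^sub>R u x) = u"
      using supp by (auto simp: fun_eq_iff indicator_def not_le)
    ultimately show ?thesis by simp
  qed
  have trans: "integrable lborel (\<lambda>x. u (x + c))" "(LINT x|lborel. u (x + c)) = (LINT x|lborel. u x)" for c
  proof -
    have *: "lborel = distr lborel borel (\<lambda>x. x + c)"
      unfolding add.commute[of _ c] using lborel_distr_plus[of c] by simp
    show "integrable lborel (\<lambda>x. u (x + c))"
      using uint by (subst (asm) *) (subst (asm) integrable_distr_eq, auto)
    show "(LINT x|lborel. u (x + c)) = (LINT x|lborel. u x)"
      by (subst (2) *) (subst integral_distr, auto)
  qed
  have "(LINT x|lborel. G k x) = 0" for k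
    unfolding G_def using trans uint by simp
  moreover have "(\<lambda>k. LINT x|lborel. G k x) \<longlonglongrightarrow> (LINT x|lborel. u' x e)"
    by (rule integral_dominated_convergence[where s = G, OF u'meas Gmeas intB]) (use Glim Gbound in auto)
  ultimately show "(LINT x|lborel. u' x e) = 0" by (simp add: LIMSEQ_const_iff)
  show "integrable lborel (\<lambda>x. u' x e)"
    by (rule integrable_dominated_convergence[where s = G, OF u'meas Gmeas intB]) (use Glim Gbound in auto)
qed

text \<open>The partial derivatives are part of the data because they are known explicitly for the
  mollified maps to which the predicate is applied.\<close>

definition C2_map :: "(real^'n::finite \<Rightarrow> 'b::real_normed_vector) \<Rightarrow> ('n \<Rightarrow> real^'n \<Rightarrow> 'b) \<Rightarrow>
    ('n \<Rightarrow> 'n \<Rightarrow> real^'n \<Rightarrow> 'b) \<Rightarrow> bool" where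
  "C2_map g g1 g2 \<longleftrightarrow>
     (\<forall>x. (g has_derivative (\<lambda>h. \<Sum>i\<in>UNIV. h $ i *\<^sub>R g1 i x)) (at x)) \<and>
     (\<forall>i x. (g1 i has_derivative (\<lambda>h. \<Sum>j\<in>UNIV. h $ j *\<^sub>R g2 i j x)) (at x)) \<and>
     (\<forall>i j. continuous_on UNIV (g2 i j)) \<and>
     (\<forall>i j x. i \<noteq> j \<longrightarrow> g2 i j x = g2 j i x)"

lemma C2_mapD:
  assumes "C2_map g g1 g2"
  shows "(g has_derivative (\<lambda>h. \<Sum>i\<in>UNIV. h $ i *\<^sub>R g1 i x)) (at x)"
    "(g1 i has_derivative (\<lambda>h. \<Sum>j\<in>UNIV. h $ j *\<^sub>R g2 i j x)) (at x)"
    "continuous_on UNIV (g2 i j)" "i \<noteq> j \<Longrightarrow> g2 i j x = g2 j i x"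
proof -
  note C = assms[unfolded C2_map_def]
  show "(g has_derivative (\<lambda>h. \<Sum>i\<in>UNIV. h $ i *\<^sub>R g1 i x)) (at x)"
    by (rule C[THEN conjunct1, THEN spec])
  show "(g1 i has_derivative (\<lambda>h. \<Sum>j\<in>UNIV. h $ j *\<^sub>R g2 i j x)) (at x)"
    by (rule C[THEN conjunct2, THEN conjunct1, THEN spec, THEN spec])
  show "continuous_on UNIV (g2 i j)"
    by (rule C[THEN conjunct2, THEN conjunct2, THEN conjunct1, THEN spec, THEN spec])
  show "i \<noteq> j \<Longrightarrow> g2 i j x = g2 j i x"
    by (rule C[THEN conjunct2, THEN conjunct2, THEN conjunct2, THEN spec, THEN spec, THEN spec, THEN mp])
qed

lemma C2_map_continuous:
  assumes "C2_map g g1 g2"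
  shows "continuous_on UNIV g" "continuous_on UNIV (g1 i)"
  by (rule has_derivative_imp_continuous_on, rule C2_mapD[OF assms])+

lemma C2_map_shift:
  assumes "C2_map g g1 g2"
  shows "C2_map (\<lambda>x. g x - c) g1 g2"
  unfolding C2_map_def
proof (intro conjI allI impI)
  show "((\<lambda>x. g x - c) has_derivative (\<lambda>h. \<Sum>i\<in>UNIV. h $ i *\<^sub>R g1 i x)) (at x)" for x
    using has_derivative_diff[OF C2_mapD(1)[OF assms] has_derivative_const[of c]]
    by (simp only: diff_zero)
qed (rule C2_mapD[OF assms], assumption?)+

lemma sum_axis_scaleR: "(\<Sum>i\<in>UNIV. (axis k 1 :: real^'n::finite) $ i *\<^sub>R f i) = (f k :: 'b::real_vector)"
proof -
  have "(\<Sum>i\<in>UNIV. (axis k 1 :: real^'n) $ i *\<^sub>R f i) = (\<Sum>i\<in>UNIV. if i = k then f i else 0)"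
    by (rule sum.cong) (auto simp: axis_def)
  then show ?thesis by simp
qed

text \<open>The fields \<open>\<psi> \<omega>(g\<^sub>1, \<dots>, g, \<dots>, g\<^sub>n)\<close>, with \<open>g\<close> itself in slot \<open>i\<close>, are differentiated in direction
  \<open>i\<close> and summed over \<open>i\<close>.  The derivative of the entry \<open>g\<close> restores \<open>\<omega>(g\<^sub>1, \<dots>, g\<^sub>n)\<close> for each of the
  \<open>n\<close> values of \<open>i\<close>.  The terms with a second derivative in slot \<open>j\<close> cancel against those with
  \<open>i\<close> and \<open>j\<close> exchanged: mixed derivatives are symmetric and \<open>\<omega>\<close> is alternating.  This is the
  closedness of the pulled back form.\<close>

lemma integral_cutoff_covector:
  fixes \<omega> :: "('n::finite \<Rightarrow> real^'m::finite) \<Rightarrow> real" and g :: "real^'n \<Rightarrow> real^'m"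
  assumes cov: "covector \<omega>" and g: "C2_map g g1 g2"
    and \<psi>: "\<And>x. (\<psi> has_derivative (\<lambda>h. \<Sum>i\<in>UNIV. h $ i *\<^sub>R \<psi>1 i x)) (at x)"
    and \<psi>1: "\<And>i. continuous_on UNIV (\<psi>1 i)"
    and supp: "\<And>x. norm x > R \<Longrightarrow> \<psi> x = 0"
  shows "real CARD('n) * (LINT x|lborel. \<psi> x * \<omega> (\<lambda>i. g1 i x)) =
    - (LINT x|lborel. (\<Sum>i\<in>UNIV. \<psi>1 i x * \<omega> ((\<lambda>j. g1 j x)(i := g x))))"
proof -
  note gd = C2_mapD[OF g] and gc = C2_map_continuous[OF g]
  have \<psi>c: "continuous_on UNIV \<psi>"
    by (rule has_derivative_imp_continuous_on, rule \<psi>)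
  define J where "J x = \<omega> (\<lambda>i. g1 i x)" for x
  define Q where "Q i x = \<omega> ((\<lambda>j. g1 j x)(i := g x))" for i x
  \<comment> \<open>\<open>Q i\<close> has \<open>g\<close> in slot \<open>i\<close>; \<open>X i j\<close> has in addition a second derivative in slot \<open>j\<close>.\<close>
  define X where "X i j x = \<omega> ((\<lambda>j. g1 j x)(i := g x, j := g2 j i x))" for i j x
  have Qd: "(Q i has_derivative (\<lambda>h. \<Sum>j\<in>UNIV. \<omega> ((\<lambda>k. g1 k x)(i := g x,
        j := \<Sum>l\<in>UNIV. h $ l *\<^sub>R (if j = i then g1 l x else g2 j l x))))) (at x)" for i x
  proof -
    have "((\<lambda>x. \<omega> (\<lambda>j. (if j = i then g else g1 j) x)) has_derivative
       (\<lambda>h. \<Sum>j\<in>UNIV. \<omega> ((\<lambda>j. (if j = i then g else g1 j) x)(j := 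
          (\<lambda>h. \<Sum>l\<in>UNIV. h $ l *\<^sub>R (if j = i then g1 l x else g2 j l x)) h)))) (at x)"
      by (rule has_derivative_covector[OF cov]) (use gd(1,2) in auto)
    moreover have "(\<lambda>j. (if j = i then g else g1 j) y) = (\<lambda>k. g1 k y)(i := g y)" for y
      by auto
    ultimately show ?thesis unfolding Q_def by simp
  qed
  define P' where "P' i x h = (\<Sum>l\<in>UNIV. h $ l *\<^sub>R \<psi>1 l x) * Q i x +
     \<psi> x * (\<Sum>j\<in>UNIV. \<omega> ((\<lambda>k. g1 k x)(i := g x,
        j := \<Sum>l\<in>UNIV. h $ l *\<^sub>R (if j = i then g1 l x else g2 j l x))))" for i x and h :: "real^'n"
  have Pd: "((\<lambda>x. \<psi> x * Q i x) has_derivative P' i x) (at x)" for i x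
    unfolding P'_def by (rule has_derivative_eq_rhs[OF has_derivative_mult[OF \<psi> Qd]]) (simp add: fun_eq_iff algebra_simps)
  have P'e: "P' i x (axis i 1) = \<psi>1 i x * Q i x + \<psi> x * (J x + (\<Sum>j\<in>UNIV - {i}. X i j x))" for i x
  proof -
    have "(\<Sum>j\<in>UNIV. \<omega> ((\<lambda>k. g1 k x)(i := g x, j := if j = i then g1 i x else g2 j i x)))
      = J x + (\<Sum>j\<in>UNIV - {i}. X i j x)"
      by (subst sum.remove[of _ i]) (auto simp: J_def X_def intro!: sum.cong arg_cong[of _ _ \<omega>])
    then show ?thesis unfolding P'_def by (simp add: sum_axis_scaleR sum_axis_scaleR[where 'b = real, simplified])
  qed
  have Qc: "continuous_on UNIV (Q i)" for i
    by (rule has_derivative_imp_continuous_on, rule Qd)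
  have Jc: "continuous_on UNIV J"
    unfolding J_def by (intro continuous_on_covector cov gc)
  have Xc: "continuous_on UNIV (X i j)" for i j
  proof -
    have "continuous_on UNIV (\<lambda>x. \<omega> (\<lambda>k. ((\<lambda>k. g1 k x)(i := g x, j := g2 j i x)) k))"
    proof (rule continuous_on_covector[OF cov])
      show "continuous_on UNIV (\<lambda>x. ((\<lambda>k. g1 k x)(i := g x, j := g2 j i x)) k)" for k
        by (cases "k = j"; cases "k = i") (simp_all add: gc gd(3))
    qed
    then show ?thesis unfolding X_def .
  qed
  have P'c: "continuous_on UNIV (\<lambda>x. P' i x (axis i 1))" for i
    unfolding P'e by (intro continuous_intros \<psi>c \<psi>1 Qc Jc Xc)
  have Psupp: "\<psi> x * Q i x = 0" if "norm x > R" for i x using supp that by simp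
  note int = integral_directional_derivative_eq_0[OF Pd P'c Psupp]
  have X_anti: "X i j x = - X j i x" if "i \<noteq> j" for i j x
  proof -
    have "(\<lambda>k. g1 k x)(j := g x, i := g2 i j x) = ((\<lambda>k. g1 k x)(i := g x, j := g2 j i x)) \<circ> Transposition.transpose i j"
      using that gd(4)[OF that] by (auto simp: fun_eq_iff Transposition.transpose_def)
    then show ?thesis using covector_swap[OF cov that] by (simp add: X_def)
  qed
  have "(\<Sum>i\<in>UNIV. \<Sum>j\<in>UNIV - {i}. X i j x) = 0" for x
  proof -
    have eq: "(\<Sum>i\<in>UNIV. \<Sum>j\<in>UNIV - {i}. f i j) = (\<Sum>i\<in>UNIV. \<Sum>j\<in>UNIV. if i = j then 0 else f i j)" for f :: "'n \<Rightarrow> 'n \<Rightarrow> real"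
    proof (rule sum.cong[OF refl])
      fix i :: 'n
      have "(\<Sum>j\<in>UNIV. if i = j then 0 else f i j) = (\<Sum>j\<in>UNIV - {i}. if i = j then 0 else f i j)"
        by (subst sum.remove[of _ i]) auto
      moreover have "(\<Sum>j\<in>UNIV - {i}. f i j) = (\<Sum>j\<in>UNIV - {i}. if i = j then 0 else f i j)"
        by (rule sum.cong) auto
      ultimately show "(\<Sum>j\<in>UNIV - {i}. f i j) = (\<Sum>j\<in>UNIV. if i = j then 0 else f i j)"
        by (simp only:)
    qed
    have "(\<Sum>i\<in>UNIV. \<Sum>j\<in>UNIV. if i = j then 0 else X i j x) = (\<Sum>j\<in>UNIV. \<Sum>i\<in>UNIV. if i = j then 0 else X i j x)"
      by (rule sum.swap)
    also have "\<dots> = - (\<Sum>j\<in>UNIV. \<Sum>i\<in>UNIV. if j = i then 0 else X j i x)"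
      unfolding sum_negf[symmetric] by (intro sum.cong refl) (metis X_anti minus_zero)
    finally show ?thesis unfolding eq by simp
  qed
  then have sumP': "(\<Sum>i\<in>UNIV. P' i x (axis i 1)) = (\<Sum>i\<in>UNIV. \<psi>1 i x * Q i x) + real CARD('n) * (\<psi> x * J x)" for x
    unfolding P'e by (simp add: sum.distrib sum_distrib_left[symmetric] distrib_left)
  have "integrable lborel (\<lambda>x. indicator (cball 0 R) x *\<^sub>R (\<psi> x * J x))"
    by (rule borel_integrable_compact) (auto intro!: continuous_intros continuous_on_subset[OF \<psi>c] continuous_on_subset[OF Jc])
  moreover have "(\<lambda>x. indicator (cball 0 R) x *\<^sub>R (\<psi> x * J x)) = (\<lambda>x. \<psi> x * J x)"
    using supp by (auto simp: fun_eq_iff indicator_def not_le)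
  ultimately have Jint: "integrable lborel (\<lambda>x. \<psi> x * J x)" by simp
  have 0: "(LINT x|lborel. (\<Sum>i\<in>UNIV. P' i x (axis i 1))) = 0"
    by (subst Bochner_Integration.integral_sum) (use int in auto)
  have eq: "(\<Sum>i\<in>UNIV. \<psi>1 i x * Q i x) = (\<Sum>i\<in>UNIV. P' i x (axis i 1)) - real CARD('n) * (\<psi> x * J x)" for x
    using sumP'[of x] by simp
  have "(LINT x|lborel. (\<Sum>i\<in>UNIV. \<psi>1 i x * Q i x)) = - (real CARD('n) * (LINT x|lborel. \<psi> x * J x))"
    unfolding eq using Jint int(1) 0 by (subst Bochner_Integration.integral_diff) auto
  then show ?thesis by (simp add: J_def Q_def)
qed

section \<open>A Poincare inequality on the boundary layer of a cube\<close>

lemma power_tangent_le: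
  fixes s u :: real
  assumes "s \<ge> 0" "u \<ge> 0"
  shows "real (Suc p) * s ^ p * u \<le> u ^ Suc p + real p * s ^ Suc p"
proof (induction p)
  case (Suc p)
  have "u ^ Suc (Suc p) + real (Suc p) * s ^ Suc (Suc p) - real (Suc (Suc p)) * s ^ Suc p * u
    = u * (u ^ Suc p + real p * s ^ Suc p - real (Suc p) * s ^ p * u) + real (Suc p) * s ^ p * (u - s)\<^sup>2"
    by (simp add: algebra_simps power2_eq_square)
  also have "\<dots> \<ge> 0" using Suc assms by (intro add_nonneg_nonneg mult_nonneg_nonneg) auto
  finally show ?case by simp
qed simp

text \<open>Jensen's inequality for powers: integrate the tangent of \<open>u \<mapsto> u ^ p\<close> at the mean of \<open>u\<close>.\<close>

lemma power_nn_integral_le: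
  fixes u :: "'a \<Rightarrow> ennreal"
  assumes M: "emeasure M (space M) = 1" and u[measurable]: "u \<in> borel_measurable M" and p: "p \<ge> 1"
  shows "(\<integral>\<^sup>+x. u x \<partial>M) ^ p \<le> (\<integral>\<^sup>+x. u x ^ p \<partial>M)"
proof -
  obtain q where q: "p = Suc q" using p by (cases p) auto
  show ?thesis
  proof (cases "(\<integral>\<^sup>+x. u x \<partial>M)")
    case top
    have "u x \<le> 1 + u x ^ p" for x
    proof (cases "u x \<le> 1")
      case False
      then have "u x ^ 1 \<le> u x ^ p" by (intro power_increasing p) auto
      also have "\<dots> \<le> 1 + u x ^ p" by simp
      finally show ?thesis by simp
    qed (simp add: add_increasing2)
    then have "(\<integral>\<^sup>+x. u x \<partial>M) \<le> (\<integral>\<^sup>+x. 1 + u x ^ p \<partial>M)" by (intro nn_integral_mono)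
    also have "\<dots> = 1 + (\<integral>\<^sup>+x. u x ^ p \<partial>M)" by (subst nn_integral_add) (auto simp: M)
    finally have "(\<integral>\<^sup>+x. u x ^ p \<partial>M) = top" using top by (simp add: top_unique)
    then show ?thesis by simp
  next
    case (real s)
    have *: "ennreal (real p * s ^ q) * u x \<le> u x ^ p + ennreal (real q * s ^ p)" for x
    proof (cases "u x")
      case (real v)
      then show ?thesis
        using power_tangent_le[of s v q] \<open>0 \<le> s\<close>
        by (simp add: q ennreal_mult[symmetric] ennreal_power ennreal_plus[symmetric] ennreal_leI del: ennreal_plus)
    qed (auto simp: q top_add)
    have "ennreal (real p * s ^ q) * ennreal s = (\<integral>\<^sup>+x. ennreal (real p * s ^ q) * u x \<partial>M)"
      by (subst nn_integral_cmult) (auto simp: real)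
    also have "\<dots> \<le> (\<integral>\<^sup>+x. u x ^ p + ennreal (real q * s ^ p) \<partial>M)"
      by (intro nn_integral_mono *)
    also have "\<dots> = (\<integral>\<^sup>+x. u x ^ p \<partial>M) + ennreal (real q * s ^ p)"
      by (subst nn_integral_add) (auto simp: M)
    finally have "ennreal (s ^ p) + ennreal (real q * s ^ p) \<le> (\<integral>\<^sup>+x. u x ^ p \<partial>M) + ennreal (real q * s ^ p)"
      using \<open>0 \<le> s\<close> by (simp add: q ennreal_mult[symmetric] ennreal_plus[symmetric] algebra_simps del: ennreal_plus)
    then have "ennreal (s ^ p) \<le> (\<integral>\<^sup>+x. u x ^ p \<partial>M)"
      by (simp add: ennreal_add_left_cancel_le add.commute)
    then show ?thesis using real by (simp add: ennreal_power)
  qed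
qed

lemma nn_integral_lborel_affine:
  fixes F :: "'a::euclidean_space \<Rightarrow> ennreal"
  assumes [measurable]: "F \<in> borel_measurable borel" and "c \<noteq> 0"
  shows "(\<integral>\<^sup>+x. F x \<partial>lborel) = ennreal (\<bar>c\<bar> ^ DIM('a)) * (\<integral>\<^sup>+x. F (t + c *\<^sub>R x) \<partial>lborel)"
  by (subst lborel_affine[OF assms(2), of t])
     (simp add: nn_integral_density nn_integral_distr nn_integral_cmult)

text \<open>A point of a segment may be substituted for the endpoint of larger weight; that weight is at
  least one half, so the Jacobian costs at most \<open>2 ^ DIM('a)\<close>.\<close>

lemma nn_integral_lborel_affine_le:
  fixes F :: "'a::euclidean_space \<Rightarrow> ennreal"
  assumes F: "F \<in> borel_measurable borel" and c: "c \<ge> 1/2"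
  shows "(\<integral>\<^sup>+x. F (t + c *\<^sub>R x) \<partial>lborel) \<le> 2 ^ DIM('a) * (\<integral>\<^sup>+x. F x \<partial>lborel)"
proof -
  have "1 \<le> 2 ^ DIM('a) * c ^ DIM('a)"
    unfolding power_mult_distrib[symmetric] using c by (intro one_le_power) auto
  then have "1 \<le> ennreal (2 ^ DIM('a)) * ennreal (\<bar>c\<bar> ^ DIM('a))"
    using c by (simp add: ennreal_mult[symmetric] ennreal_leI flip: ennreal_1)
  then have "1 * (\<integral>\<^sup>+x. F (t + c *\<^sub>R x) \<partial>lborel) \<le> ennreal (2 ^ DIM('a)) * ennreal (\<bar>c\<bar> ^ DIM('a)) * (\<integral>\<^sup>+x. F (t + c *\<^sub>R x) \<partial>lborel)"
    by (rule mult_right_mono) simp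
  also have "\<dots> = ennreal (2 ^ DIM('a)) * (\<integral>\<^sup>+x. F x \<partial>lborel)"
    using c by (subst nn_integral_lborel_affine[OF F, of c t]) (auto simp: mult.assoc)
  finally show ?thesis by (simp add: ennreal_power[symmetric])
qed

text \<open>The fundamental theorem of calculus along the segment, followed by Jensen's inequality.\<close>

lemma norm_diff_power_le_segment:
  fixes g :: "'a::euclidean_space \<Rightarrow> 'b::euclidean_space"
  assumes der: "\<And>x. (g has_derivative g' x) (at x)"
    and g'c: "\<And>h. continuous_on UNIV (\<lambda>x. g' x h)"
    and g'S: "\<And>x h. norm (g' x h) \<le> S x * norm h"
    and Sc: "continuous_on UNIV S"
    and d: "norm (x - y) \<le> d" and p: "p \<ge> 1"
  shows "ennreal (norm (g x - g y) ^ p) \<le>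
    ennreal (d ^ p) * (\<integral>\<^sup>+t. indicator {0..1} t * ennreal (S ((1 - t) *\<^sub>R y + t *\<^sub>R x) ^ p) \<partial>lborel)"
proof -
  define \<gamma> where "\<gamma> t = (1 - t) *\<^sub>R y + t *\<^sub>R x" for t
  have S0: "S z \<ge> 0" for z
  proof -
    obtain b :: 'a where "b \<in> Basis" using nonempty_Basis by blast
    then show ?thesis using order_trans[OF norm_ge_zero g'S[of z b]] by simp
  qed
  have d0: "d \<ge> 0" using order_trans[OF norm_ge_zero d] .
  have \<gamma>c: "continuous_on A \<gamma>" for A unfolding \<gamma>_def by (intro continuous_intros)
  have vd: "((\<lambda>t. g (\<gamma> t)) has_vector_derivative g' (\<gamma> t) (x - y)) (at t within T)" for t T
  proof -
    have "(\<gamma> has_vector_derivative (x - y)) (at t within T)"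
      unfolding \<gamma>_def by (auto intro!: derivative_eq_intros simp: algebra_simps)
    then show ?thesis
      using vector_derivative_diff_chain_within[OF _ has_derivative_at_withinI[OF der], of \<gamma> "x - y" t T]
      by (simp add: o_def)
  qed
  have cc: "continuous_on {0..1} (\<lambda>t. g' (\<gamma> t) (x - y))"
    using continuous_on_compose2[OF g'c \<gamma>c] by simp
  have "(LINT t|lborel. indicator {0..1} t *\<^sub>R g' (\<gamma> t) (x - y)) = g (\<gamma> 1) - g (\<gamma> 0)"
    by (rule integral_FTC_atLeastAtMost) (use vd cc in auto)
  then have "ennreal (norm (g x - g y)) = ennreal (norm (LINT t|lborel. indicator {0..1} t *\<^sub>R g' (\<gamma> t) (x - y)))"
    by (simp add: \<gamma>_def)
  also have "\<dots> \<le> (\<integral>\<^sup>+t. ennreal (norm (indicator {0..1} t *\<^sub>R g' (\<gamma> t) (x - y))) \<partial>lborel)"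
    by (intro integral_norm_bound_ennreal borel_integrable_compact cc) auto
  also have "\<dots> \<le> (\<integral>\<^sup>+t. indicator {0..1} t * ennreal (d * S (\<gamma> t)) \<partial>lborel)"
  proof (rule nn_integral_mono)
    fix t
    have "norm (g' (\<gamma> t) (x - y)) \<le> S (\<gamma> t) * d"
      using g'S[of "\<gamma> t" "x - y"] mult_left_mono[OF d S0] by (rule order_trans)
    then show "ennreal (norm (indicator {0..1} t *\<^sub>R g' (\<gamma> t) (x - y))) \<le> indicator {0..1} t * ennreal (d * S (\<gamma> t))"
      by (auto simp: indicator_def mult.commute intro: ennreal_leI)
  qed
  finally have 1: "ennreal (norm (g x - g y)) \<le> (\<integral>\<^sup>+t. ennreal (d * S (\<gamma> t)) \<partial>restrict_space lborel {0..1})"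
    by (simp add: nn_integral_restrict_space mult.commute)
  have meas: "(\<lambda>t. S (\<gamma> t)) \<in> borel_measurable borel"
    by (rule borel_measurable_continuous_onI) (use continuous_on_compose2[OF Sc \<gamma>c] in auto)
  have "ennreal (norm (g x - g y)) ^ p \<le> (\<integral>\<^sup>+t. ennreal (d * S (\<gamma> t)) \<partial>restrict_space lborel {0..1}) ^ p"
    by (intro power_mono 1) auto
  also have "\<dots> \<le> (\<integral>\<^sup>+t. ennreal (d * S (\<gamma> t)) ^ p \<partial>restrict_space lborel {0..1})"
    by (rule power_nn_integral_le)
      (use p meas in \<open>auto simp: space_restrict_space emeasure_restrict_space intro!: measurable_restrict_space1\<close>)
  also have "\<dots> = (\<integral>\<^sup>+t. ennreal (d ^ p) * (indicator {0..1} t * ennreal (S (\<gamma> t) ^ p)) \<partial>lborel)"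
    using d0 S0 by (simp add: nn_integral_restrict_space ennreal_power power_mult_distrib ennreal_mult mult_ac)
  also have "\<dots> = ennreal (d ^ p) * (\<integral>\<^sup>+t. indicator {0..1} t * ennreal (S (\<gamma> t) ^ p) \<partial>lborel)"
    by (rule nn_integral_cmult) (use meas in measurable)
  finally show ?thesis by (simp add: ennreal_power \<gamma>_def)
qed

text \<open>With \<open>k x y = \<bar>g x - g y\<bar>\<^sup>p\<close> this measures how far \<open>g\<close> on \<open>A\<close> is from \<open>g\<close> on \<open>B\<close>.  The double integral
  replaces the distance to a mean value: unlike the latter it can be chained from set to set.\<close>

definition osc :: "('a::euclidean_space \<Rightarrow> 'a \<Rightarrow> ennreal) \<Rightarrow> 'a set \<Rightarrow> 'a set \<Rightarrow> ennreal" where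
  "osc k A B = (\<integral>\<^sup>+x\<in>A. (\<integral>\<^sup>+y\<in>B. k x y \<partial>lborel) \<partial>lborel)"

text \<open>The segment estimate is integrated over both endpoints and Fubini moves the parameter \<open>t\<close> of
  the segment outside.  For each \<open>t\<close> one of the weights \<open>t\<close> and \<open>1 - t\<close> is at least one half, and the
  point of the segment is substituted for the endpoint that carries it.\<close>

lemma osc_convex_le:
  fixes g :: "'a::euclidean_space \<Rightarrow> 'b::euclidean_space"
  assumes der: "\<And>x. (g has_derivative g' x) (at x)"
    and g'c: "\<And>h. continuous_on UNIV (\<lambda>x. g' x h)"
    and g'S: "\<And>x h. norm (g' x h) \<le> S x * norm h"
    and Sc: "continuous_on UNIV S"
    and C: "convex C" and [measurable]: "C \<in> sets borel"
    and d: "\<And>x y. x \<in> C \<Longrightarrow> y \<in> C \<Longrightarrow> norm (x - y) \<le> d" and p: "p \<ge> 1"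
  shows "osc (\<lambda>x y. ennreal (norm (g x - g y) ^ p)) C C \<le>
    ennreal (d ^ p) * (2 ^ DIM('a) * (emeasure lborel C * (\<integral>\<^sup>+x\<in>C. ennreal (S x ^ p) \<partial>lborel)))"
proof -
  have [measurable]: "S \<in> borel_measurable borel"
    using Sc by (rule borel_measurable_continuous_onI)
  define F where "F x = ennreal (S x ^ p) * indicator C x" for x
  have [measurable]: "F \<in> borel_measurable borel" unfolding F_def by measurable
  define I where "I = (\<integral>\<^sup>+x. F x \<partial>lborel)"
  define H where "H t x y = (indicator {0..1::real} t * F ((1 - t) *\<^sub>R y + t *\<^sub>R x)) * (indicator C x * indicator C y)" for t x y
  have [measurable (raw)]: "(\<lambda>z. H (a z) (b z) (c z)) \<in> borel_measurable N"
    if [measurable]: "a \<in> borel_measurable N" "b \<in> borel_measurable N" "c \<in> borel_measurable N"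
    for a b c and N :: "'z measure"
    unfolding H_def by measurable
  have inner: "(\<integral>\<^sup>+x. \<integral>\<^sup>+y. H t x y \<partial>lborel \<partial>lborel) \<le> indicator {0..1} t * (2 ^ DIM('a) * (emeasure lborel C * I))" for t
  proof (cases "t \<in> {0..1}")
    case True
    have one: "(\<integral>\<^sup>+x. \<integral>\<^sup>+y. F (c *\<^sub>R y + b *\<^sub>R x) * (indicator C x * indicator C y) \<partial>lborel \<partial>lborel)
      \<le> 2 ^ DIM('a) * (emeasure lborel C * I)" if "c \<ge> 1/2" for b c :: real
    proof -
      have "(\<integral>\<^sup>+x. \<integral>\<^sup>+y. F (c *\<^sub>R y + b *\<^sub>R x) * (indicator C x * indicator C y) \<partial>lborel \<partial>lborel)
        \<le> (\<integral>\<^sup>+x. indicator C x * (2 ^ DIM('a) * I) \<partial>lborel)"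
      proof (rule nn_integral_mono)
        fix x
        have "(\<integral>\<^sup>+y. F (c *\<^sub>R y + b *\<^sub>R x) * (indicator C x * indicator C y) \<partial>lborel)
          \<le> (\<integral>\<^sup>+y. indicator C x * F (b *\<^sub>R x + c *\<^sub>R y) \<partial>lborel)"
          by (rule nn_integral_mono) (auto simp: indicator_def add.commute)
        also have "\<dots> = indicator C x * (\<integral>\<^sup>+y. F (b *\<^sub>R x + c *\<^sub>R y) \<partial>lborel)"
          by (rule nn_integral_cmult) measurable
        also have "\<dots> \<le> indicator C x * (2 ^ DIM('a) * I)"
          unfolding I_def by (intro mult_left_mono nn_integral_lborel_affine_le that) auto
        finally show "(\<integral>\<^sup>+y. F (c *\<^sub>R y + b *\<^sub>R x) * (indicator C x * indicator C y) \<partial>lborel)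
          \<le> indicator C x * (2 ^ DIM('a) * I)" .
      qed
      also have "\<dots> = emeasure lborel C * (2 ^ DIM('a) * I)"
        by (subst nn_integral_multc) auto
      finally show ?thesis by (simp add: mult_ac)
    qed
    show ?thesis
    proof (cases "t \<ge> 1/2")
      case False
      then show ?thesis using one[of "1 - t" t] True by (simp add: H_def)
    next
      case t: True
      have "(\<integral>\<^sup>+x. \<integral>\<^sup>+y. H t x y \<partial>lborel \<partial>lborel) = (\<integral>\<^sup>+y. \<integral>\<^sup>+x. H t x y \<partial>lborel \<partial>lborel)"
        by (rule lborel_pair.Fubini') measurable
      also have "\<dots> = (\<integral>\<^sup>+y. \<integral>\<^sup>+x. F (t *\<^sub>R x + (1 - t) *\<^sub>R y) * (indicator C y * indicator C x) \<partial>lborel \<partial>lborel)"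
        using True by (simp add: H_def add.commute mult.commute mult.left_commute)
      finally show ?thesis using one[OF t] True by simp
    qed
  qed (simp add: H_def)
  have "osc (\<lambda>x y. ennreal (norm (g x - g y) ^ p)) C C \<le>
     (\<integral>\<^sup>+x. (\<integral>\<^sup>+y. ennreal (d ^ p) * (\<integral>\<^sup>+t. H t x y \<partial>lborel) \<partial>lborel) \<partial>lborel)"
  proof -
    have "ennreal (norm (g x - g y) ^ p) * indicator C y * indicator C x \<le> ennreal (d ^ p) * (\<integral>\<^sup>+t. H t x y \<partial>lborel)" for x y
    proof (cases "x \<in> C \<and> y \<in> C")
      case True
      have "H t x y = indicator {0..1} t * ennreal (S ((1 - t) *\<^sub>R y + t *\<^sub>R x) ^ p)" for t
        using True convexD_alt[OF C, of y x t] by (auto simp: H_def F_def indicator_def)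
      then show ?thesis
        using norm_diff_power_le_segment[OF der g'c g'S Sc d p, of x y] True by simp
    qed auto
    then show ?thesis
      unfolding osc_def by (subst nn_integral_multc[symmetric]) 
         (use borel_measurable_continuous_onI[OF has_derivative_imp_continuous_on[OF der]] in \<open>auto intro!: nn_integral_mono\<close>)
  qed
  also have "\<dots> = ennreal (d ^ p) * (\<integral>\<^sup>+x. (\<integral>\<^sup>+y. (\<integral>\<^sup>+t. H t x y \<partial>lborel) \<partial>lborel) \<partial>lborel)"
    by (simp add: nn_integral_cmult)
  also have "(\<integral>\<^sup>+x. (\<integral>\<^sup>+y. (\<integral>\<^sup>+t. H t x y \<partial>lborel) \<partial>lborel) \<partial>lborel)
     = (\<integral>\<^sup>+x. (\<integral>\<^sup>+t. (\<integral>\<^sup>+y. H t x y \<partial>lborel) \<partial>lborel) \<partial>lborel)"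
    by (intro nn_integral_cong lborel_pair.Fubini') measurable
  also have "\<dots> = (\<integral>\<^sup>+t. (\<integral>\<^sup>+x. (\<integral>\<^sup>+y. H t x y \<partial>lborel) \<partial>lborel) \<partial>lborel)"
    by (rule lborel_pair.Fubini') measurable
  also have "\<dots> \<le> (\<integral>\<^sup>+t. indicator {0..1::real} t * (2 ^ DIM('a) * (emeasure lborel C * I)) \<partial>lborel)"
    by (intro nn_integral_mono inner)
  also have "\<dots> = 2 ^ DIM('a) * (emeasure lborel C * I)"
    by (subst nn_integral_multc) auto
  finally show ?thesis by (simp add: I_def F_def mult_left_mono)
qed

text \<open>Chaining two oscillations through a third set costs the ratios of the measures.\<close>

lemma osc_chain:
  assumes k[measurable]: "(\<lambda>(x, y). k x y) \<in> borel_measurable (borel \<Otimes>\<^sub>M borel)"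
    and tri: "\<And>x y z. k x y \<le> c * (k x z + k z y)"
    and [measurable]: "A \<in> sets borel" "B \<in> sets borel" "U \<in> sets borel"
  shows "emeasure lborel U * osc k A B \<le> c * (emeasure lborel B * osc k A U + emeasure lborel A * osc k U B)"
proof -
  have [measurable (raw)]: "(\<lambda>z. k (a z) (b z)) \<in> borel_measurable N"
    if [measurable]: "a \<in> borel_measurable N" "b \<in> borel_measurable N" for a b and N :: "'z measure"
    using measurable_compose[of "\<lambda>z. (a z, b z)" N, OF _ k] by simp
  have "emeasure lborel U * osc k A B = (\<integral>\<^sup>+x. \<integral>\<^sup>+y. \<integral>\<^sup>+z. indicator U z * (k x y * indicator B y * indicator A x) \<partial>lborel \<partial>lborel \<partial>lborel)"
    unfolding osc_def by (simp add: nn_integral_multc nn_integral_cmult)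
  also have "\<dots> \<le> (\<integral>\<^sup>+x. \<integral>\<^sup>+y. \<integral>\<^sup>+z. c * (indicator B y * (k x z * indicator U z * indicator A x)
       + indicator A x * (k z y * indicator B y * indicator U z)) \<partial>lborel \<partial>lborel \<partial>lborel)"
  proof (intro nn_integral_mono)
    fix x y z
    show "indicator U z * (k x y * indicator B y * indicator A x) \<le> c * (indicator B y * (k x z * indicator U z * indicator A x)
       + indicator A x * (k z y * indicator B y * indicator U z))"
      using tri[of x y z] by (auto simp: indicator_def)
  qed
  also have "\<dots> = c * ((\<integral>\<^sup>+x. \<integral>\<^sup>+y. \<integral>\<^sup>+z. indicator B y * (k x z * indicator U z * indicator A x) \<partial>lborel \<partial>lborel \<partial>lborel)
     + (\<integral>\<^sup>+x. \<integral>\<^sup>+y. \<integral>\<^sup>+z. indicator A x * (k z y * indicator B y * indicator U z) \<partial>lborel \<partial>lborel \<partial>lborel))"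
    by (simp add: nn_integral_cmult nn_integral_add)
  also have "(\<integral>\<^sup>+x. \<integral>\<^sup>+y. \<integral>\<^sup>+z. indicator B y * (k x z * indicator U z * indicator A x) \<partial>lborel \<partial>lborel \<partial>lborel)
     = emeasure lborel B * osc k A U"
    unfolding osc_def by (simp add: nn_integral_multc nn_integral_cmult)
  also have "(\<integral>\<^sup>+x. \<integral>\<^sup>+y. \<integral>\<^sup>+z. indicator A x * (k z y * indicator B y * indicator U z) \<partial>lborel \<partial>lborel \<partial>lborel)
     = (\<integral>\<^sup>+x. \<integral>\<^sup>+z. \<integral>\<^sup>+y. indicator A x * (k z y * indicator B y * indicator U z) \<partial>lborel \<partial>lborel \<partial>lborel)"
    by (intro nn_integral_cong lborel_pair.Fubini') measurable
  also have "\<dots> = emeasure lborel A * osc k U B"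
    unfolding osc_def by (simp add: nn_integral_multc nn_integral_cmult)
  finally show ?thesis .
qed

lemma osc_mono: "B \<subseteq> B' \<Longrightarrow> A \<subseteq> A' \<Longrightarrow> osc k A B \<le> osc k A' B'"
  unfolding osc_def by (intro nn_integral_mono mult_mono) (auto simp: indicator_def)

text \<open>The layer between the cubes of half side \<open>r\<close> and \<open>2 r\<close> is covered by the convex cells in which
  one coordinate lies in \<open>[r, 2r]\<close> or in \<open>[-2r, -r]\<close>.  A partial map \<open>c\<close> records such constraints:
  \<open>Some True\<close> is the upper side, \<open>Some False\<close> the lower side, \<open>None\<close> leaves the full range
  \<open>[-2r, 2r]\<close>.  Intersections of cells of different axes then have the same shape.\<close>

definition side :: "real \<Rightarrow> bool option \<Rightarrow> real set" where
  "side r c = {(if c = Some True then r else -2*r)..(if c = Some False then -r else 2*r)}"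

definition slab :: "real \<Rightarrow> ('n::finite \<rightharpoonup> bool) \<Rightarrow> (real^'n) set" where
  "slab r c = {x. \<forall>k. x $ k \<in> side r (c k)}"

definition layer :: "real \<Rightarrow> (real^'n::finite) set" where
  "layer r = {x. (\<forall>k. \<bar>x $ k\<bar> \<le> 2 * r) \<and> (\<exists>k. \<bar>x $ k\<bar> \<ge> r)}"

abbreviation cell :: "real \<Rightarrow> 'n::finite \<Rightarrow> bool \<Rightarrow> (real^'n) set" where
  "cell r i s \<equiv> slab r [i \<mapsto> s]"

lemma slab_cbox:
  "slab r c = cbox (\<chi> k. if c k = Some True then r else -2*r) (\<chi> k. if c k = Some False then -r else 2*r)"
  by (simp add: set_eq_iff slab_def side_def mem_box_cart)

lemma slab_borel [measurable]: "slab r c \<in> sets borel"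
  by (simp add: slab_cbox)

lemma convex_slab: "convex (slab r c)"
  by (simp add: slab_cbox)

lemma slab_antimono:
  assumes "c \<subseteq>\<^sub>m d" "r > 0"
  shows "slab r d \<subseteq> slab r c"
proof -
  have "side r (d k) \<subseteq> side r (c k)" for k
    using assms by (cases "k \<in> dom c") (auto simp: map_le_def side_def domIff)
  then show ?thesis by (auto simp: slab_def)
qed

lemma emeasure_slab:
  assumes "r > 0"
  shows "emeasure lborel (slab r c) = ennreal (\<Prod>k\<in>UNIV. if c k = None then 4 * r else r)"
proof -
  have "emeasure lborel (slab r c) = ennreal (measure lborel (slab r c))"
    by (subst emeasure_eq_ennreal_measure) (auto simp: slab_cbox emeasure_lborel_cbox_eq)
  also have "measure lborel (slab r c) = (\<Prod>k\<in>UNIV. if c k = None then 4 * r else r)"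
    unfolding slab_cbox using assms
    by (subst content_cbox_cart) (auto simp: interval_eq_empty_cart not_less intro!: prod.cong, metis not_None_eq)
  finally show ?thesis .
qed

lemma emeasure_slab_upd:
  assumes "r > 0" "c j = None"
  shows "emeasure lborel (slab r c) = 4 * emeasure lborel (slab r (c(j \<mapsto> s)))"
proof -
  have "(\<Prod>k\<in>UNIV. if c k = None then 4 * r else r) = 4 * (\<Prod>k\<in>UNIV. if (c(j \<mapsto> s)) k = None then 4 * r else r)"
    unfolding prod.remove[OF finite UNIV_I[of j]] using assms(2) by (auto intro!: prod.cong)
  then show ?thesis 
    using assms(1) by (simp only: emeasure_slab[OF assms(1)]) (subst ennreal_mult, auto intro!: prod_nonneg)
qed

lemma emeasure_slab_pos:
  assumes "r > 0"
  shows "emeasure lborel (slab r c) \<noteq> 0" "emeasure lborel (slab r c) \<noteq> top"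
proof -
  have "(\<Prod>k\<in>UNIV. if c k = None then 4 * r else r) > 0"
    by (rule prod_pos) (use assms in auto)
  then show "emeasure lborel (slab r c) \<noteq> 0" "emeasure lborel (slab r c) \<noteq> top"
    unfolding emeasure_slab[OF assms] by (metis ennreal_eq_0_iff not_le, simp)
qed

lemma slab_diam:
  assumes "x \<in> slab r c" "y \<in> slab r c" "r > 0"
  shows "norm (x - y :: real^'n::finite) \<le> real CARD('n) * (4 * r)"
proof -
  have "norm (x - y) \<le> (\<Sum>k\<in>UNIV. \<bar>(x - y) $ k\<bar>)" by (rule norm_le_l1_cart)
  also have "\<dots> \<le> (\<Sum>k\<in>(UNIV :: 'n set). 4 * r)"
  proof (rule sum_mono)
    fix k
    have "x $ k \<in> {-2*r..2*r}" "y $ k \<in> {-2*r..2*r}"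
      using assms unfolding slab_def side_def by (auto dest!: spec[of _ k] split: if_splits)
    then show "\<bar>(x - y) $ k\<bar> \<le> 4 * r" by auto
  qed
  finally show ?thesis by simp
qed

lemma layer_eq_cells: "r > 0 \<Longrightarrow> layer r = (\<Union>i. \<Union>s. cell r i s)"
proof (intro set_eqI iffI)
  fix x :: "real^'n" assume r: "r > 0" and "x \<in> layer r"
  then obtain k where k: "\<bar>x $ k\<bar> \<ge> r" and x: "\<And>k. \<bar>x $ k\<bar> \<le> 2 * r" by (auto simp: layer_def)
  have "x $ j \<in> {-2*r..2*r}" for j using x[of j] by auto
  then have "x \<in> cell r k (x $ k > 0)"
    using k x r by (auto simp: slab_def side_def)
  then show "x \<in> (\<Union>i. \<Union>s. cell r i s)" by blast
next
  fix x :: "real^'n" assume r: "r > 0" and "x \<in> (\<Union>i. \<Union>s. cell r i s)"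
  then obtain i s where x: "x \<in> cell r i s" by blast
  have "x $ k \<in> side r ([i \<mapsto> s] k)" for k using x by (auto simp: slab_def)
  from this[of i] this have "\<bar>x $ i\<bar> \<ge> r" "\<And>k. \<bar>x $ k\<bar> \<le> 2 * r"
    using r by (auto simp: side_def abs_if split: if_splits) (smt (verit))+
  then show "x \<in> layer r" by (auto simp: layer_def)
qed

lemma layer_borel [measurable]: "layer r \<in> sets borel"
  unfolding layer_def by measurable

lemma power_add_le:
  fixes a b :: real
  assumes "a \<ge> 0" "b \<ge> 0"
  shows "(a + b) ^ p \<le> 2 ^ p * (a ^ p + b ^ p)"
proof -
  have "(a + b) ^ p \<le> (2 * max a b) ^ p" by (intro power_mono) (use assms in auto)
  also have "\<dots> = 2 ^ p * (max a b) ^ p" by (rule power_mult_distrib)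
  also have "(max a b) ^ p \<le> a ^ p + b ^ p" using assms by (auto simp: max_def)
  finally show ?thesis by simp
qed

text \<open>The factors are the number \<open>2 n\<close> of cells, the cost \<open>2 ^ (2 n + 4)\<close> of two chainings, and the
  constant of the convex case for cells of diameter at most \<open>4 n r\<close>.\<close>

definition layer_const :: "nat \<Rightarrow> real" where
  "layer_const n = 2 * real n * (2 ^ (2 * n + 4) * ((real n * 4) ^ n * 2 ^ n))"

text \<open>Cells of different axes meet in a slab of a quarter of their volume, through which their
  oscillations can be chained.  Two cells of the same axis are linked by a cell of another axis,
  and there is one since \<open>n \<ge> 2\<close>; for \<open>n = 1\<close> the layer is disconnected and the inequality
  fails for locally constant maps.\<close>

lemma osc_layer_le:
  fixes g :: "real^'n::finite \<Rightarrow> 'b::euclidean_space"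
  assumes n: "CARD('n) \<ge> 2" and r: "r > 0"
    and der: "\<And>x. (g has_derivative g' x) (at x)"
    and g'c: "\<And>h. continuous_on UNIV (\<lambda>x. g' x h)"
    and g'S: "\<And>x h. norm (g' x h) \<le> S x * norm h"
    and Sc: "continuous_on UNIV S"
  defines "p \<equiv> CARD('n)"
  shows "osc (\<lambda>x y. ennreal (norm (g x - g y) ^ p)) (cell r i s) (layer r) \<le>
    ennreal (layer_const p * r ^ p) * (emeasure lborel (cell r i s) * (\<integral>\<^sup>+x\<in>layer r. ennreal (S x ^ p) \<partial>lborel))"
proof -
  define k where "k = (\<lambda>x y. ennreal (norm (g x - g y) ^ p))"
  have p: "p \<ge> 1" using n by (simp add: p_def)
  have [measurable]: "g \<in> borel_measurable borel"
    by (rule borel_measurable_continuous_onI, rule has_derivative_imp_continuous_on[OF der])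
  have [measurable]: "S \<in> borel_measurable borel"
    using Sc by (rule borel_measurable_continuous_onI)
  have km[measurable]: "(\<lambda>(x, y). k x y) \<in> borel_measurable (borel \<Otimes>\<^sub>M borel)"
    unfolding k_def by measurable
  have tri: "k x y \<le> 2 ^ p * (k x z + k z y)" for x y z
  proof -
    have "norm (g x - g y) ^ p \<le> (norm (g x - g z) + norm (g z - g y)) ^ p"
      using norm_triangle_ineq[of "g x - g z" "g z - g y"] by (intro power_mono) auto
    also have "\<dots> \<le> 2 ^ p * (norm (g x - g z) ^ p + norm (g z - g y) ^ p)"
      by (rule power_add_le) auto
    finally have "k x y \<le> ennreal (2 ^ p * (norm (g x - g z) ^ p + norm (g z - g y) ^ p))"
      unfolding k_def by (rule ennreal_leI)
    also have "\<dots> = 2 ^ p * (k x z + k z y)"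
      by (simp add: k_def ennreal_mult ennreal_power[symmetric])
    finally show ?thesis .
  qed
  define V where "V = emeasure lborel (cell r i s)"
  define I where "I = (\<integral>\<^sup>+x\<in>layer r. ennreal (S x ^ p) \<partial>lborel)"
  define Q where "Q = ennreal ((real p * (4 * r)) ^ p) * (2 ^ p * (V * I))"
  have Veq: "emeasure lborel (cell r j t) = V" for j :: 'n and t
  proof -
    have 4: "emeasure lborel (slab r (Map.empty :: 'n \<rightharpoonup> bool)) = 4 * emeasure lborel (cell r j t)" for j :: 'n and t
      by (rule emeasure_slab_upd[OF r]) simp
    have "4 * emeasure lborel (cell r j t) = 4 * V"
      using 4[of j t] 4[of i s] by (simp add: V_def)
    then show ?thesis by (subst (asm) ennreal_mult_cancel_left) (auto simp: )
  qed
  have V0: "V \<noteq> 0" "V \<noteq> top" unfolding V_def using emeasure_slab_pos[OF r] by auto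
  have same: "osc k (cell r j t) (cell r j t) \<le> Q" for j :: 'n and t
  proof -
    have "osc k (cell r j t) (cell r j t) \<le> ennreal ((real p * (4 * r)) ^ p) * (2 ^ DIM(real^'n) *
      (emeasure lborel (cell r j t) * (\<integral>\<^sup>+x\<in>cell r j t. ennreal (S x ^ p) \<partial>lborel)))"
      unfolding k_def
      by (rule osc_convex_le[OF der g'c g'S Sc]) (use p r slab_diam in \<open>auto simp: p_def convex_slab\<close>)
    also have "\<dots> \<le> Q"
    proof -
      have "(\<integral>\<^sup>+x\<in>cell r j t. ennreal (S x ^ p) \<partial>lborel) \<le> I"
        unfolding I_def by (rule nn_set_integral_set_mono) (use layer_eq_cells[OF r] in blast)
      then show ?thesis unfolding Q_def Veq by (auto simp: p_def intro!: mult_left_mono)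
    qed
    finally show ?thesis .
  qed
  have cancel: "X \<le> Y" if "V * X \<le> V * Y" for X Y
    using that V0 by (simp add: ennreal_mult_le_mult_iff)
  have other: "osc k (cell r j t) (cell r j' t') \<le> 2 ^ (p + 3) * Q" if jj: "j \<noteq> j'" for j j' :: 'n and t t'
  proof -
    define U where "U = slab r [j \<mapsto> t, j' \<mapsto> t']"
    have U: "V = 4 * emeasure lborel U"
      unfolding U_def Veq[of j t, symmetric] by (rule emeasure_slab_upd[OF r]) (use jj in auto)
    have "U \<subseteq> cell r j t" "U \<subseteq> cell r j' t'"
      unfolding U_def using jj by (intro slab_antimono r; simp add: map_le_def)+
    then have UQ: "osc k (cell r j t) U \<le> Q" "osc k U (cell r j' t') \<le> Q"
      using osc_mono same by (meson order_refl order_trans)+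
    have "V * osc k (cell r j t) (cell r j' t') = 4 * (emeasure lborel U * osc k (cell r j t) (cell r j' t'))"
      by (simp add: U mult.assoc)
    also have "\<dots> \<le> 4 * (2 ^ p * (V * osc k (cell r j t) U + V * osc k U (cell r j' t')))"
      using osc_chain[OF km tri, of "cell r j t" "cell r j' t'" U]
      by (intro mult_left_mono) (auto simp: Veq U_def)
    also have "\<dots> \<le> 4 * (2 ^ p * (V * Q + V * Q))"
      by (intro mult_left_mono add_mono UQ) auto
    also have "\<dots> = V * (2 ^ (p + 3) * Q)"
      unfolding mult_2[symmetric] by (simp add: power_add mult_ac)
    finally show ?thesis by (rule cancel)
  qed
  have any: "osc k (cell r i s) (cell r j t) \<le> 2 ^ (2 * p + 4) * Q" for j :: 'n and t
  proof -
    obtain l where l: "l \<noteq> i"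
    proof (rule ccontr)
      assume "\<not> thesis"
      with that have "UNIV = {i}" by auto
      then have "CARD('n) = card {i}" by (rule arg_cong)
      with n show False by simp
    qed
    show ?thesis
    proof (cases "i = j")
      case False
      have "osc k (cell r i s) (cell r j t) \<le> 2 ^ (p + 3) * Q" using other False by blast
      also have "\<dots> \<le> 2 ^ (2 * p + 4) * Q" by (intro mult_right_mono power_increasing) auto
      finally show ?thesis .
    next
      case True
      have "V * osc k (cell r i s) (cell r j t) \<le> 2 ^ p * (V * osc k (cell r i s) (cell r l True) + V * osc k (cell r l True) (cell r j t))"
        using osc_chain[OF km tri, of "cell r i s" "cell r j t" "cell r l True"] by (simp add: Veq)
      also have "\<dots> \<le> 2 ^ p * (V * (2 ^ (p + 3) * Q) + V * (2 ^ (p + 3) * Q))"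
        by (intro mult_left_mono add_mono other) (use l True in auto)
      also have "\<dots> = V * (2 ^ (2 * p + 4) * Q)"
      proof -
        have dist: "c * (V * (a * Q) + V * (a * Q)) = V * ((c * 2 * a) * Q)" for a c
          unfolding mult_2_right distrib_left distrib_right by (simp add: mult_ac)
        have "(2::ennreal) ^ p * 2 * 2 ^ (p + 3) = 2 ^ (p + 1 + (p + 3))"
          unfolding power_add by (simp only: power_one_right)
        also have "p + 1 + (p + 3) = 2 * p + 4" by simp
        finally show ?thesis unfolding dist by (simp only:)
      qed
      finally show ?thesis by (rule cancel)
    qed
  qed
  have "osc k (cell r i s) (layer r) \<le> (\<Sum>(j, t)\<in>UNIV. osc k (cell r i s) (cell r j t))"
  proof -
    have [measurable]: "(\<lambda>x. \<integral>\<^sup>+y\<in>cell r j t. k x y \<partial>lborel) \<in> borel_measurable borel" for j t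
      unfolding k_def by measurable
    have "(\<integral>\<^sup>+y\<in>layer r. k x y \<partial>lborel) \<le> (\<Sum>(j, t)\<in>UNIV. \<integral>\<^sup>+y\<in>cell r j t. k x y \<partial>lborel)" for x
    proof -
      have "(\<integral>\<^sup>+y\<in>layer r. k x y \<partial>lborel) \<le> (\<integral>\<^sup>+y. (\<Sum>z\<in>UNIV. k x y * indicator (cell r (fst z) (snd z)) y) \<partial>lborel)"
      proof (rule nn_integral_mono)
        fix y :: "real^'n"
        show "k x y * indicator (layer r) y \<le> (\<Sum>z\<in>UNIV. k x y * indicator (cell r (fst z) (snd z)) y)"
        proof (cases "y \<in> layer r")
          case True
          then obtain j t where "y \<in> cell r j t" using layer_eq_cells[OF r] by blast
          then show ?thesis using True member_le_sum[of "(j, t)" UNIV "\<lambda>z. k x y * indicator (cell r (fst z) (snd z)) y"]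
            by simp
        qed simp
      qed
      also have "\<dots> = (\<Sum>z\<in>UNIV. \<integral>\<^sup>+y\<in>cell r (fst z) (snd z). k x y \<partial>lborel)"
        unfolding k_def by (rule nn_integral_sum) measurable
      finally show ?thesis by (simp add: case_prod_beta)
    qed
    then have "osc k (cell r i s) (layer r) \<le> (\<integral>\<^sup>+x\<in>cell r i s. (\<Sum>(j, t)\<in>UNIV. \<integral>\<^sup>+y\<in>cell r j t. k x y \<partial>lborel) \<partial>lborel)"
      unfolding osc_def by (intro nn_integral_mono mult_right_mono) auto
    also have "\<dots> = (\<Sum>(j, t)\<in>UNIV. osc k (cell r i s) (cell r j t))"
      unfolding osc_def case_prod_beta sum_distrib_right by (rule nn_integral_sum) measurable
    finally show ?thesis .
  qed
  also have "\<dots> \<le> (\<Sum>z\<in>(UNIV :: ('n \<times> bool) set). 2 ^ (2 * p + 4) * Q)"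
    by (intro sum_mono) (auto intro: any)
  also have "\<dots> = ennreal (2 * real p) * (2 ^ (2 * p + 4) * Q)"
    by (simp add: p_def ennreal_mult mult.commute flip: ennreal_of_nat_eq_real_of_nat)
  also have "\<dots> = ennreal (layer_const p * r ^ p) * (V * I)"
    using r unfolding Q_def layer_const_def
    by (simp add: ennreal_mult ennreal_power[symmetric] power_mult_distrib mult_ac)
  finally show ?thesis by (simp add: k_def V_def I_def)
qed

section \<open>The cutoff inequality for twice differentiable maps\<close>

text \<open>A continuously differentiable substitute for the positive part: one integration by parts
  asks for no more smoothness of the cutoff.\<close>

definition sq_pos :: "real \<Rightarrow> real" where
  "sq_pos t = (max 0 t)\<^sup>2"

lemma DERIV_sq_pos: "(sq_pos has_real_derivative 2 * max 0 t) (at t)"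
proof -
  consider "t > 0" | "t < 0" | "t = 0" by linarith
  then show ?thesis
  proof cases
    case 1
    have "((\<lambda>t. t\<^sup>2) has_real_derivative 2 * max 0 t) (at t)"
      using 1 by (auto intro!: derivative_eq_intros)
    then show ?thesis
      by (rule has_field_derivative_transform_within_open[of _ _ _ "{0<..}"]) (use 1 in \<open>auto simp: sq_pos_def\<close>)
  next
    case 2
    have "((\<lambda>t. 0) has_real_derivative 2 * max 0 t) (at t)" using 2 by simp
    then show ?thesis
      by (rule has_field_derivative_transform_within_open[of _ _ _ "{..<0}"]) (use 2 in \<open>auto simp: sq_pos_def\<close>)
  next
    case 3
    have "((\<lambda>h. max 0 h * (max 0 h / h)) \<longlongrightarrow> 0) (at (0::real))"
    proof (rule Lim_null_comparison)
      show "\<forall>\<^sub>F h in at 0. norm (max 0 h * (max 0 h / h)) \<le> \<bar>h\<bar>"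
        by (rule always_eventually) (auto simp: max_def)
      show "((\<lambda>h. \<bar>h\<bar>) \<longlongrightarrow> 0) (at (0::real))" by (intro tendsto_eq_intros) auto
    qed
    then show ?thesis
      by (simp add: 3 has_field_derivative_iff sq_pos_def power2_eq_square)
  qed
qed

text \<open>This is the squared distance to the cube of half side \<open>r\<close>, in units of \<open>r\<close>.\<close>

definition cube_dist :: "real \<Rightarrow> real^'n::finite \<Rightarrow> real" where
  "cube_dist r x = (\<Sum>k\<in>UNIV. sq_pos (x $ k / r - 1) + sq_pos (- (x $ k) / r - 1))"

definition cutoff :: "real \<Rightarrow> real^'n::finite \<Rightarrow> real" where
  "cutoff r x = sq_pos (1 - cube_dist r x)"

definition cutoff_deriv :: "real \<Rightarrow> 'n::finite \<Rightarrow> real^'n \<Rightarrow> real" where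
  "cutoff_deriv r i x = - 4 / r * max 0 (1 - cube_dist r x) * (max 0 (x $ i / r - 1) - max 0 (- (x $ i) / r - 1))"

lemma cutoff_has_derivative:
  "(cutoff r has_derivative (\<lambda>h. \<Sum>i\<in>UNIV. h $ i *\<^sub>R cutoff_deriv r i x)) (at (x :: real^'n::finite))"
proof -
  have comp: "((\<lambda>x :: real^'n. x $ k) has_derivative (\<lambda>h. h $ k)) (at x)" for k
    by (rule bounded_linear_imp_has_derivative[OF bounded_linear_vec_nth])
  have sq: "((\<lambda>x. sq_pos (f x)) has_derivative (\<lambda>h. 2 * max 0 (f x) * f' h)) (at x)"
    if "(f has_derivative f') (at x)" for f :: "real^'n \<Rightarrow> real" and f'
    using has_derivative_compose[OF that DERIV_sq_pos[unfolded has_field_derivative_def]] by simp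
  have "(cutoff r has_derivative (\<lambda>h. 2 * max 0 (1 - cube_dist r x) * (0 - (\<Sum>k\<in>UNIV.
       2 * max 0 (x $ k / r - 1) * (h $ k / r - 0) + 2 * max 0 (- (x $ k) / r - 1) * (- (h $ k) / r - 0))))) (at x)"
    unfolding cutoff_def cube_dist_def
    by (intro sq has_derivative_diff has_derivative_const has_derivative_sum has_derivative_add
        has_derivative_divide' has_derivative_minus comp bounded_linear.has_derivative[OF bounded_linear_divide])
  moreover have "2 * max 0 (1 - cube_dist r x) * (0 - (\<Sum>k\<in>UNIV.
       2 * max 0 (x $ k / r - 1) * (h $ k / r - 0) + 2 * max 0 (- (x $ k) / r - 1) * (- (h $ k) / r - 0)))
    = (\<Sum>i\<in>UNIV. h $ i *\<^sub>R cutoff_deriv r i x)" for h :: "real^'n"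
    unfolding cutoff_deriv_def diff_0 sum_negf[symmetric] sum_distrib_left
    by (rule sum.cong[OF refl]) (simp add: divide_inverse algebra_simps)
  ultimately show ?thesis by simp
qed

lemma continuous_cutoff_deriv: "continuous_on UNIV (cutoff_deriv r i)"
  unfolding cutoff_deriv_def[abs_def] cube_dist_def sq_pos_def divide_inverse
  by (intro continuous_intros)

lemma cube_dist_nonneg: "cube_dist r x \<ge> 0"
  unfolding cube_dist_def sq_pos_def by (intro sum_nonneg) auto

lemma cutoff_bounds: "0 \<le> cutoff r x" "cutoff r x \<le> 1"
proof -
  show "0 \<le> cutoff r x" by (simp add: cutoff_def sq_pos_def)
  have "(max 0 (1 - cube_dist r x))\<^sup>2 \<le> 1\<^sup>2"
    using cube_dist_nonneg[of r x] by (intro power_mono) auto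
  then show "cutoff r x \<le> 1" by (simp add: cutoff_def sq_pos_def)
qed

lemma cube_dist_less_1:
  assumes "r > 0" "cube_dist r x < 1"
  shows "\<bar>x $ k\<bar> < 2 * r" "max 0 (x $ k / r - 1) < 1" "max 0 (- (x $ k) / r - 1) < 1"
proof -
  have "sq_pos (x $ k / r - 1) + sq_pos (- (x $ k) / r - 1) \<le> cube_dist r x"
    unfolding cube_dist_def by (rule member_le_sum) (auto simp: sq_pos_def)
  then have "sq_pos (x $ k / r - 1) < 1" "sq_pos (- (x $ k) / r - 1) < 1"
    using assms(2) zero_le_power2 unfolding sq_pos_def by (smt (verit))+
  then show *: "max 0 (x $ k / r - 1) < 1" "max 0 (- (x $ k) / r - 1) < 1"
    unfolding sq_pos_def by (auto simp: power2_less_1_iff abs_square_less_1)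
  then show "\<bar>x $ k\<bar> < 2 * r" using assms(1) by (auto simp: field_simps abs_if)
qed

lemma cutoff_eq_0: "r > 0 \<Longrightarrow> \<bar>x $ k\<bar> \<ge> 2 * r \<Longrightarrow> cutoff r x = 0"
  using cube_dist_less_1(1)[of r x k] by (cases "cube_dist r x < 1") (auto simp: cutoff_def sq_pos_def)

lemma cutoff_support:
  assumes r: "r > 0" and x: "norm (x :: real^'n::finite) > 2 * r * real CARD('n)"
  shows "cutoff r x = 0"
proof -
  have "\<not> (\<forall>k. \<bar>x $ k\<bar> \<le> 2 * r)"
    using x norm_le_l1_cart[of x] sum_mono[of UNIV "\<lambda>k. \<bar>x $ k\<bar>" "\<lambda>_. 2 * r"] by (auto simp: mult_ac)
  then obtain k where "\<bar>x $ k\<bar> \<ge> 2 * r" by (auto simp: not_le intro: less_imp_le)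
  then show "cutoff r x = 0" by (rule cutoff_eq_0[OF r])
qed

lemma layer_subset_cball: "layer r \<subseteq> cball (0 :: real^'n::finite) (2 * r * real CARD('n))"
proof
  fix x :: "real^'n" assume "x \<in> layer r"
  then have "(\<Sum>k\<in>UNIV. \<bar>x $ k\<bar>) \<le> (\<Sum>k\<in>(UNIV :: 'n set). 2 * r)"
    by (intro sum_mono) (auto simp: layer_def)
  then show "x \<in> cball 0 (2 * r * real CARD('n))" using norm_le_l1_cart[of x] by (simp add: mult_ac)
qed

lemma cutoff_eq_1:
  assumes "r > 0" "\<And>k. \<bar>x $ k\<bar> \<le> r"
  shows "cutoff r x = 1"
proof -
  have "x $ k / r \<le> 1" "- (x $ k) / r \<le> 1" for k
    using assms(2)[of k] assms(1) by (auto simp: field_simps)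
  then have "cube_dist r x = 0" unfolding cube_dist_def sq_pos_def by (intro sum.neutral) auto
  then show ?thesis by (simp add: cutoff_def sq_pos_def)
qed

lemma cutoff_deriv_le:
  assumes r: "r > 0"
  shows "\<bar>cutoff_deriv r i x\<bar> \<le> 4 / r * indicator (layer r) x"
proof (cases "cube_dist r x < 1 \<and> \<bar>x $ i\<bar> \<ge> r")
  case True
  then have 1: "\<bar>max 0 (x $ i / r - 1) - max 0 (- (x $ i) / r - 1)\<bar> \<le> 1"
    using cube_dist_less_1[OF r, of x i] by (auto simp: abs_if)
  have 2: "\<bar>max 0 (1 - cube_dist r x)\<bar> \<le> 1" using cube_dist_nonneg[of r x] by auto
  have "x \<in> layer r"
    using True cube_dist_less_1(1)[OF r, of x] by (auto simp: layer_def intro: less_imp_le)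
  moreover have "\<bar>cutoff_deriv r i x\<bar> = 4 / r * (\<bar>max 0 (1 - cube_dist r x)\<bar> * \<bar>max 0 (x $ i / r - 1) - max 0 (- (x $ i) / r - 1)\<bar>)"
    using r by (simp add: cutoff_deriv_def abs_mult)
  moreover have "\<dots> \<le> 4 / r * (1 * 1)"
    by (intro mult_left_mono mult_mono 1 2) (use r in auto)
  ultimately show ?thesis by simp
next
  case False
  then have "cutoff_deriv r i x = 0"
    using r by (auto simp: cutoff_deriv_def field_simps abs_if split: if_splits)
  then show ?thesis using r by simp
qed

text \<open>A crude form of Young's inequality takes the place of Hoelder's, because multiplicative
  constants are immaterial.  The parameter \<open>s\<close> makes the coefficient of \<open>b ^ n\<close> small at the
  expense of the other one; this is how errors are absorbed when mollifications pass to the limit.\<close>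

lemma scaled_young_power_le:
  fixes t b s :: real
  assumes "t \<ge> 0" "b \<ge> 0" "s > 0" "n \<ge> 1"
  shows "t * b ^ (n - 1) \<le> (1 / s) ^ (n - 1) * t ^ n + s * b ^ n"
proof -
  obtain q where q: "n = Suc q" using assms(4) by (cases n) auto
  show ?thesis
  proof (cases "t \<le> s * b")
    case True
    then have "t * b ^ (n - 1) \<le> s * b * b ^ (n - 1)" using assms by (intro mult_right_mono) auto
    also have "\<dots> = s * b ^ n" by (simp add: q)
    finally show ?thesis using assms by (simp add: add_increasing)
  next
    case False
    then have "b \<le> 1 / s * t" using assms(3) by (simp add: field_simps)
    then have "t * b ^ (n - 1) \<le> t * (1 / s * t) ^ (n - 1)" using assms by (intro mult_left_mono power_mono) auto
    also have "\<dots> = (1 / s) ^ (n - 1) * t ^ n" by (simp add: q power_mult_distrib power_divide)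
    finally show ?thesis using assms by (simp add: add_increasing2)
  qed
qed

text \<open>Subtracting \<open>c\<close> from \<open>g\<close> leaves the derivatives unchanged, and the gradient of the cutoff lives
  on the layer and is of size \<open>1 / r\<close>.  The factor \<open>1 / r\<close> is attached to \<open>g - c\<close> before Young's
  inequality is applied, so that the Poincare inequality can absorb it.\<close>

lemma cutoff_integral_le_pointwise:
  fixes \<omega> :: "('n::finite \<Rightarrow> real^'m::finite) \<Rightarrow> real" and g :: "real^'n \<Rightarrow> real^'m"
  assumes cov: "covector \<omega>" and g: "C2_map g g1 g2" and r: "r > 0"
  shows "ennreal (LINT x|lborel. cutoff r x * \<omega> (\<lambda>i. g1 i x)) \<le> ennreal (4 * covector_bound \<omega>) *
     (\<integral>\<^sup>+x\<in>layer r. ennreal ((norm (g x - c) / r) ^ CARD('n) + (\<Sum>i\<in>UNIV. norm (g1 i x)) ^ CARD('n)) \<partial>lborel)"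
proof -
  define N where "N = CARD('n)"
  have N: "N \<ge> 1" by (simp add: N_def Suc_leI)
  define S where "S x = (\<Sum>i\<in>UNIV. norm (g1 i x))" for x
  have S: "norm (g1 i x) \<le> S x" for i x unfolding S_def by (rule member_le_sum) auto
  have S0: "S x \<ge> 0" for x unfolding S_def by (intro sum_nonneg) auto
  note gm = C2_map_continuous[OF g, THEN borel_measurable_continuous_onI]
  have [measurable]: "g \<in> borel_measurable borel" "g1 i \<in> borel_measurable borel" for i
    by (rule gm)+
  have [measurable]: "S \<in> borel_measurable borel" unfolding S_def by measurable
  define E where "E = (LINT x|lborel. cutoff r x * \<omega> (\<lambda>i. g1 i x))"
  define \<Phi> where "\<Phi> x = (\<Sum>i\<in>UNIV. cutoff_deriv r i x * \<omega> ((\<lambda>j. g1 j x)(i := g x - c)))" for x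
  define b where "b x = (norm (g x - c) / r) ^ N + S x ^ N" for x
  from integral_cutoff_covector[OF cov C2_map_shift[OF g, of c] cutoff_has_derivative continuous_cutoff_deriv cutoff_support[OF r]]
  have eq: "real N * E = - (LINT x|lborel. \<Phi> x)"
    by (simp add: E_def \<Phi>_def N_def)
  have \<Phi>: "\<bar>\<Phi> x\<bar> \<le> real N * (4 * covector_bound \<omega> * b x) * indicator (layer r) x" for x
  proof -
    have "\<bar>\<Phi> x\<bar> \<le> (\<Sum>i\<in>UNIV. \<bar>cutoff_deriv r i x * \<omega> ((\<lambda>j. g1 j x)(i := g x - c))\<bar>)"
      unfolding \<Phi>_def by (rule sum_abs)
    also have "\<dots> \<le> (\<Sum>i\<in>(UNIV :: 'n set). 4 * covector_bound \<omega> * b x * indicator (layer r) x)"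
    proof (rule sum_mono)
      fix i
      have "(\<Prod>j\<in>UNIV. norm (((\<lambda>j. g1 j x)(i := g x - c)) j)) = norm (g x - c) * (\<Prod>j\<in>UNIV - {i}. norm (g1 j x))"
        by (subst prod.remove[of _ i]) (auto intro!: prod.cong)
      also have "(\<Prod>j\<in>UNIV - {i}. norm (g1 j x)) \<le> (\<Prod>j\<in>UNIV - {i}. S x)"
        by (intro prod_mono) (auto simp: S)
      also have "\<dots> = S x ^ (N - 1)" by (simp add: card_Diff_singleton N_def)
      finally have P: "(\<Prod>j\<in>UNIV. norm (((\<lambda>j. g1 j x)(i := g x - c)) j)) \<le> norm (g x - c) * S x ^ (N - 1)"
        by (simp add: mult_left_mono)
      have "\<bar>\<omega> ((\<lambda>j. g1 j x)(i := g x - c))\<bar> \<le> covector_bound \<omega> * (norm (g x - c) * S x ^ (N - 1))"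
        using abs_covector_le[OF cov] mult_left_mono[OF P covector_bound_nonneg[of \<omega>]] by (rule order_trans)
      then have "\<bar>cutoff_deriv r i x * \<omega> ((\<lambda>j. g1 j x)(i := g x - c))\<bar>
         \<le> (4 / r * indicator (layer r) x) * (covector_bound \<omega> * (norm (g x - c) * S x ^ (N - 1)))"
        unfolding abs_mult using cutoff_deriv_le[OF r, of i x] r by (intro mult_mono) auto
      also have "\<dots> = 4 * covector_bound \<omega> * (norm (g x - c) / r * S x ^ (N - 1)) * indicator (layer r) x"
        by simp
      also have "\<dots> \<le> 4 * covector_bound \<omega> * b x * indicator (layer r) x"
        unfolding b_def
        using r covector_bound_nonneg[of \<omega>] N S0 scaled_young_power_le[of "norm (g x - c) / r" "S x" 1 N]
        by (intro mult_right_mono mult_left_mono) auto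
      finally show "\<bar>cutoff_deriv r i x * \<omega> ((\<lambda>j. g1 j x)(i := g x - c))\<bar> \<le> 4 * covector_bound \<omega> * b x * indicator (layer r) x" .
    qed
    finally show ?thesis by (simp add: N_def mult_ac)
  qed
  have b0: "b x \<ge> 0" for x using r S0 by (auto simp: b_def)
  have "ennreal (real N) * ennreal E = ennreal (real N * E)"
    using N by (simp add: ennreal_mult')
  also have "\<dots> \<le> ennreal (norm (LINT x|lborel. \<Phi> x))" unfolding eq by (intro ennreal_leI) simp
  also have "\<dots> \<le> (\<integral>\<^sup>+x. ennreal (norm (\<Phi> x)) \<partial>lborel)"
    by (cases "integrable lborel \<Phi>") (use integral_norm_bound_ennreal[of lborel \<Phi>] in \<open>auto simp: not_integrable_integral_eq\<close>)
  also have "\<dots> \<le> (\<integral>\<^sup>+x. ennreal (real N) * (ennreal (4 * covector_bound \<omega>) * (ennreal (b x) * indicator (layer r) x)) \<partial>lborel)"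
  proof (rule nn_integral_mono)
    fix x
    have "ennreal (norm (\<Phi> x)) \<le> ennreal (real N * (4 * covector_bound \<omega> * b x) * indicator (layer r) x)"
      using \<Phi> by (intro ennreal_leI) simp
    also have "\<dots> = ennreal (real N) * (ennreal (4 * covector_bound \<omega>) * (ennreal (b x) * indicator (layer r) x))"
      using covector_bound_nonneg[of \<omega>] b0 by (simp add: ennreal_mult ennreal_mult'' mult_ac flip: ennreal_indicator)
    finally show "ennreal (norm (\<Phi> x)) \<le> ennreal (real N) * (ennreal (4 * covector_bound \<omega>) * (ennreal (b x) * indicator (layer r) x))" .
  qed
  also have "\<dots> = ennreal (real N) * (ennreal (4 * covector_bound \<omega>) * (\<integral>\<^sup>+x\<in>layer r. ennreal (b x) \<partial>lborel))"
    unfolding b_def by (simp add: nn_integral_cmult)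
  finally have "ennreal E \<le> ennreal (4 * covector_bound \<omega>) * (\<integral>\<^sup>+x\<in>layer r. ennreal (b x) \<partial>lborel)"
    using N by (subst (asm) ennreal_mult_le_mult_iff) auto
  then show ?thesis by (simp add: E_def b_def N_def S_def)
qed

definition caccioppoli_const :: "nat \<Rightarrow> real \<Rightarrow> real" where
  "caccioppoli_const n W = 4 * W * (layer_const n + 1)"

lemma layer_const_nonneg: "layer_const n \<ge> 0"
  by (simp add: layer_const_def)

text \<open>Averaging the preceding estimate over the constants \<open>c = g y\<close>, with \<open>y\<close> in one fixed cell,
  produces the oscillation between that cell and the layer.  The powers of \<open>r\<close> cancel, hence the
  constant does not depend on the scale.\<close>

lemma cutoff_integral_le:
  fixes \<omega> :: "('n::finite \<Rightarrow> real^'m::finite) \<Rightarrow> real" and g :: "real^'n \<Rightarrow> real^'m"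
  assumes cov: "covector \<omega>" and g: "C2_map g g1 g2" and r: "r > 0" and n: "CARD('n) \<ge> 2"
  shows "ennreal (LINT x|lborel. cutoff r x * \<omega> (\<lambda>i. g1 i x)) \<le>
    ennreal (caccioppoli_const CARD('n) (covector_bound \<omega>)) * (\<integral>\<^sup>+x\<in>layer r. ennreal ((\<Sum>i\<in>UNIV. norm (g1 i x)) ^ CARD('n)) \<partial>lborel)"
proof -
  define N where "N = CARD('n)"
  define S where "S x = (\<Sum>i\<in>UNIV. norm (g1 i x))" for x
  have S0: "S x \<ge> 0" for x unfolding S_def by (intro sum_nonneg) auto
  note gm = C2_map_continuous[OF g, THEN borel_measurable_continuous_onI]
  have [measurable]: "g \<in> borel_measurable borel" "g1 i \<in> borel_measurable borel" for i
    by (rule gm)+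
  have [measurable]: "S \<in> borel_measurable borel" unfolding S_def by measurable
  define E where "E = (LINT x|lborel. cutoff r x * \<omega> (\<lambda>i. g1 i x))"
  define W where "W = covector_bound \<omega>"
  have W0: "W \<ge> 0" unfolding W_def by (rule covector_bound_nonneg)
  fix i0 :: 'n
  define C where "C = cell r i0 True"
  have [measurable]: "C \<in> sets borel" unfolding C_def by measurable
  define V where "V = emeasure lborel C"
  have V: "V \<noteq> 0" "V \<noteq> top" unfolding V_def C_def using emeasure_slab_pos[OF r] by auto
  define I where "I = (\<integral>\<^sup>+x\<in>layer r. ennreal (S x ^ N) \<partial>lborel)"
  define k where "k = (\<lambda>x y. ennreal (norm (g x - g y) ^ N))"
  have ptw: "ennreal E \<le> ennreal (4 * W) * (ennreal (1 / r ^ N) * (\<integral>\<^sup>+x\<in>layer r. k y x \<partial>lborel) + I)" for y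
  proof -
    have "(\<integral>\<^sup>+x\<in>layer r. ennreal ((norm (g x - g y) / r) ^ N + S x ^ N) \<partial>lborel)
      = (\<integral>\<^sup>+x. ennreal (1 / r ^ N) * (k y x * indicator (layer r) x) + ennreal (S x ^ N) * indicator (layer r) x \<partial>lborel)"
    proof (intro nn_integral_cong)
      fix x
      have "(norm (g x - g y) / r) ^ N + S x ^ N = 1 / r ^ N * norm (g y - g x) ^ N + S x ^ N"
        by (simp add: power_divide norm_minus_commute)
      then have "ennreal ((norm (g x - g y) / r) ^ N + S x ^ N) = ennreal (1 / r ^ N) * k y x + ennreal (S x ^ N)"
        unfolding k_def using r S0 by (simp only: ) (subst ennreal_plus, auto simp: ennreal_mult[symmetric])
      then show "ennreal ((norm (g x - g y) / r) ^ N + S x ^ N) * indicator (layer r) x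
        = ennreal (1 / r ^ N) * (k y x * indicator (layer r) x) + ennreal (S x ^ N) * indicator (layer r) x"
        by (simp only: distrib_right mult.assoc)
    qed
    also have "\<dots> = ennreal (1 / r ^ N) * (\<integral>\<^sup>+x\<in>layer r. k y x \<partial>lborel) + I"
      unfolding I_def k_def by (simp add: nn_integral_add nn_integral_cmult)
    finally show ?thesis
      using cutoff_integral_le_pointwise[OF cov g r, of "g y"] by (simp add: E_def W_def N_def S_def)
  qed
  have osc: "osc k C (layer r) \<le> ennreal (layer_const N * r ^ N) * (V * I)"
    unfolding k_def N_def V_def I_def C_def
  proof (rule osc_layer_le[OF n r])
    show "(g has_derivative (\<lambda>h. \<Sum>i\<in>UNIV. h $ i *\<^sub>R g1 i x)) (at x)" for x by (rule C2_mapD[OF g])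
    show "continuous_on UNIV (\<lambda>x. \<Sum>i\<in>UNIV. h $ i *\<^sub>R g1 i x)" for h
      by (intro continuous_intros C2_map_continuous[OF g])
    show "continuous_on UNIV S" unfolding S_def[abs_def] by (intro continuous_intros C2_map_continuous[OF g])
    show "norm (\<Sum>i\<in>UNIV. h $ i *\<^sub>R g1 i x) \<le> S x * norm h" for x h
    proof -
      have "norm (\<Sum>i\<in>UNIV. h $ i *\<^sub>R g1 i x) \<le> (\<Sum>i\<in>UNIV. norm (h $ i *\<^sub>R g1 i x))" by (rule norm_sum)
      also have "\<dots> \<le> (\<Sum>i\<in>UNIV. norm (g1 i x) * norm h)"
        by (intro sum_mono) (auto simp: mult.commute intro!: mult_right_mono component_le_norm_cart)
      finally show ?thesis by (simp add: S_def sum_distrib_right)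
    qed
  qed
  have "V * ennreal E = (\<integral>\<^sup>+y\<in>C. ennreal E \<partial>lborel)"
    by (simp add: V_def nn_integral_cmult mult.commute)
  also have "\<dots> \<le> (\<integral>\<^sup>+y\<in>C. ennreal (4 * W) * (ennreal (1 / r ^ N) * (\<integral>\<^sup>+x\<in>layer r. k y x \<partial>lborel) + I) \<partial>lborel)"
    by (intro nn_integral_mono mult_right_mono ptw) auto
  also have "\<dots> = (\<integral>\<^sup>+y. ennreal (4 * W) * (ennreal (1 / r ^ N) * ((\<integral>\<^sup>+x\<in>layer r. k y x \<partial>lborel) * indicator C y) + I * indicator C y) \<partial>lborel)"
    by (intro nn_integral_cong) (simp add: algebra_simps)
  also have "\<dots> = ennreal (4 * W) * (ennreal (1 / r ^ N) * osc k C (layer r) + I * V)"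
    unfolding osc_def k_def V_def by (simp add: nn_integral_add nn_integral_cmult)
  also have "\<dots> \<le> ennreal (4 * W) * (ennreal (1 / r ^ N) * (ennreal (layer_const N * r ^ N) * (V * I)) + I * V)"
    by (intro mult_left_mono add_mono osc) auto
  also have "ennreal (1 / r ^ N) * (ennreal (layer_const N * r ^ N) * (V * I)) = ennreal (layer_const N) * (V * I)"
    using r layer_const_nonneg[of N] by (simp add: ennreal_mult[symmetric] mult.assoc[symmetric])
  also have "ennreal (4 * W) * (ennreal (layer_const N) * (V * I) + I * V) = V * (ennreal (caccioppoli_const N W) * I)"
    using W0 layer_const_nonneg[of N]
    by (simp add: caccioppoli_const_def ennreal_mult ennreal_plus algebra_simps)
  finally have "ennreal E \<le> ennreal (caccioppoli_const N W) * I"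
    using V by (simp add: ennreal_mult_le_mult_iff)
  then show ?thesis by (simp add: E_def N_def W_def I_def S_def)
qed

section \<open>Smooth mollifiers\<close>

text \<open>The derivatives of the flat function \<open>exp (-1/s)\<close> are linear combinations of these functions.\<close>

definition flat :: "nat \<Rightarrow> real \<Rightarrow> real" where
  "flat k s = (if s > 0 then (1 / s) ^ k * exp (- 1 / s) else 0)"

lemma flat_le: "\<bar>flat k s\<bar> \<le> fact (k + 2) * s\<^sup>2"
proof (cases "s > 0")
  case True
  \<comment> \<open>A single term of the exponential series; \<open>N = k + 2\<close> leaves a factor \<open>s\<^sup>2\<close> to spare.\<close>
  have "(1 / s) ^ N \<le> fact N * exp (1 / s)" for N
  proof -
    have "(\<Sum>i\<in>{N}. (1 / s) ^ i /\<^sub>R fact i) \<le> (\<Sum>i. (1 / s) ^ i /\<^sub>R fact i)"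
      by (rule sum_le_suminf[OF summable_exp_generic]) (use True in auto)
    then have "(1 / s) ^ N /\<^sub>R fact N \<le> exp (1 / s)" by (simp add: exp_def)
    then have "fact N * ((1 / s) ^ N /\<^sub>R fact N) \<le> fact N * exp (1 / s)" by (rule mult_left_mono) simp
    moreover have "fact N * ((1 / s) ^ N /\<^sub>R fact N) = (1 / s) ^ N" by simp
    ultimately show ?thesis by (simp only:)
  qed
  from this[of "k + 2"] have "(1 / s) ^ k * (1 / s)\<^sup>2 \<le> fact (k + 2) * exp (1 / s)"
    unfolding power_add .
  then have "(1 / s) ^ k * (1 / s)\<^sup>2 * (exp (- 1 / s) * s\<^sup>2) \<le> fact (k + 2) * exp (1 / s) * (exp (- 1 / s) * s\<^sup>2)"
    by (rule mult_right_mono) simp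
  moreover have "(1 / s) ^ k * (1 / s)\<^sup>2 * (exp (- 1 / s) * s\<^sup>2) = (1 / s) ^ k * exp (- 1 / s) * ((1 / s)\<^sup>2 * s\<^sup>2)"
    "fact (k + 2) * exp (1 / s) * (exp (- 1 / s) * s\<^sup>2) = fact (k + 2) * s\<^sup>2 * (exp (1 / s) * exp (- 1 / s))"
    by (simp_all only: mult_ac)
  moreover have "exp (1 / s) * exp (- 1 / s) = 1" by (simp add: exp_add[symmetric])
  moreover have "(1 / s)\<^sup>2 * s\<^sup>2 = 1" using True by (simp add: field_simps)
  ultimately have "(1 / s) ^ k * exp (- 1 / s) \<le> fact (k + 2) * s\<^sup>2" by (simp only: mult_1_right)
  then show ?thesis using True by (simp add: flat_def)
qed (simp add: flat_def)

lemma DERIV_flat: "(flat k has_real_derivative flat (k + 2) s - real k * flat (k + 1) s) (at s)"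
proof -
  consider "s > 0" | "s < 0" | "s = 0" by linarith
  then show ?thesis
  proof cases
    case 1
    have "((\<lambda>s. (1 / s) ^ k * exp (- 1 / s)) has_real_derivative flat (k + 2) s - real k * flat (k + 1) s) (at s)"
    proof -
      have inv: "((\<lambda>s. 1 / s) has_real_derivative - ((1 / s)\<^sup>2)) (at s)"
        using 1 by (auto intro!: derivative_eq_intros simp: power2_eq_square)
      have e: "((\<lambda>s. exp (- 1 / s)) has_real_derivative exp (- 1 / s) * (1 / s)\<^sup>2) (at s)"
        using 1 by (auto intro!: derivative_eq_intros simp: power2_eq_square)
      have p: "((\<lambda>s. (1 / s) ^ k) has_real_derivative - (real k * (1 / s) ^ (k + 1))) (at s)"
        by (rule DERIV_cong[OF DERIV_power[OF inv]]) (cases k; simp add: power2_eq_square)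
      show ?thesis
        by (rule DERIV_cong[OF DERIV_mult[OF p e]]) (use 1 in \<open>simp add: flat_def power2_eq_square mult_ac\<close>)
    qed
    then show ?thesis
      by (rule has_field_derivative_transform_within_open[of _ _ _ "{0<..}"]) (use 1 in \<open>auto simp: flat_def\<close>)
  next
    case 2
    have "((\<lambda>s. 0) has_real_derivative flat (k + 2) s - real k * flat (k + 1) s) (at s)"
      using 2 by (simp add: flat_def)
    then show ?thesis
      by (rule has_field_derivative_transform_within_open[of _ _ _ "{..<0}"]) (use 2 in \<open>auto simp: flat_def\<close>)
  next
    case 3
    have "((\<lambda>h. flat k h / h) \<longlongrightarrow> 0) (at 0)"
    proof (rule Lim_null_comparison)
      show "\<forall>\<^sub>F h in at 0. norm (flat k h / h) \<le> fact (k + 2) * \<bar>h\<bar>"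
      proof (rule always_eventually, intro allI)
        fix h :: real
        have "norm (flat k h / h) \<le> fact (k + 2) * h\<^sup>2 / \<bar>h\<bar>"
          unfolding real_norm_def abs_divide by (rule divide_right_mono[OF flat_le]) simp
        also have "h\<^sup>2 / \<bar>h\<bar> = \<bar>h\<bar>" by (simp add: power2_eq_square abs_if)
        then have "fact (k + 2) * h\<^sup>2 / \<bar>h\<bar> = fact (k + 2) * \<bar>h\<bar>"
          unfolding times_divide_eq_right[symmetric] by (rule arg_cong)
        finally show "norm (flat k h / h) \<le> fact (k + 2) * \<bar>h\<bar>" .
      qed
      show "((\<lambda>h. fact (k + 2) * \<bar>h\<bar>) \<longlongrightarrow> 0) (at (0::real))" by (intro tendsto_eq_intros) auto
    qed
    then show ?thesis by (simp add: 3 has_field_derivative_iff flat_def)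
  qed
qed

text \<open>Closing the products \<open>flat k (1 + t) * flat m (1 - t)\<close> under linear combinations gives a
  set of functions that contains a derivative of each of its members.\<close>

inductive_set bumps :: "(real \<Rightarrow> real) set" where
  prod: "(\<lambda>t. flat k (1 + t) * flat m (1 - t)) \<in> bumps"
| lin: "f \<in> bumps \<Longrightarrow> g \<in> bumps \<Longrightarrow> (\<lambda>t. f t + c * g t) \<in> bumps"

lemma bumps_derivative:
  assumes "f \<in> bumps"
  shows "\<exists>f'\<in>bumps. \<forall>t. (f has_real_derivative f' t) (at t)"
  using assms
proof induction
  case (prod k m)
  define e where "e k m t = flat k (1 + t) * flat m (1 - t)" for k m t
  have e: "e k m \<in> bumps" for k m unfolding e_def by (rule bumps.prod)
  define f' where "f' t = ((e (k + 2) m t + (- real k) * e (k + 1) m t) + (-1) * e k (m + 2) t) + real m * e k (m + 1) t" for t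
  have "f' \<in> bumps" unfolding f'_def by (intro bumps.lin e)
  moreover have "((\<lambda>t. flat k (1 + t) * flat m (1 - t)) has_real_derivative f' t) (at t)" for t
  proof -
    have 1: "((\<lambda>t. flat k (1 + t)) has_real_derivative (flat (k + 2) (1 + t) - real k * flat (k + 1) (1 + t)) * 1) (at t)"
      by (rule DERIV_chain2[OF DERIV_flat]) (auto intro!: derivative_eq_intros)
    have 2: "((\<lambda>t. flat m (1 - t)) has_real_derivative (flat (m + 2) (1 - t) - real m * flat (m + 1) (1 - t)) * (-1)) (at t)"
      by (rule DERIV_chain2[OF DERIV_flat]) (auto intro!: derivative_eq_intros)
    show ?thesis
      by (rule DERIV_cong[OF DERIV_mult[OF 1 2]]) (simp add: f'_def e_def algebra_simps)
  qed
  ultimately show ?case by blast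
next
  case (lin f g c)
  then obtain f' g' where "f' \<in> bumps" "g' \<in> bumps"
    and d: "\<And>t. (f has_real_derivative f' t) (at t)" "\<And>t. (g has_real_derivative g' t) (at t)" by blast
  then have "(\<lambda>t. f' t + c * g' t) \<in> bumps" by (intro bumps.lin)
  moreover have "((\<lambda>t. f t + c * g t) has_real_derivative f' t + c * g' t) (at t)" for t
    by (intro DERIV_add DERIV_cmult d)
  ultimately show ?case by (intro bexI[of _ "\<lambda>t. f' t + c * g' t"]) auto
qed

lemma bumps_support: "f \<in> bumps \<Longrightarrow> \<bar>t\<bar> \<ge> 1 \<Longrightarrow> f t = 0"
  by (induction rule: bumps.induct) (auto simp: flat_def)

lemma bump_derivatives:
  obtains H :: "nat \<Rightarrow> real \<Rightarrow> real"
  where "\<And>l t. (H l has_real_derivative H (Suc l) t) (at t)" "\<And>l t. \<bar>t\<bar> \<ge> 1 \<Longrightarrow> H l t = 0"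
    "\<And>t. H 0 t \<ge> 0" "H 0 0 > 0"
proof -
  obtain D where D: "\<And>f. f \<in> bumps \<Longrightarrow> D f \<in> bumps" "\<And>f t. f \<in> bumps \<Longrightarrow> (f has_real_derivative D f t) (at t)"
    using bumps_derivative by metis
  define H where "H l = (D ^^ l) (\<lambda>t. flat 0 (1 + t) * flat 0 (1 - t))" for l
  have H: "H l \<in> bumps" for l
    by (induction l) (auto simp: H_def intro: D bumps.prod)
  show thesis
  proof
    show "(H l has_real_derivative H (Suc l) t) (at t)" for l t
      using D(2)[OF H[of l]] by (simp add: H_def)
    show "\<bar>t\<bar> \<ge> 1 \<Longrightarrow> H l t = 0" for l t by (rule bumps_support[OF H])
  qed (auto simp: H_def flat_def)
qed

text \<open>A mollifier comes with all its partial derivatives: \<open>\<kappa> \<alpha>\<close> is the derivative of \<open>\<kappa> 0\<close> for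
  the multi-index \<open>\<alpha>\<close>.  Symmetry of mixed derivatives is then built into the indexing.\<close>

definition mollifier :: "real \<Rightarrow> (('n::finite \<Rightarrow> nat) \<Rightarrow> real^'n \<Rightarrow> real) \<Rightarrow> bool" where
  "mollifier \<delta> \<kappa> \<longleftrightarrow>
     (\<forall>\<alpha> x. (\<kappa> \<alpha> has_derivative (\<lambda>h. \<Sum>i\<in>UNIV. h $ i * \<kappa> (\<alpha>(i := Suc (\<alpha> i))) x)) (at x)) \<and>
     (\<forall>\<alpha> x. norm x > \<delta> \<longrightarrow> \<kappa> \<alpha> x = 0) \<and>
     (\<forall>x. \<kappa> (\<lambda>_. 0) x \<ge> 0) \<and> (LINT x|lborel. \<kappa> (\<lambda>_. 0) x) = 1"

lemma mollifierD:
  assumes "mollifier \<delta> \<kappa>"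
  shows "(\<kappa> \<alpha> has_derivative (\<lambda>h. \<Sum>i\<in>UNIV. h $ i * \<kappa> (\<alpha>(i := Suc (\<alpha> i))) x)) (at x)"
    "norm x > \<delta> \<Longrightarrow> \<kappa> \<alpha> x = 0" "\<kappa> (\<lambda>_. 0) x \<ge> 0" "(LINT x|lborel. \<kappa> (\<lambda>_. 0) x) = 1"
proof -
  note M = assms[unfolded mollifier_def]
  show "(\<kappa> \<alpha> has_derivative (\<lambda>h. \<Sum>i\<in>UNIV. h $ i * \<kappa> (\<alpha>(i := Suc (\<alpha> i))) x)) (at x)"
    by (rule M[THEN conjunct1, THEN spec, THEN spec])
  show "norm x > \<delta> \<Longrightarrow> \<kappa> \<alpha> x = 0"
    by (rule M[THEN conjunct2, THEN conjunct1, THEN spec, THEN spec, THEN mp])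
  show "\<kappa> (\<lambda>_. 0) x \<ge> 0" "(LINT x|lborel. \<kappa> (\<lambda>_. 0) x) = 1" using M by simp_all
qed

lemma mollifier_exists:
  fixes \<delta> :: real
  assumes \<delta>: "\<delta> > 0"
  obtains \<kappa> :: "('n::finite \<Rightarrow> nat) \<Rightarrow> real^'n \<Rightarrow> real" where "mollifier \<delta> \<kappa>"
proof -
  obtain H :: "nat \<Rightarrow> real \<Rightarrow> real" where H: "\<And>l t. (H l has_real_derivative H (Suc l) t) (at t)" 
    "\<And>l t. \<bar>t\<bar> \<ge> 1 \<Longrightarrow> H l t = 0" "\<And>t. H 0 t \<ge> 0" "H 0 0 > 0"
    using bump_derivatives by metis
  \<comment> \<open>The cube of half side \<open>\<rho>\<close> fits into the ball of radius \<open>\<delta>\<close>.\<close>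
  define \<rho> where "\<rho> = \<delta> / real CARD('n)"
  have \<rho>: "\<rho> > 0" using \<delta> by (simp add: \<rho>_def)
  define G where "G l t = (1 / \<rho>) ^ l * H l (t / \<rho>)" for l t
  have G: "(G l has_real_derivative G (Suc l) t) (at t)" for l t
  proof -
    have "((\<lambda>t. H l (t / \<rho>)) has_real_derivative H (Suc l) (t / \<rho>) * (1 / \<rho>)) (at t)"
      by (rule DERIV_chain2[OF H(1)]) (use \<rho> in \<open>auto intro!: derivative_eq_intros\<close>)
    from DERIV_cmult[OF this, of "(1 / \<rho>) ^ l"] show ?thesis
      unfolding G_def by (simp add: mult_ac)
  qed
  define p where "p \<alpha> x = (\<Prod>k\<in>UNIV. G (\<alpha> k) (x $ k))" for \<alpha> and x :: "real^'n"
  have pd: "(p \<alpha> has_derivative (\<lambda>h. \<Sum>i\<in>UNIV. h $ i * p (\<alpha>(i := Suc (\<alpha> i))) x)) (at x)" for \<alpha> x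
  proof -
    have "((\<lambda>x. G (\<alpha> k) (x $ k)) has_derivative (\<lambda>h. h $ k * G (Suc (\<alpha> k)) (x $ k))) (at x)" for k
      using has_derivative_compose[OF bounded_linear_imp_has_derivative[OF bounded_linear_vec_nth] G[unfolded has_field_derivative_def]]
      by (simp add: mult.commute)
    then have "(p \<alpha> has_derivative (\<lambda>h. \<Sum>i\<in>UNIV. h $ i * G (Suc (\<alpha> i)) (x $ i) * (\<Prod>k\<in>UNIV - {i}. G (\<alpha> k) (x $ k)))) (at x)"
      unfolding p_def by (rule has_derivative_prod)
    moreover have "p (\<alpha>(i := Suc (\<alpha> i))) x = G (Suc (\<alpha> i)) (x $ i) * (\<Prod>k\<in>UNIV - {i}. G (\<alpha> k) (x $ k))" for i
      unfolding p_def by (subst prod.remove[of _ i]) (auto intro!: prod.cong)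
    ultimately show ?thesis by (simp add: mult.assoc)
  qed
  have supp: "p \<alpha> x = 0" if "norm x > \<delta>" for \<alpha> x
  proof -
    have "\<not> (\<forall>k. \<bar>x $ k\<bar> < \<rho>)"
    proof
      assume "\<forall>k. \<bar>x $ k\<bar> < \<rho>"
      then have "(\<Sum>k\<in>UNIV. \<bar>x $ k\<bar>) \<le> (\<Sum>k\<in>(UNIV :: 'n set). \<rho>)" by (intro sum_mono) (auto intro: less_imp_le)
      with norm_le_l1_cart[of x] that \<rho> show False by (simp add: \<rho>_def)
    qed
    then obtain k where "\<bar>x $ k\<bar> \<ge> \<rho>" by (auto simp: not_less)
    then have "\<bar>x $ k / \<rho>\<bar> \<ge> 1" using \<rho> by (auto simp: field_simps)
    then have "G (\<alpha> k) (x $ k) = 0" using H(2) by (simp add: G_def)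
    then show ?thesis unfolding p_def by (intro prod_zero) auto
  qed
  have p0: "p (\<lambda>_. 0) x \<ge> 0" for x
    unfolding p_def by (intro prod_nonneg) (auto simp: G_def H)
  have pc: "continuous_on UNIV (p \<alpha>)" for \<alpha>
    by (rule has_derivative_imp_continuous_on, rule pd)
  have int: "integrable lborel (p \<alpha>)" for \<alpha>
  proof -
    have "integrable lborel (\<lambda>x. indicator (cball 0 \<delta>) x *\<^sub>R p \<alpha> x)"
      by (rule borel_integrable_compact) (auto intro: continuous_on_subset[OF pc])
    moreover have "(\<lambda>x. indicator (cball 0 \<delta>) x *\<^sub>R p \<alpha> x) = p \<alpha>"
      using supp by (auto simp: fun_eq_iff indicator_def not_le)
    ultimately show ?thesis by simp
  qed
  define Z where "Z = (LINT x|lborel. p (\<lambda>_. 0) x)"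
  have "Z > 0"
  proof -
    have c: "p (\<lambda>_. 0) 0 > 0" unfolding p_def by (intro prod_pos) (auto simp: G_def H)
    have "isCont (p (\<lambda>_. 0)) 0" using pc by (simp add: continuous_on_eq_continuous_at)
    then obtain e where e: "e > 0" "\<And>y. dist y 0 < e \<Longrightarrow> dist (p (\<lambda>_. 0) y) (p (\<lambda>_. 0) 0) < p (\<lambda>_. 0) 0 / 2"
      unfolding continuous_at_eps_delta using c by (meson half_gt_zero)
    have "0 < p (\<lambda>_. 0) 0 / 2 * measure lborel (ball (0::real^'n) e)"
      using c e(1) content_ball_pos[of e "0::real^'n"] by simp
    also have "\<dots> = (LINT x|lborel. p (\<lambda>_. 0) 0 / 2 * indicator (ball (0::real^'n) e) x)" by simp
    also have "\<dots> \<le> Z"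
      unfolding Z_def
    proof (rule integral_mono[OF _ int])
      show "integrable lborel (\<lambda>x. p (\<lambda>_. 0) 0 / 2 * indicator (ball (0::real^'n) e) x)"
        using emeasure_bounded_finite[of "ball (0::real^'n) e"]
        by (intro integrable_mult_right integrable_real_indicator) auto
      show "p (\<lambda>_. 0) 0 / 2 * indicator (ball 0 e) x \<le> p (\<lambda>_. 0) x" for x
        using e(2)[of x] p0[of x] by (auto simp: indicator_def dist_real_def abs_if dist_commute split: if_splits)
    qed
    finally show ?thesis .
  qed
  define \<kappa> where "\<kappa> \<alpha> x = 1 / Z * p \<alpha> x" for \<alpha> x
  have "mollifier \<delta> \<kappa>"
    unfolding mollifier_def
  proof (intro conjI allI impI)
    show "(\<kappa> \<alpha> has_derivative (\<lambda>h. \<Sum>i\<in>UNIV. h $ i * \<kappa> (\<alpha>(i := Suc (\<alpha> i))) x)) (at x)" for \<alpha> x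
      using has_derivative_mult_right[OF pd, of "1 / Z" \<alpha> x]
      unfolding \<kappa>_def by (simp add: sum_divide_distrib)
    show "norm x > \<delta> \<Longrightarrow> \<kappa> \<alpha> x = 0" for \<alpha> x using supp by (simp add: \<kappa>_def)
    show "\<kappa> (\<lambda>_. 0) x \<ge> 0" for x using p0 \<open>Z > 0\<close> by (simp add: \<kappa>_def)
    show "(LINT x|lborel. \<kappa> (\<lambda>_. 0) x) = 1" using \<open>Z > 0\<close> by (simp add: \<kappa>_def Z_def)
  qed
  then show thesis by (rule that)
qed

lemma mollifier_continuous: "mollifier \<delta> \<kappa> \<Longrightarrow> continuous_on A (\<kappa> \<alpha>)"
  by (rule continuous_on_subset[OF has_derivative_imp_continuous_on subset_UNIV], rule mollifierD)

lemma partial_deriv_reflected_mollifier: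
  assumes "mollifier \<delta> \<kappa>"
  shows "partial_deriv i (\<lambda>y. c * \<kappa> \<alpha> (x - y)) = (\<lambda>y. (- c) * \<kappa> (\<alpha>(i := Suc (\<alpha> i))) (x - y))"
    "(\<lambda>y. c * \<kappa> \<alpha> (x - y)) differentiable (at y)"
proof -
  have d: "((\<lambda>y. c * \<kappa> \<alpha> (x - y)) has_derivative (\<lambda>h. c * (\<Sum>i\<in>UNIV. (- h) $ i * \<kappa> (\<alpha>(i := Suc (\<alpha> i))) (x - y)))) (at y)" for y
  proof (rule has_derivative_mult_right, rule has_derivative_compose[OF _ mollifierD(1)[OF assms]])
    show "((\<lambda>y. x - y) has_derivative (\<lambda>h. - h)) (at y)" by (auto intro!: derivative_eq_intros)
  qed
  show "(\<lambda>y. c * \<kappa> \<alpha> (x - y)) differentiable (at y)" using d by (auto simp: differentiable_def)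
  show "partial_deriv i (\<lambda>y. c * \<kappa> \<alpha> (x - y)) = (\<lambda>y. (- c) * \<kappa> (\<alpha>(i := Suc (\<alpha> i))) (x - y))"
  proof
    fix y
    show "partial_deriv i (\<lambda>y. c * \<kappa> \<alpha> (x - y)) y = (- c) * \<kappa> (\<alpha>(i := Suc (\<alpha> i))) (x - y)"
      unfolding partial_deriv_def frechet_derivative_at[OF d, symmetric]
      using sum_axis_scaleR[of i "\<lambda>j. \<kappa> (\<alpha>(j := Suc (\<alpha> j))) (x - y)"] by (simp add: sum_negf)
  qed
qed

lemma test_function_reflected_mollifier:
  assumes "mollifier \<delta> \<kappa>"
  shows "test_function (\<lambda>y. \<kappa> \<alpha> (x - y))"
  unfolding test_function_def
proof (intro conjI allI)
  have "C_k k (\<lambda>y. c * \<kappa> \<alpha> (x - y))" for k c \<alpha>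
  proof (induction k arbitrary: c \<alpha>)
    case 0
    show ?case by (auto intro!: continuous_intros continuous_on_compose2[OF mollifier_continuous[OF assms, of UNIV]])
  next
    case (Suc k)
    show ?case
      unfolding C_k.simps partial_deriv_reflected_mollifier(1)[OF assms]
      using Suc partial_deriv_reflected_mollifier(2)[OF assms] by blast
  qed
  from this[of _ 1] show "C_k k (\<lambda>y. \<kappa> \<alpha> (x - y))" for k by simp
  have "{y. \<kappa> \<alpha> (x - y) \<noteq> 0} \<subseteq> cball x \<delta>"
    using mollifierD(2)[OF assms] by (auto simp: dist_norm not_less[symmetric])
  then have "bounded {y. \<kappa> \<alpha> (x - y) \<noteq> 0}" using bounded_cball bounded_subset by blast
  then show "compact (closure {y. \<kappa> \<alpha> (x - y) \<noteq> 0})" by (simp add: compact_closure)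
qed

section \<open>Convolution and approximation in the mean\<close>

definition convolve :: "('a::euclidean_space \<Rightarrow> real) \<Rightarrow> ('a \<Rightarrow> 'b::euclidean_space) \<Rightarrow> 'a \<Rightarrow> 'b" where
  "convolve \<kappa> u x = (LINT y|lborel. \<kappa> (x - y) *\<^sub>R u y)"

text \<open>For \<open>z\<close> near \<open>x\<close> the convolution is an integral over a fixed box, under which the kernel can be
  differentiated.\<close>

lemma convolve_has_derivative:
  fixes u :: "real^'n::finite \<Rightarrow> 'b::euclidean_space"
  assumes \<kappa>: "mollifier \<delta> \<kappa>" and u: "continuous_on UNIV u"
  shows "(convolve (\<kappa> \<alpha>) u has_derivative
    (\<lambda>h. \<Sum>i\<in>UNIV. h $ i *\<^sub>R convolve (\<kappa> (\<alpha>(i := Suc (\<alpha> i)))) u x)) (at x)"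
proof -
  obtain a where a: "cball x (1 + \<bar>\<delta>\<bar>) \<subseteq> cbox (-a) a"
    using bounded_subset_cbox_symmetric[OF bounded_cball] by metis
  have \<kappa>c: "continuous_on A (\<lambda>z. \<kappa> \<alpha> (f z))" if "continuous_on A f" for \<alpha> f and A :: "'z::topological_space set"
    using continuous_on_compose2[OF mollifier_continuous[OF \<kappa>, of UNIV] that] by simp
  have uc: "continuous_on A (\<lambda>z. u (f z))" if "continuous_on A f" for f and A :: "'z::topological_space set"
    using continuous_on_compose2[OF u that] by simp
  have eq: "convolve (\<kappa> \<alpha>) u z = integral (cbox (-a) a) (\<lambda>y. \<kappa> \<alpha> (z - y) *\<^sub>R u y)"
    and int: "(\<lambda>y. \<kappa> \<alpha> (z - y) *\<^sub>R u y) integrable_on cbox (-a) a" if z: "z \<in> ball x 1" for \<alpha> z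
  proof -
    have ind: "indicator (cbox (-a) a) y *\<^sub>R (\<kappa> \<alpha> (z - y) *\<^sub>R u y) = \<kappa> \<alpha> (z - y) *\<^sub>R u y" for y
    proof (cases "norm (z - y) > \<delta>")
      case True
      then show ?thesis by (simp add: mollifierD(2)[OF \<kappa>])
    next
      case False
      have "dist x y \<le> dist x z + dist z y" by (rule dist_triangle)
      then have "y \<in> cball x (1 + \<bar>\<delta>\<bar>)" using False z by (simp add: dist_norm)
      then show ?thesis using a by auto
    qed
    have "continuous_on (cbox (-a) a) (\<lambda>y. \<kappa> \<alpha> (z - y) *\<^sub>R u y)"
      by (intro continuous_intros \<kappa>c uc)
    then have "set_integrable lborel (cbox (-a) a) (\<lambda>y. \<kappa> \<alpha> (z - y) *\<^sub>R u y)"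
      unfolding set_integrable_def by (intro borel_integrable_compact) auto
    note hk = set_borel_integral_eq_integral[OF this]
    show "convolve (\<kappa> \<alpha>) u z = integral (cbox (-a) a) (\<lambda>y. \<kappa> \<alpha> (z - y) *\<^sub>R u y)"
      using hk(2) unfolding convolve_def set_lebesgue_integral_def by (simp only: ind)
    show "(\<lambda>y. \<kappa> \<alpha> (z - y) *\<^sub>R u y) integrable_on cbox (-a) a" by (rule hk(1))
  qed
  define fx where "fx z y = (\<Sum>i\<in>UNIV. \<kappa> (\<alpha>(i := Suc (\<alpha> i))) (z - y) *\<^sub>R
     (blinfun_scaleR_left (u y) o\<^sub>L blinfun_inner_left (axis i (1::real))))" for z y :: "real^'n"
  have fx: "blinfun_apply (fx z y) h = (\<Sum>i\<in>UNIV. h $ i *\<^sub>R (\<kappa> (\<alpha>(i := Suc (\<alpha> i))) (z - y) *\<^sub>R u y))" for z y h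
    unfolding fx_def by (simp add: blinfun.sum_left blinfun.scaleR_left inner_axis mult.commute)
  have "((\<lambda>z. integral (cbox (-a) a) (\<lambda>y. \<kappa> \<alpha> (z - y) *\<^sub>R u y)) has_derivative
     blinfun_apply (integral (cbox (-a) a) (fx x))) (at x within ball x 1)"
  proof (rule leibniz_rule[OF _ int])
    fix z y :: "real^'n" assume "z \<in> ball x 1"
    have "((\<lambda>z. z - y) has_derivative (\<lambda>h. h)) (at z)" by (auto intro!: derivative_eq_intros)
    from has_derivative_compose[OF this mollifierD(1)[OF \<kappa>]]
    have "((\<lambda>z. \<kappa> \<alpha> (z - y)) has_derivative (\<lambda>h. \<Sum>i\<in>UNIV. h $ i * \<kappa> (\<alpha>(i := Suc (\<alpha> i))) (z - y))) (at z)" .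
    from has_derivative_scaleR_left[OF this, of "u y"]
    have "((\<lambda>z. \<kappa> \<alpha> (z - y) *\<^sub>R u y) has_derivative blinfun_apply (fx z y)) (at z)"
      by (rule has_derivative_eq_rhs) (simp add: fun_eq_iff fx scaleR_sum_left)
    then show "((\<lambda>z. \<kappa> \<alpha> (z - y) *\<^sub>R u y) has_derivative blinfun_apply (fx z y)) (at z within ball x 1)"
      by (rule has_derivative_at_withinI)
  next
    show "continuous_on (ball x 1 \<times> cbox (-a) a) (\<lambda>(z, y). fx z y)"
      unfolding fx_def case_prod_beta
      by (intro continuous_intros \<kappa>c uc bounded_bilinear.continuous_on[OF bounded_bilinear_blinfun_compose]
            bounded_linear.continuous_on[OF bounded_linear_blinfun_scaleR_left])
  qed (auto simp: convex_ball)
  moreover have "blinfun_apply (integral (cbox (-a) a) (fx x)) h =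
     (\<Sum>i\<in>UNIV. h $ i *\<^sub>R convolve (\<kappa> (\<alpha>(i := Suc (\<alpha> i)))) u x)" for h
  proof -
    have "continuous_on (cbox (-a) a) (fx x)"
      unfolding fx_def
      by (intro continuous_intros \<kappa>c uc bounded_bilinear.continuous_on[OF bounded_bilinear_blinfun_compose]
            bounded_linear.continuous_on[OF bounded_linear_blinfun_scaleR_left])
    then have "blinfun_apply (integral (cbox (-a) a) (fx x)) h = integral (cbox (-a) a) (\<lambda>y. blinfun_apply (fx x y) h)"
      by (intro blinfun_apply_integral integrable_continuous)
    also have "\<dots> = (\<Sum>i\<in>UNIV. integral (cbox (-a) a) (\<lambda>y. h $ i *\<^sub>R (\<kappa> (\<alpha>(i := Suc (\<alpha> i))) (x - y) *\<^sub>R u y)))"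
      unfolding fx by (rule Henstock_Kurzweil_Integration.integral_sum) (simp, intro integrable_cmul int, simp)
    also have "\<dots> = (\<Sum>i\<in>UNIV. h $ i *\<^sub>R convolve (\<kappa> (\<alpha>(i := Suc (\<alpha> i)))) u x)"
      by (simp add: eq del: scaleR_scaleR)
    finally show ?thesis .
  qed
  ultimately have "((\<lambda>z. integral (cbox (-a) a) (\<lambda>y. \<kappa> \<alpha> (z - y) *\<^sub>R u y)) has_derivative
     (\<lambda>h. \<Sum>i\<in>UNIV. h $ i *\<^sub>R convolve (\<kappa> (\<alpha>(i := Suc (\<alpha> i)))) u x)) (at x within ball x 1)"
    by (rule has_derivative_eq_rhs[OF _ ext])
  then have "(convolve (\<kappa> \<alpha>) u has_derivative
     (\<lambda>h. \<Sum>i\<in>UNIV. h $ i *\<^sub>R convolve (\<kappa> (\<alpha>(i := Suc (\<alpha> i)))) u x)) (at x within ball x 1)"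
    by (rule has_derivative_transform_within[where d = 1]) (auto simp: eq)
  then show ?thesis by (subst (asm) at_within_open) auto
qed

lemma C2_map_convolve:
  fixes u :: "real^'n::finite \<Rightarrow> 'b::euclidean_space"
  assumes \<kappa>: "mollifier \<delta> \<kappa>" and u: "continuous_on UNIV u"
  defines "\<epsilon> \<equiv> \<lambda>i. (\<lambda>_. 0 :: nat)(i := 1)"
  shows "C2_map (convolve (\<kappa> (\<lambda>_. 0)) u) (\<lambda>i. convolve (\<kappa> (\<epsilon> i)) u)
    (\<lambda>i j. convolve (\<kappa> ((\<epsilon> i)(j := Suc (\<epsilon> i j)))) u)"
  unfolding C2_map_def
proof (intro conjI allI impI)
  show "(convolve (\<kappa> (\<lambda>_. 0)) u has_derivative (\<lambda>h. \<Sum>i\<in>UNIV. h $ i *\<^sub>R convolve (\<kappa> (\<epsilon> i)) u x)) (at x)" for x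
    using convolve_has_derivative[OF \<kappa> u, of "\<lambda>_. 0" x] by (simp add: \<epsilon>_def)
  show "(convolve (\<kappa> (\<epsilon> i)) u has_derivative
    (\<lambda>h. \<Sum>j\<in>UNIV. h $ j *\<^sub>R convolve (\<kappa> ((\<epsilon> i)(j := Suc (\<epsilon> i j)))) u x)) (at x)" for i x
    by (rule convolve_has_derivative[OF \<kappa> u])
  show "continuous_on UNIV (convolve (\<kappa> ((\<epsilon> i)(j := Suc (\<epsilon> i j)))) u)" for i j
    by (rule has_derivative_imp_continuous_on, rule convolve_has_derivative[OF \<kappa> u])
  show "convolve (\<kappa> ((\<epsilon> i)(j := Suc (\<epsilon> i j)))) u x = convolve (\<kappa> ((\<epsilon> j)(i := Suc (\<epsilon> j i)))) u x" if "i \<noteq> j" for i j x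
    using that by (simp add: \<epsilon>_def fun_upd_twist)
qed

lemma integrable_mollifier_scaleR:
  fixes u :: "real^'n::finite \<Rightarrow> 'b::euclidean_space"
  assumes \<kappa>: "mollifier \<delta> \<kappa>" and u[measurable]: "u \<in> borel_measurable borel"
    and loc: "\<And>R. integrable lborel (\<lambda>x. indicator (cball 0 R) x *\<^sub>R u x)"
  shows "integrable lborel (\<lambda>y. \<kappa> \<alpha> (x - y) *\<^sub>R u y)"
proof -
  have kc: "continuous_on A (\<kappa> \<alpha>)" for A by (rule mollifier_continuous[OF \<kappa>])
  then have [measurable]: "\<kappa> \<alpha> \<in> borel_measurable borel" by (rule borel_measurable_continuous_onI)
  have "compact (\<kappa> \<alpha> ` cball 0 \<delta>)" by (intro compact_continuous_image kc) auto
  then obtain M where M: "\<And>z. z \<in> cball 0 \<delta> \<Longrightarrow> norm (\<kappa> \<alpha> z) \<le> M"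
    using compact_imp_bounded bounded_iff by (metis image_eqI)
  show ?thesis
  proof (rule Bochner_Integration.integrable_bound[OF integrable_mult_right[OF integrable_norm[OF loc[of "norm x + \<delta>"]], of M]])
    show "AE y in lborel. norm (\<kappa> \<alpha> (x - y) *\<^sub>R u y) \<le> norm (M * norm (indicator (cball 0 (norm x + \<delta>)) y *\<^sub>R u y))"
    proof (rule AE_I2)
      fix y
      show "norm (\<kappa> \<alpha> (x - y) *\<^sub>R u y) \<le> norm (M * norm (indicator (cball 0 (norm x + \<delta>)) y *\<^sub>R u y))"
      proof (cases "norm (x - y) > \<delta>")
        case False
        moreover from this have "norm y \<le> norm x + \<delta>" using norm_triangle_sub[of y x] by (simp add: norm_minus_commute)
        ultimately show ?thesis using M[of "x - y"] by (simp add: abs_mult mult_right_mono)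
      qed (simp add: mollifierD(2)[OF \<kappa>])
    qed
  qed measurable
qed

lemma mollifier_nn_integral:
  assumes \<kappa>: "mollifier \<delta> \<kappa>"
  shows "(\<integral>\<^sup>+y. ennreal (\<kappa> (\<lambda>_. 0) (x - y)) \<partial>lborel) = 1" "(\<integral>\<^sup>+x. ennreal (\<kappa> (\<lambda>_. 0) (x - y)) \<partial>lborel) = 1"
proof -
  define k where "k = \<kappa> (\<lambda>_. 0)"
  have "continuous_on UNIV k" unfolding k_def by (rule mollifier_continuous[OF \<kappa>])
  then have [measurable]: "k \<in> borel_measurable borel" by (rule borel_measurable_continuous_onI)
  have k0: "k z \<ge> 0" for z unfolding k_def by (rule mollifierD[OF \<kappa>])
  have "(\<integral>\<^sup>+z. ennreal (k z) \<partial>lborel) = 1"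
    using mollifierD(4)[OF \<kappa>] not_integrable_integral_eq[of lborel k] k0
    by (subst nn_integral_eq_integral) (auto simp: k_def)
  then show "(\<integral>\<^sup>+y. ennreal (\<kappa> (\<lambda>_. 0) (x - y)) \<partial>lborel) = 1" "(\<integral>\<^sup>+x. ennreal (\<kappa> (\<lambda>_. 0) (x - y)) \<partial>lborel) = 1"
    using nn_integral_lborel_affine[of "\<lambda>z. ennreal (k z)" "-1" x] nn_integral_lborel_affine[of "\<lambda>z. ennreal (k z)" 1 "-y"]
    unfolding k_def[symmetric] by simp_all
qed

text \<open>Jensen's inequality for the probability density \<open>y \<mapsto> \<kappa> (x - y)\<close>.\<close>

lemma convolve_diff_power_le:
  fixes u :: "real^'n::finite \<Rightarrow> 'b::euclidean_space"
  assumes \<kappa>: "mollifier \<delta> \<kappa>" and u[measurable]: "u \<in> borel_measurable borel"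
    and loc: "\<And>R. integrable lborel (\<lambda>x. indicator (cball 0 R) x *\<^sub>R u x)" and p: "p \<ge> 1"
  shows "ennreal (norm (convolve (\<kappa> (\<lambda>_. 0)) u x - u x) ^ p) \<le>
    (\<integral>\<^sup>+y. ennreal (\<kappa> (\<lambda>_. 0) (x - y)) * ennreal (norm (u y - u x) ^ p) \<partial>lborel)"
proof -
  define k where "k = \<kappa> (\<lambda>_. 0)"
  have kc: "continuous_on UNIV k" unfolding k_def by (rule mollifier_continuous[OF \<kappa>])
  then have [measurable]: "k \<in> borel_measurable borel" by (rule borel_measurable_continuous_onI)
  have k0: "k z \<ge> 0" for z unfolding k_def by (rule mollifierD[OF \<kappa>])
  have kint: "(\<integral>\<^sup>+y. ennreal (k (x - y)) \<partial>lborel) = 1"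
    unfolding k_def by (rule mollifier_nn_integral(1)[OF \<kappa>])
  have int_k: "integrable lborel (\<lambda>y. k (x - y))"
    by (rule integrableI_nonneg) (auto simp: k0 kint)
  have int_ku: "integrable lborel (\<lambda>y. k (x - y) *\<^sub>R u y)"
    unfolding k_def by (rule integrable_mollifier_scaleR[OF \<kappa> u loc])
  define D where "D = density lborel (\<lambda>y. ennreal (k (x - y)))"
  have "convolve k u x - u x = (LINT y|lborel. k (x - y) *\<^sub>R u y) - (LINT y|lborel. k (x - y)) *\<^sub>R u x"
    using kint by (simp add: convolve_def integral_eq_nn_integral k0)
  also have "\<dots> = (LINT y|lborel. k (x - y) *\<^sub>R (u y - u x))"
    using int_k int_ku by (simp add: scaleR_diff_right)
  finally have "ennreal (norm (convolve k u x - u x)) = ennreal (norm (LINT y|lborel. k (x - y) *\<^sub>R (u y - u x)))" by simp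
  also have "\<dots> \<le> (\<integral>\<^sup>+y. ennreal (norm (k (x - y) *\<^sub>R (u y - u x))) \<partial>lborel)"
    using int_k int_ku by (intro integral_norm_bound_ennreal) (auto simp: scaleR_diff_right)
  also have "\<dots> = (\<integral>\<^sup>+y. ennreal (norm (u y - u x)) \<partial>D)"
    unfolding D_def by (subst nn_integral_density) (auto simp: k0 ennreal_mult)
  finally have "ennreal (norm (convolve k u x - u x)) ^ p \<le> (\<integral>\<^sup>+y. ennreal (norm (u y - u x)) \<partial>D) ^ p"
    by (rule power_mono) simp
  also have "\<dots> \<le> (\<integral>\<^sup>+y. ennreal (norm (u y - u x)) ^ p \<partial>D)"
    by (rule power_nn_integral_le) (use p in \<open>auto simp: D_def emeasure_density kint\<close>)
  also have "\<dots> = (\<integral>\<^sup>+y. ennreal (k (x - y)) * ennreal (norm (u y - u x) ^ p) \<partial>lborel)"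
    unfolding D_def by (subst nn_integral_density) (auto simp: ennreal_power)
  finally show ?thesis by (simp add: k_def ennreal_power)
qed

lemma convolve_tendsto:
  fixes u :: "real^'n::finite \<Rightarrow> 'b::euclidean_space"
  assumes u: "continuous_on UNIV u" and e: "e > 0"
  shows "\<exists>\<delta>0>0. \<forall>\<delta> \<kappa>. \<delta> \<le> \<delta>0 \<longrightarrow> mollifier \<delta> \<kappa> \<longrightarrow> norm (convolve (\<kappa> (\<lambda>_. 0)) u x - u x) \<le> e"
proof -
  have um[measurable]: "u \<in> borel_measurable borel" using u by (rule borel_measurable_continuous_onI)
  have loc: "integrable lborel (\<lambda>x. indicator (cball 0 R) x *\<^sub>R u x)" for R
    by (rule borel_integrable_compact) (auto intro: continuous_on_subset[OF u])
  have "isCont u x" using u by (simp add: continuous_on_eq_continuous_at)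
  then obtain d where d: "d > 0" "\<And>y. dist y x < d \<Longrightarrow> dist (u y) (u x) < e"
    unfolding continuous_at_eps_delta using e by metis
  show ?thesis
  proof (intro exI[of _ "d/2"] conjI allI impI)
    fix \<delta> and \<kappa> :: "('n \<Rightarrow> nat) \<Rightarrow> real^'n \<Rightarrow> real"
    assume \<delta>: "\<delta> \<le> d / 2" and \<kappa>: "mollifier \<delta> \<kappa>"
    have "ennreal (norm (convolve (\<kappa> (\<lambda>_. 0)) u x - u x) ^ 1) \<le>
      (\<integral>\<^sup>+y. ennreal (\<kappa> (\<lambda>_. 0) (x - y)) * ennreal (norm (u y - u x) ^ 1) \<partial>lborel)"
      by (rule convolve_diff_power_le[OF \<kappa> um loc]) simp
    also have "\<dots> \<le> (\<integral>\<^sup>+y. ennreal (\<kappa> (\<lambda>_. 0) (x - y)) * ennreal e \<partial>lborel)"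
    proof (rule nn_integral_mono)
      fix y
      show "ennreal (\<kappa> (\<lambda>_. 0) (x - y)) * ennreal (norm (u y - u x) ^ 1) \<le> ennreal (\<kappa> (\<lambda>_. 0) (x - y)) * ennreal e"
      proof (cases "norm (x - y) > \<delta>")
        case False
        then have "dist y x < d" using \<delta> d(1) by (simp add: dist_norm norm_minus_commute)
        then show ?thesis using d(2)[of y] by (intro mult_left_mono ennreal_leI) (auto simp: dist_norm)
      qed (simp add: mollifierD(2)[OF \<kappa>])
    qed
    also have "\<dots> = ennreal e"
      using mollifier_nn_integral(1)[OF \<kappa>, of x] borel_measurable_continuous_onI[OF mollifier_continuous[OF \<kappa>, of UNIV]]
      by (subst nn_integral_multc) auto
    finally show "norm (convolve (\<kappa> (\<lambda>_. 0)) u x - u x) \<le> e"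
      using e by simp
  qed (use d in auto)
qed

definition truncate :: "real \<Rightarrow> 'b::real_normed_vector \<Rightarrow> 'b" where
  "truncate M v = (M / max M (norm v)) *\<^sub>R v"

lemma truncate:
  assumes "M > 0"
  shows "norm (truncate M v) \<le> M" "norm v \<le> M \<Longrightarrow> truncate M v = v" "norm (truncate M v - v) \<le> norm v"
    "continuous_on UNIV (truncate M :: 'b::real_normed_vector \<Rightarrow> 'b)"
proof -
  have "norm v * M \<le> max M (norm v) * M" using assms by (intro mult_right_mono) auto
  then show "norm (truncate M v) \<le> M"
    using assms by (auto simp: truncate_def field_simps)
  show "norm v \<le> M \<Longrightarrow> truncate M v = v" using assms by (simp add: truncate_def max_def)
  have "truncate M v - v = (M / max M (norm v) - 1) *\<^sub>R v" by (simp add: truncate_def scaleR_diff_left)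
  moreover have "0 \<le> M / max M (norm v)" "M / max M (norm v) \<le> 1"
    using assms by (auto simp: le_max_iff_disj less_max_iff_disj pos_divide_le_eq)
  then have "\<bar>M / max M (norm v) - 1\<bar> \<le> 1" by linarith
  ultimately show "norm (truncate M v - v) \<le> norm v" by (simp add: mult_left_le_one_le)
  show "continuous_on UNIV (truncate M :: 'b \<Rightarrow> 'b)"
    unfolding truncate_def using assms by (intro continuous_intros) auto
qed

text \<open>A measurable function is almost everywhere a limit of continuous ones, but without a majorant.
  Truncating \<open>u\<close> at a large height, and the approximating functions at the same height, supplies a
  bounded one.\<close>

lemma continuous_approximation:
  fixes u :: "'a::euclidean_space \<Rightarrow> 'b::euclidean_space"
  assumes u[measurable]: "u \<in> borel_measurable borel" and B[measurable]: "B \<in> sets borel" and bB: "bounded B"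
    and fin: "(\<integral>\<^sup>+x\<in>B. ennreal (norm (u x) ^ p) \<partial>lborel) < \<infinity>" and e: "e > 0" and p: "p \<ge> 1"
  shows "\<exists>h. continuous_on UNIV h \<and> (\<integral>\<^sup>+x\<in>B. ennreal (norm (h x - u x) ^ p) \<partial>lborel) < ennreal e"
proof -
  define e' where "e' = e / 2 ^ (p + 1)"
  have e': "e' > 0" using e by (simp add: e'_def)
  have "(\<lambda>n. \<integral>\<^sup>+x\<in>B. ennreal (norm (truncate (real (Suc n)) (u x) - u x) ^ p) \<partial>lborel)
    \<longlonglongrightarrow> (\<integral>\<^sup>+x. 0 \<partial>(lborel :: 'a measure))"
  proof (rule nn_integral_dominated_convergence[where w = "\<lambda>x. ennreal (norm (u x) ^ p) * indicator B x"])
    have [measurable]: "truncate (real (Suc n)) \<in> borel_measurable (borel :: 'b measure)" for n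
      by (rule borel_measurable_continuous_onI, rule truncate(4)) simp
    show "(\<lambda>x. ennreal (norm (truncate (real (Suc n)) (u x) - u x) ^ p) * indicator B x) \<in> borel_measurable lborel" for n
      by measurable
    show "AE x in lborel. ennreal (norm (truncate (real (Suc n)) (u x) - u x) ^ p) * indicator B x
       \<le> ennreal (norm (u x) ^ p) * indicator B x" for n
      by (intro AE_I2 mult_right_mono ennreal_leI power_mono truncate(3)) auto
    show "AE x in lborel. (\<lambda>n. ennreal (norm (truncate (real (Suc n)) (u x) - u x) ^ p) * indicator B x) \<longlonglongrightarrow> 0"
    proof (rule AE_I2, rule tendsto_eventually)
      fix x
      obtain N where "norm (u x) \<le> real N" using real_arch_simple by blast
      then have "truncate (real (Suc n)) (u x) = u x" if "n \<ge> N" for n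
        using that by (intro truncate(2)) auto
      then show "\<forall>\<^sub>F n in sequentially. ennreal (norm (truncate (real (Suc n)) (u x) - u x) ^ p) * indicator B x = 0"
        unfolding eventually_sequentially using p by (intro exI[of _ N]) auto
    qed
  qed (use fin in auto)
  then have "\<forall>\<^sub>F n in sequentially. (\<integral>\<^sup>+x\<in>B. ennreal (norm (truncate (real (Suc n)) (u x) - u x) ^ p) \<partial>lborel) < ennreal e'"
    using e' by (intro order_tendstoD(2)[where y = 0]) auto
  then obtain n0 where n0: "(\<integral>\<^sup>+x\<in>B. ennreal (norm (truncate (real (Suc n0)) (u x) - u x) ^ p) \<partial>lborel) < ennreal e'"
    by (auto simp: eventually_sequentially)
  define T where "T = (truncate (real (Suc n0)) :: 'b \<Rightarrow> 'b)"
  have T: "continuous_on UNIV T" "\<And>v. norm (T v) \<le> real (Suc n0)" unfolding T_def by (intro truncate; simp)+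
  have [measurable]: "T \<in> borel_measurable borel" using T(1) by (rule borel_measurable_continuous_onI)
  have "u measurable_on UNIV" by (rule lebesgue_measurable_imp_measurable_on) (auto intro: measurable_completion)
  then obtain N g where N: "negligible N" and g: "\<And>n. continuous_on UNIV (g n)" and lim: "\<And>x. x \<notin> N \<Longrightarrow> (\<lambda>n. g n x) \<longlonglongrightarrow> u x"
    unfolding measurable_on_def by auto
  have [measurable]: "g n \<in> borel_measurable borel" for n using g by (rule borel_measurable_continuous_onI)
  have AEN: "AE x in lborel. x \<notin> N"
    using AE_not_in[OF N[unfolded negligible_iff_null_sets]] unfolding AE_completion_iff .
  have "(\<lambda>n. \<integral>\<^sup>+x\<in>B. ennreal (norm (T (g n x) - T (u x)) ^ p) \<partial>lborel) \<longlonglongrightarrow> (\<integral>\<^sup>+x. 0 \<partial>(lborel :: 'a measure))"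
  proof (rule nn_integral_dominated_convergence[where w = "\<lambda>x. ennreal ((2 * real (Suc n0)) ^ p) * indicator B x"])
    show "AE x in lborel. ennreal (norm (T (g n x) - T (u x)) ^ p) * indicator B x \<le> ennreal ((2 * real (Suc n0)) ^ p) * indicator B x" for n
    proof (intro AE_I2 mult_right_mono ennreal_leI power_mono)
      show "norm (T (g n x) - T (u x)) \<le> 2 * real (Suc n0)" for x
        using norm_triangle_ineq4[of "T (g n x)" "T (u x)"] T(2)[of "g n x"] T(2)[of "u x"] by simp
    qed auto
    show "(\<integral>\<^sup>+x. ennreal ((2 * real (Suc n0)) ^ p) * indicator B x \<partial>lborel) < \<infinity>"
      using emeasure_bounded_finite[OF bB] by (simp add: nn_integral_cmult ennreal_mult_less_top)
    show "AE x in lborel. (\<lambda>n. ennreal (norm (T (g n x) - T (u x)) ^ p) * indicator B x) \<longlonglongrightarrow> 0"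
      using AEN
    proof eventually_elim
      case (elim x)
      have "isCont T (u x)" using T(1) by (simp add: continuous_on_eq_continuous_at)
      then have "(\<lambda>n. T (g n x)) \<longlonglongrightarrow> T (u x)" using lim[OF elim] by (rule isCont_tendsto_compose)
      then have "(\<lambda>n. norm (T (g n x) - T (u x)) ^ p) \<longlonglongrightarrow> norm (T (u x) - T (u x)) ^ p"
        by (intro tendsto_intros)
      then have "(\<lambda>n. norm (T (g n x) - T (u x)) ^ p) \<longlonglongrightarrow> 0"
        using p by (simp only: diff_self norm_zero) (simp add: power_0_left)
      from tendsto_ennrealI[OF this]
      have "(\<lambda>n. ennreal (norm (T (g n x) - T (u x)) ^ p)) \<longlonglongrightarrow> 0" by simp
      then show ?case by (cases "x \<in> B") auto
    qed
  qed measurable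
  then have "\<forall>\<^sub>F n in sequentially. (\<integral>\<^sup>+x\<in>B. ennreal (norm (T (g n x) - T (u x)) ^ p) \<partial>lborel) < ennreal e'"
    using e' by (intro order_tendstoD(2)[where y = 0]) auto
  then obtain n1 where n1: "(\<integral>\<^sup>+x\<in>B. ennreal (norm (T (g n1 x) - T (u x)) ^ p) \<partial>lborel) < ennreal e'"
    by (auto simp: eventually_sequentially)
  have "(\<integral>\<^sup>+x\<in>B. ennreal (norm (T (g n1 x) - u x) ^ p) \<partial>lborel) \<le>
    (\<integral>\<^sup>+x. ennreal (2 ^ p) * (ennreal (norm (T (g n1 x) - T (u x)) ^ p) * indicator B x + ennreal (norm (T (u x) - u x) ^ p) * indicator B x) \<partial>lborel)"
  proof (rule nn_integral_mono)
    fix x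
    have "norm (T (g n1 x) - u x) ^ p \<le> (norm (T (g n1 x) - T (u x)) + norm (T (u x) - u x)) ^ p"
      using norm_triangle_ineq[of "T (g n1 x) - T (u x)" "T (u x) - u x"] by (intro power_mono) auto
    also have "\<dots> \<le> 2 ^ p * (norm (T (g n1 x) - T (u x)) ^ p + norm (T (u x) - u x) ^ p)"
      by (rule power_add_le) auto
    finally have "ennreal (norm (T (g n1 x) - u x) ^ p) \<le> ennreal (2 ^ p * (norm (T (g n1 x) - T (u x)) ^ p + norm (T (u x) - u x) ^ p))"
      by (rule ennreal_leI)
    then show "ennreal (norm (T (g n1 x) - u x) ^ p) * indicator B x \<le>
      ennreal (2 ^ p) * (ennreal (norm (T (g n1 x) - T (u x)) ^ p) * indicator B x + ennreal (norm (T (u x) - u x) ^ p) * indicator B x)"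
      by (cases "x \<in> B") (auto simp: ennreal_mult)
  qed
  also have "\<dots> = ennreal (2 ^ p) * ((\<integral>\<^sup>+x\<in>B. ennreal (norm (T (g n1 x) - T (u x)) ^ p) \<partial>lborel)
      + (\<integral>\<^sup>+x\<in>B. ennreal (norm (T (u x) - u x) ^ p) \<partial>lborel))"
    by (simp add: nn_integral_cmult nn_integral_add)
  also have "\<dots> < ennreal (2 ^ p) * (ennreal e' + ennreal e')"
    using n0 n1 by (intro ennreal_mult_strict_left_mono add_strict_mono) (auto simp: T_def)
  also have "\<dots> = ennreal e" using e' e by (simp add: ennreal_mult[symmetric] ennreal_plus[symmetric] e'_def del: ennreal_plus)
  finally have "(\<integral>\<^sup>+x\<in>B. ennreal (norm (T (g n1 x) - u x) ^ p) \<partial>lborel) < ennreal e" .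
  moreover have "continuous_on UNIV (\<lambda>x. T (g n1 x))" using continuous_on_compose2[OF T(1) g] by simp
  ultimately show ?thesis by blast
qed

lemma locally_integrable_of_power:
  fixes u :: "'a::euclidean_space \<Rightarrow> 'b::euclidean_space"
  assumes u[measurable]: "u \<in> borel_measurable borel" and p: "p \<ge> 1"
    and fin: "(\<integral>\<^sup>+x\<in>cball 0 R. ennreal (norm (u x) ^ p) \<partial>lborel) < \<infinity>"
  shows "integrable lborel (\<lambda>x. indicator (cball 0 R) x *\<^sub>R u x)"
proof -
  define C where "C = cball (0::'a) R"
  have [measurable]: "C \<in> sets borel" and C: "bounded C" by (auto simp: C_def)
  have "integrable lborel (\<lambda>x. indicator C x *\<^sub>R u x)"
  proof (rule integrableI_bounded)
  have "(\<integral>\<^sup>+x. ennreal (norm (indicator (C) x *\<^sub>R u x)) \<partial>lborel)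
    \<le> (\<integral>\<^sup>+x. indicator (C) x + ennreal (norm (u x) ^ p) * indicator (C) x \<partial>lborel)"
  proof (rule nn_integral_mono)
    fix x
    have "norm (u x) \<le> 1 + norm (u x) ^ p"
    proof (cases "norm (u x) \<le> 1")
      case False
      then have "norm (u x) ^ 1 \<le> norm (u x) ^ p" by (intro power_increasing p) auto
      then show ?thesis by simp
    qed (simp add: add_increasing2)
    then have "ennreal (norm (u x)) \<le> ennreal (1 + norm (u x) ^ p)" by (rule ennreal_leI)
    then show "ennreal (norm (indicator (C) x *\<^sub>R u x))
      \<le> indicator (C) x + ennreal (norm (u x) ^ p) * indicator (C) x"
      by (cases "x \<in> C") (auto simp: ennreal_plus)
  qed
  also have "\<dots> = emeasure lborel (C) + (\<integral>\<^sup>+x\<in>C. ennreal (norm (u x) ^ p) \<partial>lborel)"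
    by (subst nn_integral_add) auto
  also have "\<dots> < \<infinity>"
    using fin[folded C_def] emeasure_bounded_finite[OF C] by (simp add: ennreal_add_eq_top less_top)
  finally show "(\<integral>\<^sup>+x. ennreal (norm (indicator (C) x *\<^sub>R u x)) \<partial>lborel) < \<infinity>" .
  qed measurable
  then show ?thesis by (simp add: C_def)
qed

lemma power_add3_le:
  fixes a b c :: real
  assumes "a \<ge> 0" "b \<ge> 0" "c \<ge> 0"
  shows "(a + b + c) ^ p \<le> 4 ^ p * (a ^ p + b ^ p + c ^ p)"
proof -
  have "(a + b + c) ^ p \<le> 2 ^ p * ((a + b) ^ p + c ^ p)" by (rule power_add_le) (use assms in auto)
  also have "\<dots> \<le> 2 ^ p * (2 ^ p * (a ^ p + b ^ p) + 2 ^ p * c ^ p)"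
  proof (intro mult_left_mono add_mono power_add_le)
    have "1 * c ^ p \<le> 2 ^ p * c ^ p" by (rule mult_right_mono) (use assms in auto)
    then show "c ^ p \<le> 2 ^ p * c ^ p" by simp
  qed (use assms in auto)
  also have "\<dots> = 4 ^ p * (a ^ p + b ^ p + c ^ p)"
    using power_mult_distrib[of "2::real" 2 p] by (simp add: algebra_simps)
  finally show ?thesis .
qed

text \<open>Convergence in the mean: replace \<open>u\<close> by a continuous function, for which the mollification
  converges uniformly on balls; both replacements cost only the mean distance to \<open>u\<close>, because
  the mollifier has mass one in each variable.\<close>

lemma convolve_tendsto_power_mean:
  fixes u :: "real^'n::finite \<Rightarrow> 'b::euclidean_space"
  assumes u[measurable]: "u \<in> borel_measurable borel" and p: "p \<ge> 1"
    and fin: "\<And>R. (\<integral>\<^sup>+x\<in>cball 0 R. ennreal (norm (u x) ^ p) \<partial>lborel) < \<infinity>" and e: "e > 0"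
  shows "\<exists>\<delta>0>0. \<forall>\<delta> \<kappa>. \<delta> \<le> \<delta>0 \<longrightarrow> mollifier \<delta> \<kappa> \<longrightarrow>
    (\<integral>\<^sup>+x\<in>cball 0 R. ennreal (norm (convolve (\<kappa> (\<lambda>_. 0)) u x - u x) ^ p) \<partial>lborel) \<le> ennreal e"
proof -
  define A where "A = cball (0::real^'n) R"
  define B where "B = cball (0::real^'n) (R + 1)"
  have [measurable]: "A \<in> sets borel" "B \<in> sets borel" by (auto simp: A_def B_def)
  have AB: "A \<subseteq> B" by (auto simp: A_def B_def)
  define e' where "e' = e / (3 * 4 ^ p)"
  have e': "e' > 0" using e by (simp add: e'_def)
  obtain h where h: "continuous_on UNIV h" and hB: "(\<integral>\<^sup>+x\<in>B. ennreal (norm (h x - u x) ^ p) \<partial>lborel) < ennreal e'"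
    using continuous_approximation[OF u, of B p e'] fin e' p by (auto simp: B_def)
  have hm[measurable]: "h \<in> borel_measurable borel" using h by (rule borel_measurable_continuous_onI)
  define \<eta> where "\<eta> = min 1 (e' / (measure lborel A + 1))"
  have m0: "measure lborel A \<ge> 0" by simp
  have \<eta>: "\<eta> > 0" "\<eta> \<le> 1" using e' m0 by (auto simp: \<eta>_def intro!: divide_pos_pos add_nonneg_pos)
  have "\<eta> ^ p * measure lborel A \<le> e'"
  proof -
    have "\<eta> ^ p \<le> \<eta> ^ 1" using \<eta> p by (intro power_decreasing) auto
    then have "\<eta> ^ p * measure lborel A \<le> \<eta> * measure lborel A" using m0 by (simp add: mult_right_mono)
    also have "\<dots> \<le> e' / (measure lborel A + 1) * (measure lborel A + 1)"
      using \<eta> m0 e' by (intro mult_mono) (auto simp: \<eta>_def)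
    also have "\<dots> = e'" using m0 by (simp add: add_nonneg_eq_0_iff)
    finally show ?thesis .
  qed
  moreover have "emeasure lborel A = ennreal (measure lborel A)"
    using emeasure_bounded_finite[of A] by (intro emeasure_eq_ennreal_measure) (auto simp: A_def)
  ultimately have \<eta>A: "ennreal (\<eta> ^ p) * emeasure lborel A \<le> ennreal e'"
    using \<eta> by (simp add: ennreal_mult[symmetric] ennreal_leI)
  have "uniformly_continuous_on B h"
    by (rule compact_uniformly_continuous) (auto simp: B_def intro: continuous_on_subset[OF h])
  then obtain d where d: "d > 0" "\<And>x y. x \<in> B \<Longrightarrow> y \<in> B \<Longrightarrow> dist y x < d \<Longrightarrow> dist (h y) (h x) < \<eta>"
    unfolding uniformly_continuous_on_def using \<eta> by metis
  show ?thesis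
  proof (intro exI[of _ "min 1 (d / 2)"] conjI allI impI)
    fix \<delta> and \<kappa> :: "('n \<Rightarrow> nat) \<Rightarrow> real^'n \<Rightarrow> real"
    assume \<delta>: "\<delta> \<le> min 1 (d / 2)" and \<kappa>: "mollifier \<delta> \<kappa>"
    define k where "k = \<kappa> (\<lambda>_. 0)"
    have [measurable]: "k \<in> borel_measurable borel" unfolding k_def
      by (rule borel_measurable_continuous_onI, rule mollifier_continuous[OF \<kappa>])
    have k0: "k z \<ge> 0" for z unfolding k_def by (rule mollifierD[OF \<kappa>])
    have k1: "(\<integral>\<^sup>+y. ennreal (k (x - y)) \<partial>lborel) = 1" "(\<integral>\<^sup>+x. ennreal (k (x - y)) \<partial>lborel) = 1" for x y
      unfolding k_def by (rule mollifier_nn_integral[OF \<kappa>])+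
    define F where "F y = ennreal (norm (h y - u y) ^ p) * indicator B y" for y
    have [measurable]: "F \<in> borel_measurable borel" unfolding F_def by measurable
    have pt: "ennreal (norm (convolve k u x - u x) ^ p) * indicator A x \<le>
       4 ^ p * ((\<integral>\<^sup>+y. ennreal (k (x - y)) * F y \<partial>lborel) + ennreal (\<eta> ^ p) * indicator A x + F x)" for x
    proof (cases "x \<in> A")
      case True
      have "ennreal (norm (convolve k u x - u x) ^ p) \<le> (\<integral>\<^sup>+y. ennreal (k (x - y)) * ennreal (norm (u y - u x) ^ p) \<partial>lborel)"
        unfolding k_def by (rule convolve_diff_power_le[OF \<kappa> u locally_integrable_of_power[OF u p fin] p])
      also have "\<dots> \<le> (\<integral>\<^sup>+y. 4 ^ p * (ennreal (k (x - y)) * F y + ennreal (k (x - y)) * (ennreal (\<eta> ^ p) + F x)) \<partial>lborel)"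
      proof (rule nn_integral_mono)
        fix y
        show "ennreal (k (x - y)) * ennreal (norm (u y - u x) ^ p) \<le> 
           4 ^ p * (ennreal (k (x - y)) * F y + ennreal (k (x - y)) * (ennreal (\<eta> ^ p) + F x))"
        proof (cases "norm (x - y) > \<delta>")
          case True
          then show ?thesis by (simp add: k_def mollifierD(2)[OF \<kappa>])
        next
          case False
          then have "norm y \<le> R + 1"
            using norm_triangle_sub[of y x] \<open>x \<in> A\<close> \<delta> by (simp add: norm_minus_commute A_def)
          then have y: "y \<in> B" and x: "x \<in> B" using \<open>x \<in> A\<close> AB by (auto simp: B_def)
          have "dist y x < d" using False \<delta> d(1) by (simp add: dist_norm norm_minus_commute)
          then have hh: "norm (h y - h x) \<le> \<eta>" using d(2)[OF x y] by (simp add: dist_norm)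
          have "norm (u y - u x) \<le> norm (h y - u y) + norm (h y - h x) + norm (h x - u x)"
            using norm_triangle_ineq4[of "h y - h x" "h y - u y"] norm_triangle_ineq[of "h y - h x - (h y - u y)" "h x - u x"]
            by (simp add: algebra_simps)
          then have "norm (u y - u x) ^ p \<le> (norm (h y - u y) + norm (h y - h x) + norm (h x - u x)) ^ p"
            by (intro power_mono) auto
          also have "\<dots> \<le> 4 ^ p * (norm (h y - u y) ^ p + norm (h y - h x) ^ p + norm (h x - u x) ^ p)"
            by (rule power_add3_le) auto
          also have "\<dots> \<le> 4 ^ p * (norm (h y - u y) ^ p + \<eta> ^ p + norm (h x - u x) ^ p)"
            by (intro mult_left_mono add_mono power_mono hh order_refl) auto
          finally have "ennreal (norm (u y - u x) ^ p) \<le> ennreal (4 ^ p * (norm (h y - u y) ^ p + \<eta> ^ p + norm (h x - u x) ^ p))"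
            by (rule ennreal_leI)
          also have "\<dots> = 4 ^ p * (F y + ennreal (\<eta> ^ p) + F x)"
            using x y \<eta> by (simp add: F_def ennreal_mult ennreal_plus ennreal_power[symmetric])
          finally have "ennreal (k (x - y)) * ennreal (norm (u y - u x) ^ p) \<le> ennreal (k (x - y)) * (4 ^ p * (F y + ennreal (\<eta> ^ p) + F x))"
            by (rule mult_left_mono) simp
          then show ?thesis by (simp add: algebra_simps)
        qed
      qed
      also have "\<dots> = 4 ^ p * ((\<integral>\<^sup>+y. ennreal (k (x - y)) * F y \<partial>lborel) + (ennreal (\<eta> ^ p) + F x))"
        by (simp add: nn_integral_cmult nn_integral_add nn_integral_multc k1)
      finally show ?thesis using True by (simp add: add.assoc)
    qed simp
    have "(\<integral>\<^sup>+x\<in>A. ennreal (norm (convolve k u x - u x) ^ p) \<partial>lborel) \<le> 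
      (\<integral>\<^sup>+x. 4 ^ p * ((\<integral>\<^sup>+y. ennreal (k (x - y)) * F y \<partial>lborel) + ennreal (\<eta> ^ p) * indicator A x + F x) \<partial>lborel)"
      by (intro nn_integral_mono pt)
    also have "\<dots> = 4 ^ p * ((\<integral>\<^sup>+x. \<integral>\<^sup>+y. ennreal (k (x - y)) * F y \<partial>lborel \<partial>lborel) + ennreal (\<eta> ^ p) * emeasure lborel A + (\<integral>\<^sup>+x. F x \<partial>lborel))"
      by (simp add: nn_integral_cmult nn_integral_add)
    also have "(\<integral>\<^sup>+x. \<integral>\<^sup>+y. ennreal (k (x - y)) * F y \<partial>lborel \<partial>lborel) = (\<integral>\<^sup>+y. \<integral>\<^sup>+x. ennreal (k (x - y)) * F y \<partial>lborel \<partial>lborel)"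
      by (rule lborel_pair.Fubini') measurable
    also have "\<dots> = (\<integral>\<^sup>+y. F y \<partial>lborel)"
      by (simp add: nn_integral_multc k1)
    also have "4 ^ p * ((\<integral>\<^sup>+y. F y \<partial>lborel) + ennreal (\<eta> ^ p) * emeasure lborel A + (\<integral>\<^sup>+x. F x \<partial>lborel)) \<le> 4 ^ p * (ennreal e' + ennreal e' + ennreal e')"
      using hB by (intro mult_left_mono add_mono \<eta>A) (auto simp: F_def less_imp_le)
    also have "\<dots> = ennreal (4 ^ p * (e' + e' + e'))"
    proof -
      have "ennreal e' + ennreal e' + ennreal e' = ennreal (e' + e' + e')"
        using e' by (simp only: ennreal_plus add_nonneg_nonneg less_imp_le)
      moreover have "(4::ennreal) ^ p = ennreal (4 ^ p)" by (simp add: ennreal_power[symmetric])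
      ultimately show ?thesis using e' by (simp only: ennreal_mult add_nonneg_nonneg less_imp_le zero_le_power zero_le_numeral)
    qed
    also have "4 ^ p * (e' + e' + e') = e" by (simp add: e'_def)
    finally show "(\<integral>\<^sup>+x\<in>cball 0 R. ennreal (norm (convolve (\<kappa> (\<lambda>_. 0)) u x - u x) ^ p) \<partial>lborel) \<le> ennreal e"
      by (simp add: A_def k_def)
  qed (use d in auto)
qed

section \<open>The cutoff inequality for Sobolev maps\<close>

text \<open>The columns of a weak differential, in a Borel representative, and seen through mollifiers:
  the derivative of the mollified map is the mollified differential.\<close>

definition has_weak_columns :: "(real^'n::finite \<Rightarrow> real^'m::finite) \<Rightarrow> ('n \<Rightarrow> real^'n \<Rightarrow> real^'m) \<Rightarrow> bool" where
  "has_weak_columns f d \<longleftrightarrow>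
     continuous_on UNIV f \<and> (\<forall>i. d i \<in> borel_measurable borel) \<and>
     (\<forall>i R. (\<integral>\<^sup>+x\<in>cball 0 R. ennreal (norm (d i x) ^ CARD('n)) \<partial>lborel) < \<infinity>) \<and>
     (\<forall>i \<delta> \<kappa>. mollifier \<delta> \<kappa> \<longrightarrow> convolve (\<kappa> ((\<lambda>_. 0)(i := 1))) f = convolve (\<kappa> (\<lambda>_. 0)) (d i))"

lemma norm_column_le: "norm (column i (A :: real^'n::finite^'m::finite)) \<le> norm A"
proof -
  have "norm (column i A) = L2_set (\<lambda>j. norm (column i A $ j)) UNIV" by (rule norm_vec_def)
  also have "\<dots> \<le> L2_set (\<lambda>j. norm (A $ j)) UNIV"
    by (rule L2_set_mono) (auto simp: column_def component_le_norm_cart)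
  also have "\<dots> = norm A" by (rule norm_vec_def[symmetric])
  finally show ?thesis .
qed

text \<open>The functions \<open>y \<mapsto> \<kappa> (x - y)\<close> are test functions; the defining identity of the weak differential,
  tested against them, is the asserted identity of convolutions at the point \<open>x\<close>.\<close>

lemma weak_columns_exist:
  fixes f :: "real^'n::finite \<Rightarrow> real^'m::finite"
  assumes f: "continuous_on UNIV f" and D: "has_weak_differential f D" and Lp: "Lp_loc CARD('n) D"
  obtains d where "has_weak_columns f d" "AE x in lborel. \<forall>i. column i (D x) = d i x"
proof -
  have Dm: "D \<in> borel_measurable lebesgue" using Lp by (simp add: Lp_loc_def)
  have comp_m: "(\<lambda>x. D x $ j $ i) \<in> borel_measurable lebesgue" for i j
  proof -
    have "continuous_on UNIV (\<lambda>A :: real^'n^'m. A $ j $ i)" by (intro continuous_intros)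
    from measurable_compose[OF Dm borel_measurable_continuous_onI[OF this]] show ?thesis .
  qed
  have "\<forall>i j. \<exists>c. c \<in> borel_measurable lborel \<and> (AE x in lborel. D x $ j $ i = c x)"
    using completion_ex_borel_measurable_real[OF comp_m] by blast
  then have "\<exists>c. \<forall>i j. c i j \<in> borel_measurable lborel \<and> (AE x in lborel. D x $ j $ i = c i j x)"
    unfolding choice_iff .
  then obtain c where c: "\<And>i j. c i j \<in> borel_measurable lborel" "\<And>i j. AE x in lborel. D x $ j $ i = c i j x"
    by blast
  have [measurable]: "c i j \<in> borel_measurable borel" for i j using c(1) by simp
  define d where "d i x = (\<chi> j. c i j x)" for i x
  have "AE x in lborel. \<forall>i\<in>UNIV. \<forall>j\<in>UNIV. D x $ j $ i = c i j x"
    by (intro AE_finite_allI finite c)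
  then have AEd: "AE x in lborel. \<forall>i. column i (D x) = d i x"
    by eventually_elim (auto simp: d_def column_def vec_eq_iff)
  have dm[measurable]: "d i \<in> borel_measurable borel" for i
  proof (subst borel_measurable_euclidean_space, intro ballI)
    fix b :: "real^'m" assume "b \<in> Basis"
    then obtain j where "b = axis j 1" by (auto simp: Basis_vec_def)
    then have "(\<lambda>x. d i x \<bullet> b) = c i j" by (simp add: d_def inner_axis)
    then show "(\<lambda>x. d i x \<bullet> b) \<in> borel_measurable borel" by simp
  qed
  have fin: "(\<integral>\<^sup>+x\<in>cball 0 R. ennreal (norm (d i x) ^ CARD('n)) \<partial>lborel) < \<infinity>" for i R
  proof -
    have "(\<integral>\<^sup>+x\<in>cball 0 R. ennreal (norm (d i x) ^ CARD('n)) \<partial>lborel)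
      = (\<integral>\<^sup>+x\<in>cball 0 R. ennreal (norm (d i x) ^ CARD('n)) \<partial>lebesgue)"
      by (simp add: nn_integral_completion)
    also have "\<dots> \<le> (\<integral>\<^sup>+x. ennreal (norm (indicator (cball 0 R) x *\<^sub>R norm (D x) ^ CARD('n))) \<partial>lebesgue)"
    proof (rule nn_integral_mono_AE, use AE_completion[OF AEd] in eventually_elim)
      case (elim x)
      then have "norm (d i x) ^ CARD('n) \<le> norm (D x) ^ CARD('n)"
        using norm_column_le[of i "D x"] by (intro power_mono) auto
      then show ?case by (auto simp: indicator_def intro: ennreal_leI)
    qed
    also have "\<dots> < \<infinity>"
      using Lp unfolding Lp_loc_def set_integrable_def by (simp add: integrable_iff_bounded)
    finally show ?thesis .
  qed
  have N1: "1 \<le> CARD('n)" by (simp add: Suc_leI)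
  have [measurable]: "(\<lambda>y. g y $ j) \<in> borel_measurable borel"
    if "g \<in> borel_measurable borel" for g :: "real^'n \<Rightarrow> real^'m" and j
    using measurable_compose[OF that borel_measurable_continuous_onI[OF continuous_on_component[OF continuous_on_id]]]
    by simp
  have fm[measurable]: "f \<in> borel_measurable borel" using f by (rule borel_measurable_continuous_onI)
  have floc: "integrable lborel (\<lambda>x. indicator (cball 0 R) x *\<^sub>R f x)" for R
    by (rule borel_integrable_compact) (auto intro: continuous_on_subset[OF f])
  have "convolve (\<kappa> ((\<lambda>_. 0)(i := 1))) f x = convolve (\<kappa> (\<lambda>_. 0)) (d i) x"
    if \<kappa>: "mollifier \<delta> \<kappa>" for i \<delta> \<kappa> x
  proof -
    have km[measurable]: "\<kappa> \<alpha> \<in> borel_measurable borel" for \<alpha>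
      by (rule borel_measurable_continuous_onI, rule mollifier_continuous[OF \<kappa>])
    have component: "convolve (\<kappa> \<alpha>) g x $ j = (LINT y|lborel. \<kappa> \<alpha> (x - y) * g y $ j)"
      if "g \<in> borel_measurable borel" "\<And>R. integrable lborel (\<lambda>x. indicator (cball 0 R) x *\<^sub>R g x)"
      for \<alpha> j and g :: "real^'n \<Rightarrow> real^'m"
      unfolding convolve_def
      using integral_bounded_linear[OF bounded_linear_vec_nth[of j] integrable_mollifier_scaleR[OF \<kappa> that, of \<alpha> x]] by simp
    have "convolve (\<kappa> ((\<lambda>_. 0)(i := 1))) f x $ j = convolve (\<kappa> (\<lambda>_. 0)) (d i) x $ j" for j
    proof -
      define \<phi> where "\<phi> = (\<lambda>y. \<kappa> (\<lambda>_. 0) (x - y))"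
      have [measurable]: "\<phi> \<in> borel_measurable borel" unfolding \<phi>_def by measurable
      have \<phi>: "test_function \<phi>" unfolding \<phi>_def by (rule test_function_reflected_mollifier[OF \<kappa>])
      have pd: "partial_deriv i \<phi> = (\<lambda>y. - \<kappa> ((\<lambda>_. 0)(i := 1)) (x - y))"
        unfolding \<phi>_def using partial_deriv_reflected_mollifier(1)[OF \<kappa>, of i 1 "\<lambda>_. 0" x] by simp
      have "(LINT y|lebesgue. f y $ j * partial_deriv i \<phi> y) = - (LINT y|lebesgue. D y $ j $ i * \<phi> y)"
        using D \<phi> unfolding has_weak_differential_def by blast
      also have "(LINT y|lebesgue. f y $ j * partial_deriv i \<phi> y) = - (LINT y|lborel. \<kappa> ((\<lambda>_. 0)(i := 1)) (x - y) * f y $ j)"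
        unfolding pd by (subst integral_completion) (auto simp: mult.commute)
      also have "(LINT y|lebesgue. D y $ j $ i * \<phi> y) = (LINT y|lebesgue. \<phi> y * d i y $ j)"
      proof (rule integral_cong_AE)
        show "(\<lambda>y. D y $ j $ i * \<phi> y) \<in> borel_measurable lebesgue"
          by (intro borel_measurable_times comp_m measurable_completion) simp
        show "(\<lambda>y. \<phi> y * d i y $ j) \<in> borel_measurable lebesgue"
          by (intro measurable_completion) simp
        show "AE y in lebesgue. D y $ j $ i * \<phi> y = \<phi> y * d i y $ j"
          using AE_completion[OF c(2)[of j i]] by eventually_elim (simp add: d_def)
      qed
      also have "\<dots> = (LINT y|lborel. \<kappa> (\<lambda>_. 0) (x - y) * d i y $ j)"
        unfolding \<phi>_def by (subst integral_completion) auto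
      finally show ?thesis
        by (simp only: neg_equal_iff_equal component[OF fm floc] component[OF dm locally_integrable_of_power[OF dm N1 fin]])
    qed
    then show ?thesis by (simp add: vec_eq_iff)
  qed
  then have "has_weak_columns f d"
    unfolding has_weak_columns_def using f dm fin by (auto simp: fun_eq_iff)
  with AEd show thesis by (rule that[rotated])
qed

lemma sum_power_le:
  fixes a :: "'n::finite \<Rightarrow> real"
  assumes a: "\<And>i. a i \<ge> 0"
  shows "(\<Sum>i\<in>UNIV. a i) ^ p \<le> real CARD('n) ^ p * (\<Sum>i\<in>UNIV. a i ^ p)"
proof -
  obtain k where k: "\<And>i. a i \<le> a k"
  proof -
    have "Max (range a) \<in> range a" by (rule Max_in) auto
    then obtain k where "a k = Max (range a)" by (metis rangeE)
    then have "a i \<le> a k" for i by simp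
    then show thesis by (rule that)
  qed
  have "(\<Sum>i\<in>UNIV. a i) \<le> real CARD('n) * a k" using sum_mono[of UNIV a "\<lambda>_. a k"] k by simp
  then have "(\<Sum>i\<in>UNIV. a i) ^ p \<le> (real CARD('n) * a k) ^ p"
    by (intro power_mono sum_nonneg a)
  also have "\<dots> = real CARD('n) ^ p * a k ^ p" by (rule power_mult_distrib)
  also have "\<dots> \<le> real CARD('n) ^ p * (\<Sum>i\<in>UNIV. a i ^ p)"
    by (intro mult_left_mono member_le_sum) (auto simp: a)
  finally show ?thesis .
qed

text \<open>If the columns \<open>v\<close> converge to \<open>d\<close> in the mean of order \<open>N\<close>, then the terms with \<open>t\<close> integrate to
  something small for fixed \<open>s\<close>, and \<open>s\<close> controls the rest.  Hence the integrals of \<open>\<omega> v\<close> converge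
  to that of \<open>\<omega> d\<close>.\<close>

lemma covector_diff_power_le:
  fixes \<omega> :: "('n::finite \<Rightarrow> real^'m::finite) \<Rightarrow> real" and v d :: "'n \<Rightarrow> real^'m"
  assumes cov: "covector \<omega>" and s: "s > 0"
  defines "N \<equiv> CARD('n)" and "t \<equiv> \<Sum>i\<in>UNIV. norm (v i - d i)" and "S \<equiv> \<Sum>i\<in>UNIV. norm (d i)"
  shows "\<bar>\<omega> v - \<omega> d\<bar> \<le> covector_bound \<omega> * real N * ((1 / s) ^ (N - 1) * t ^ N + s * 2 ^ N * (S ^ N + t ^ N))"
proof -
  have N: "N \<ge> 1" by (simp add: N_def Suc_leI)
  have S: "norm (d i) \<le> S" for i unfolding S_def by (rule member_le_sum) auto
  have t: "norm (v i - d i) \<le> t" for i unfolding t_def by (rule member_le_sum) auto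
  have S0: "S \<ge> 0" and t0: "t \<ge> 0" unfolding S_def t_def by (intro sum_nonneg; simp)+
  have "\<bar>\<omega> v - \<omega> d\<bar> \<le> covector_bound \<omega> * (CARD('n) * (t * (S + t) ^ (CARD('n) - 1)))"
  proof (rule covector_diff_le[OF cov])
    show "norm (v i) \<le> S + t" for i
      using norm_triangle_sub[of "v i" "d i"] S[of i] t[of i] by linarith
    show "norm (d i) \<le> S + t" for i using S[of i] t0 by linarith
  qed (rule t)
  also have "\<dots> = covector_bound \<omega> * real N * (t * (S + t) ^ (N - 1))" by (simp add: N_def)
  also have "\<dots> \<le> covector_bound \<omega> * real N * ((1 / s) ^ (N - 1) * t ^ N + s * (S + t) ^ N)"
    using covector_bound_nonneg[of \<omega>] S0 t0 s N by (intro mult_left_mono scaled_young_power_le) auto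
  also have "\<dots> \<le> covector_bound \<omega> * real N * ((1 / s) ^ (N - 1) * t ^ N + s * (2 ^ N * (S ^ N + t ^ N)))"
    using covector_bound_nonneg[of \<omega>] S0 t0 s by (intro mult_left_mono add_mono power_add_le) auto
  finally show ?thesis by (simp add: mult.assoc)
qed

lemma nn_integral_sum_norm_power_le:
  fixes d :: "'n::finite \<Rightarrow> 'a::euclidean_space \<Rightarrow> 'b::euclidean_space"
  assumes [measurable]: "\<And>i. d i \<in> borel_measurable borel" "B \<in> sets borel"
  shows "(\<integral>\<^sup>+x\<in>B. ennreal ((\<Sum>i\<in>UNIV. norm (d i x)) ^ p) \<partial>lborel) \<le>
    ennreal (real CARD('n) ^ p) * (\<Sum>i\<in>UNIV. \<integral>\<^sup>+x\<in>B. ennreal (norm (d i x) ^ p) \<partial>lborel)"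
proof -
  have "(\<integral>\<^sup>+x\<in>B. ennreal ((\<Sum>i\<in>UNIV. norm (d i x)) ^ p) \<partial>lborel) \<le>
    (\<integral>\<^sup>+x. ennreal (real CARD('n) ^ p) * (\<Sum>i\<in>UNIV. ennreal (norm (d i x) ^ p) * indicator B x) \<partial>lborel)"
  proof (rule nn_integral_mono)
    fix x
    have "ennreal ((\<Sum>i\<in>UNIV. norm (d i x)) ^ p) \<le> ennreal (real CARD('n) ^ p * (\<Sum>i\<in>UNIV. norm (d i x) ^ p))"
      by (intro ennreal_leI sum_power_le) simp
    also have "\<dots> = ennreal (real CARD('n) ^ p) * (\<Sum>i\<in>UNIV. ennreal (norm (d i x) ^ p))"
      by (subst ennreal_mult) (auto intro!: sum_nonneg simp: sum_ennreal)
    finally show "ennreal ((\<Sum>i\<in>UNIV. norm (d i x)) ^ p) * indicator B x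
      \<le> ennreal (real CARD('n) ^ p) * (\<Sum>i\<in>UNIV. ennreal (norm (d i x) ^ p) * indicator B x)"
      by (cases "x \<in> B") auto
  qed
  also have "\<dots> = ennreal (real CARD('n) ^ p) * (\<Sum>i\<in>UNIV. \<integral>\<^sup>+x\<in>B. ennreal (norm (d i x) ^ p) \<partial>lborel)"
    by (subst nn_integral_cmult, measurable, subst nn_integral_sum, measurable)
  finally show ?thesis .
qed

lemma abs_covector_le_power:
  fixes \<omega> :: "('n::finite \<Rightarrow> real^'m::finite) \<Rightarrow> real"
  assumes "covector \<omega>"
  shows "\<bar>\<omega> v\<bar> \<le> covector_bound \<omega> * (\<Sum>i\<in>UNIV. norm (v i)) ^ CARD('n)"
proof -
  have "(\<Prod>j\<in>UNIV. norm (v j)) \<le> (\<Prod>j\<in>(UNIV :: 'n set). \<Sum>i\<in>UNIV. norm (v i))"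
    by (intro prod_mono) (auto intro!: member_le_sum)
  then have "(\<Prod>j\<in>UNIV. norm (v j)) \<le> (\<Sum>i\<in>UNIV. norm (v i)) ^ CARD('n)" by simp
  from mult_left_mono[OF this covector_bound_nonneg] show ?thesis
    using abs_covector_le[OF assms, of v] by (rule order_trans[rotated])
qed

text \<open>The inequality holds for the mollified map, and both sides pass to the limit.  The factor
  \<open>2 ^ n\<close> comes from splitting the mollified differential into the weak one and an error.\<close>

lemma cutoff_integral_le_sobolev:
  fixes \<omega> :: "('n::finite \<Rightarrow> real^'m::finite) \<Rightarrow> real"
  assumes cov: "covector \<omega>" and fd: "has_weak_columns f d" and r: "r > 0" and n: "CARD('n) \<ge> 2"
  shows "ennreal (LINT x|lborel. cutoff r x * \<omega> (\<lambda>i. d i x)) \<le>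
    ennreal (caccioppoli_const CARD('n) (covector_bound \<omega>) * 2 ^ CARD('n)) *
    (\<integral>\<^sup>+x\<in>layer r. ennreal ((\<Sum>i\<in>UNIV. norm (d i x)) ^ CARD('n)) \<partial>lborel)"
proof (rule ennreal_le_epsilon)
  define N where "N = CARD('n)"
  have N: "N \<ge> 1" and N0: "real N > 0" using n by (auto simp: N_def)
  define W where "W = covector_bound \<omega>"
  have W0: "W \<ge> 0" unfolding W_def by (rule covector_bound_nonneg)
  define C where "C = caccioppoli_const N W"
  have C0: "C \<ge> 0" unfolding C_def caccioppoli_const_def using W0 layer_const_nonneg[of N] by simp
  define P where "P = W * real N"
  have P0: "P \<ge> 0" using W0 by (simp add: P_def)
  have f: "continuous_on UNIV f" and dm[measurable]: "\<And>i. d i \<in> borel_measurable borel"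
    and fin: "\<And>i R. (\<integral>\<^sup>+x\<in>cball 0 R. ennreal (norm (d i x) ^ N) \<partial>lborel) < \<infinity>"
    and conv: "\<And>i \<delta> \<kappa>. mollifier \<delta> \<kappa> \<Longrightarrow> convolve (\<kappa> ((\<lambda>_. 0)(i := 1))) f = convolve (\<kappa> (\<lambda>_. 0)) (d i)"
    using fd unfolding has_weak_columns_def N_def by blast+
  define S where "S x = (\<Sum>i\<in>UNIV. norm (d i x))" for x
  have S0: "S x \<ge> 0" for x unfolding S_def by (intro sum_nonneg) auto
  have [measurable]: "S \<in> borel_measurable borel" unfolding S_def by measurable
  define B where "B = cball (0::real^'n) (2 * r * real N)"
  have [measurable]: "B \<in> sets borel" by (simp add: B_def)
  have layerB: "layer r \<subseteq> B" unfolding B_def N_def by (rule layer_subset_cball)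
  have "(\<integral>\<^sup>+x\<in>B. ennreal (S x ^ N) \<partial>lborel) < \<infinity>"
  proof -
    have "(\<integral>\<^sup>+x\<in>B. ennreal (S x ^ N) \<partial>lborel) \<le> ennreal (real N ^ N) * (\<Sum>i\<in>UNIV. \<integral>\<^sup>+x\<in>B. ennreal (norm (d i x) ^ N) \<partial>lborel)"
      unfolding S_def using nn_integral_sum_norm_power_le[of d B N] by (simp add: N_def)
    also have "\<dots> < \<infinity>" using fin by (simp add: ennreal_mult_less_top B_def less_top)
    finally show ?thesis .
  qed
  then obtain \<sigma> where \<sigma>: "(\<integral>\<^sup>+x\<in>B. ennreal (S x ^ N) \<partial>lborel) = ennreal \<sigma>" "\<sigma> \<ge> 0"
    by (cases "\<integral>\<^sup>+x\<in>B. ennreal (S x ^ N) \<partial>lborel") auto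
  fix e :: real assume e: "e > 0"
  \<comment> \<open>The scale in Young's inequality is chosen first, the mollifier afterwards.\<close>
  have half: "e / (2 * b) * b = e / 2" if "b > 0" for b using that by simp
  define s where "s = e / (2 * (P * 2 ^ N * \<sigma> + 1))"
  have den: "P * 2 ^ N * \<sigma> + 1 > 0" using P0 \<sigma>(2) by (simp add: add_nonneg_pos)
  have s: "s > 0" using e den by (simp add: s_def)
  have s\<sigma>: "P * (s * 2 ^ N * \<sigma>) \<le> e / 2"
  proof -
    have "P * (s * 2 ^ N * \<sigma>) = s * (P * 2 ^ N * \<sigma>)" by simp
    also have "\<dots> \<le> s * (P * 2 ^ N * \<sigma> + 1)" using s by simp
    also have "\<dots> = e / 2" unfolding s_def by (rule half[OF den])
    finally show ?thesis .
  qed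
  define Q where "Q = C * 2 ^ N + P * ((1 / s) ^ (N - 1) + s * 2 ^ N)"
  have Q0: "Q \<ge> 0" unfolding Q_def using C0 P0 s by simp
  define \<tau> where "\<tau> = e / (2 * (Q + 1))"
  have \<tau>: "\<tau> > 0" using e Q0 by (simp add: \<tau>_def)
  have Q\<tau>: "Q * \<tau> \<le> e / 2"
  proof -
    have "Q * \<tau> \<le> \<tau> * (Q + 1)" using \<tau> by (simp add: algebra_simps)
    also have "\<dots> = e / 2" unfolding \<tau>_def by (rule half) (use Q0 in simp)
    finally show ?thesis .
  qed
  define \<tau>1 where "\<tau>1 = \<tau> / (real N ^ N * real N)"
  have \<tau>1: "\<tau>1 > 0" using \<tau> N0 by (simp add: \<tau>1_def)
  have "\<forall>i. \<exists>\<delta>0>0. \<forall>\<delta> \<kappa>. \<delta> \<le> \<delta>0 \<longrightarrow> mollifier \<delta> \<kappa> \<longrightarrow>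
    (\<integral>\<^sup>+x\<in>B. ennreal (norm (convolve (\<kappa> (\<lambda>_. 0)) (d i) x - d i x) ^ N) \<partial>lborel) \<le> ennreal \<tau>1"
    unfolding B_def using convolve_tendsto_power_mean[OF dm N fin \<tau>1] by blast
  then obtain \<delta>0 where \<delta>0: "\<And>i. \<delta>0 i > 0" "\<And>i \<delta> \<kappa>. \<delta> \<le> \<delta>0 i \<Longrightarrow> mollifier \<delta> \<kappa> \<Longrightarrow>
    (\<integral>\<^sup>+x\<in>B. ennreal (norm (convolve (\<kappa> (\<lambda>_. 0)) (d i) x - d i x) ^ N) \<partial>lborel) \<le> ennreal \<tau>1"
    unfolding choice_iff by blast
  define \<delta> where "\<delta> = Min (range \<delta>0)"
  have \<delta>: "\<delta> > 0" "\<And>i. \<delta> \<le> \<delta>0 i" unfolding \<delta>_def using \<delta>0(1) by (subst Min_gr_iff) auto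
  obtain \<kappa> :: "('n \<Rightarrow> nat) \<Rightarrow> real^'n \<Rightarrow> real" where \<kappa>: "mollifier \<delta> \<kappa>" using mollifier_exists[OF \<delta>(1)] .
  define v where "v i = convolve (\<kappa> ((\<lambda>_. 0)(i := 1))) f" for i
  note C2 = C2_map_convolve[OF \<kappa> f, folded v_def]
  have vc: "continuous_on UNIV (v i)" for i by (rule C2_map_continuous[OF C2])
  have vm[measurable]: "v i \<in> borel_measurable borel" for i using vc by (rule borel_measurable_continuous_onI)
  define t where "t x = (\<Sum>i\<in>UNIV. norm (v i x - d i x))" for x
  have t0: "t x \<ge> 0" for x unfolding t_def by (intro sum_nonneg) auto
  have [measurable]: "t \<in> borel_measurable borel" unfolding t_def by measurable
  have tB: "(\<integral>\<^sup>+x\<in>B. ennreal (t x ^ N) \<partial>lborel) \<le> ennreal \<tau>"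
  proof -
    have "(\<integral>\<^sup>+x\<in>B. ennreal (t x ^ N) \<partial>lborel) \<le> ennreal (real N ^ N) * (\<Sum>i\<in>UNIV. \<integral>\<^sup>+x\<in>B. ennreal (norm (v i x - d i x) ^ N) \<partial>lborel)"
      unfolding t_def using nn_integral_sum_norm_power_le[of "\<lambda>i x. v i x - d i x" B N] by (simp add: N_def)
    also have "\<dots> \<le> ennreal (real N ^ N) * (\<Sum>i\<in>(UNIV :: 'n set). ennreal \<tau>1)"
      unfolding v_def conv[OF \<kappa>] by (intro mult_left_mono sum_mono \<delta>0(2)[OF \<delta>(2) \<kappa>]) auto
    also have "\<dots> = ennreal (real N ^ N * (real N * \<tau>1))"
      using \<tau>1 by (simp add: N_def ennreal_mult ennreal_of_nat_eq_real_of_nat)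
    also have "real N ^ N * (real N * \<tau>1) = \<tau>" using N0 by (simp add: \<tau>1_def)
    finally show ?thesis .
  qed
  define L where "L w = (LINT x|lborel. cutoff r x * \<omega> (\<lambda>i. w i x))" for w :: "'n \<Rightarrow> real^'n \<Rightarrow> real^'m"
  have cutc: "continuous_on UNIV (cutoff r :: real^'n \<Rightarrow> real)"
    by (rule has_derivative_imp_continuous_on, rule cutoff_has_derivative)
  have cm[measurable]: "(cutoff r :: real^'n \<Rightarrow> real) \<in> borel_measurable borel"
    using cutc by (rule borel_measurable_continuous_onI)
  have cutB: "cutoff r x = 0" if "x \<notin> B" for x
    using cutoff_support[OF r, of x] that by (auto simp: B_def N_def not_le)
  have cut1: "\<bar>cutoff r x\<bar> \<le> indicator B x" for x
    using cutoff_bounds[of r x] cutB[of x] by (cases "x \<in> B") auto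
  have \<omega>m[measurable]: "(\<lambda>x. \<omega> (\<lambda>i. w i x)) \<in> borel_measurable borel" if "\<And>i. w i \<in> borel_measurable borel" for w
    by (rule borel_measurable_covector[OF cov that])
  have [measurable]: "(\<lambda>x. \<omega> (\<lambda>i. d i x)) \<in> borel_measurable borel" "(\<lambda>x. \<omega> (\<lambda>i. v i x)) \<in> borel_measurable borel"
    by (intro \<omega>m dm vm)+
  have intd: "integrable lborel (\<lambda>x. cutoff r x * \<omega> (\<lambda>i. d i x))"
  proof (rule integrableI_bounded)
    have "(\<integral>\<^sup>+x. ennreal (norm (cutoff r x * \<omega> (\<lambda>i. d i x))) \<partial>lborel) \<le> (\<integral>\<^sup>+x. ennreal W * (ennreal (S x ^ N) * indicator B x) \<partial>lborel)"
    proof (rule nn_integral_mono)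
      fix x
      have "norm (cutoff r x * \<omega> (\<lambda>i. d i x)) \<le> indicator B x * (W * S x ^ N)"
        unfolding real_norm_def abs_mult W_def S_def N_def
        by (intro mult_mono cut1 abs_covector_le_power[OF cov]) auto
      then have "ennreal (norm (cutoff r x * \<omega> (\<lambda>i. d i x))) \<le> ennreal (indicator B x * (W * S x ^ N))" by (rule ennreal_leI)
      also have "\<dots> = ennreal W * (ennreal (S x ^ N) * indicator B x)"
        using W0 S0 by (cases "x \<in> B") (auto simp: ennreal_mult)
      finally show "ennreal (norm (cutoff r x * \<omega> (\<lambda>i. d i x))) \<le> ennreal W * (ennreal (S x ^ N) * indicator B x)" .
    qed
    also have "\<dots> = ennreal W * ennreal \<sigma>" by (simp add: nn_integral_cmult \<sigma>)
    also have "\<dots> < \<infinity>" by (simp add: ennreal_mult_less_top)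
    finally show "(\<integral>\<^sup>+x. ennreal (norm (cutoff r x * \<omega> (\<lambda>i. d i x))) \<partial>lborel) < \<infinity>" .
  qed measurable
  have intv: "integrable lborel (\<lambda>x. cutoff r x * \<omega> (\<lambda>i. v i x))"
  proof -
    have "integrable lborel (\<lambda>x. indicator B x *\<^sub>R (cutoff r x * \<omega> (\<lambda>i. v i x)))"
      unfolding B_def
    proof (rule borel_integrable_compact)
      show "continuous_on (cball 0 (2 * r * real N)) (\<lambda>x. cutoff r x * \<omega> (\<lambda>i. v i x))"
        by (intro continuous_on_mult continuous_on_covector[OF cov] continuous_on_subset[OF cutc] continuous_on_subset[OF vc] subset_UNIV)
    qed simp
    moreover have "(\<lambda>x. indicator B x *\<^sub>R (cutoff r x * \<omega> (\<lambda>i. v i x))) = (\<lambda>x. cutoff r x * \<omega> (\<lambda>i. v i x))"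
      using cutB by (auto simp: fun_eq_iff indicator_def)
    ultimately show ?thesis by simp
  qed
  define I where "I = (\<integral>\<^sup>+x\<in>layer r. ennreal (S x ^ N) \<partial>lborel)"
  have Lv: "ennreal (L v) \<le> ennreal (C * 2 ^ N) * (I + ennreal \<tau>)"
  proof -
    have "ennreal (L v) \<le> ennreal C * (\<integral>\<^sup>+x\<in>layer r. ennreal ((\<Sum>i\<in>UNIV. norm (v i x)) ^ N) \<partial>lborel)"
      using cutoff_integral_le[OF cov C2 r n] by (simp add: L_def C_def W_def N_def)
    also have "\<dots> \<le> ennreal C * (\<integral>\<^sup>+x. ennreal (2 ^ N) * (ennreal (S x ^ N) * indicator (layer r) x + ennreal (t x ^ N) * indicator (layer r) x) \<partial>lborel)"
    proof (intro mult_left_mono nn_integral_mono)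
      fix x
      have "(\<Sum>i\<in>UNIV. norm (v i x)) \<le> S x + t x"
        unfolding S_def t_def sum.distrib[symmetric] by (intro sum_mono norm_triangle_sub)
      then have "(\<Sum>i\<in>UNIV. norm (v i x)) ^ N \<le> (S x + t x) ^ N" by (intro power_mono sum_nonneg) auto
      also have "\<dots> \<le> 2 ^ N * (S x ^ N + t x ^ N)" by (rule power_add_le[OF S0 t0])
      finally have "ennreal ((\<Sum>i\<in>UNIV. norm (v i x)) ^ N) \<le> ennreal (2 ^ N * (S x ^ N + t x ^ N))" by (rule ennreal_leI)
      also have "\<dots> = ennreal (2 ^ N) * (ennreal (S x ^ N) + ennreal (t x ^ N))" using S0 t0 by (simp add: ennreal_mult)
      finally show "ennreal ((\<Sum>i\<in>UNIV. norm (v i x)) ^ N) * indicator (layer r) x \<le>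
        ennreal (2 ^ N) * (ennreal (S x ^ N) * indicator (layer r) x + ennreal (t x ^ N) * indicator (layer r) x)"
        by (cases "x \<in> layer r") auto
    qed simp
    also have "\<dots> = ennreal C * (ennreal (2 ^ N) * (I + (\<integral>\<^sup>+x\<in>layer r. ennreal (t x ^ N) \<partial>lborel)))"
      by (simp add: nn_integral_cmult nn_integral_add I_def)
    also have "\<dots> \<le> ennreal C * (ennreal (2 ^ N) * (I + ennreal \<tau>))"
      using order_trans[OF nn_set_integral_set_mono[OF layerB] tB] by (intro mult_left_mono add_mono) auto
    also have "\<dots> = ennreal (C * 2 ^ N) * (I + ennreal \<tau>)" using C0 by (simp add: ennreal_mult mult.assoc)
    finally show ?thesis .
  qed
  have diff: "ennreal \<bar>L v - L d\<bar> \<le> ennreal (P * ((1 / s) ^ (N - 1) * \<tau> + s * 2 ^ N * (\<sigma> + \<tau>)))"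
  proof -
    have "L v - L d = (LINT x|lborel. cutoff r x * (\<omega> (\<lambda>i. v i x) - \<omega> (\<lambda>i. d i x)))"
      unfolding L_def right_diff_distrib by (rule Bochner_Integration.integral_diff[OF intv intd, symmetric])
    then have "ennreal \<bar>L v - L d\<bar> \<le> (\<integral>\<^sup>+x. ennreal (norm (cutoff r x * (\<omega> (\<lambda>i. v i x) - \<omega> (\<lambda>i. d i x)))) \<partial>lborel)"
      using integral_norm_bound_ennreal[OF Bochner_Integration.integrable_diff[OF intv intd]] by (simp add: right_diff_distrib)
    also have "\<dots> \<le> (\<integral>\<^sup>+x. ennreal P * (ennreal ((1 / s) ^ (N - 1)) * (ennreal (t x ^ N) * indicator B x) +
       ennreal (s * 2 ^ N) * (ennreal (S x ^ N) * indicator B x + ennreal (t x ^ N) * indicator B x)) \<partial>lborel)"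
    proof (rule nn_integral_mono)
      fix x
      have "norm (cutoff r x * (\<omega> (\<lambda>i. v i x) - \<omega> (\<lambda>i. d i x))) \<le> indicator B x * (P * ((1 / s) ^ (N - 1) * t x ^ N + s * 2 ^ N * (S x ^ N + t x ^ N)))"
        unfolding real_norm_def abs_mult P_def W_def S_def t_def N_def
        by (intro mult_mono cut1 covector_diff_power_le[OF cov s]) auto
      then have "ennreal (norm (cutoff r x * (\<omega> (\<lambda>i. v i x) - \<omega> (\<lambda>i. d i x)))) \<le> ennreal (indicator B x * (P * ((1 / s) ^ (N - 1) * t x ^ N + s * 2 ^ N * (S x ^ N + t x ^ N))))"
        by (rule ennreal_leI)
      also have "\<dots> = ennreal P * (ennreal ((1 / s) ^ (N - 1)) * (ennreal (t x ^ N) * indicator B x) +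
       ennreal (s * 2 ^ N) * (ennreal (S x ^ N) * indicator B x + ennreal (t x ^ N) * indicator B x))"
        using P0 S0[of x] t0[of x] s by (cases "x \<in> B") (auto simp: ennreal_mult ennreal_plus)
      finally show "ennreal (norm (cutoff r x * (\<omega> (\<lambda>i. v i x) - \<omega> (\<lambda>i. d i x)))) \<le> ennreal P * (ennreal ((1 / s) ^ (N - 1)) * (ennreal (t x ^ N) * indicator B x) +
       ennreal (s * 2 ^ N) * (ennreal (S x ^ N) * indicator B x + ennreal (t x ^ N) * indicator B x))" .
    qed
    also have "\<dots> = ennreal P * (ennreal ((1 / s) ^ (N - 1)) * (\<integral>\<^sup>+x\<in>B. ennreal (t x ^ N) \<partial>lborel) +
       ennreal (s * 2 ^ N) * (ennreal \<sigma> + (\<integral>\<^sup>+x\<in>B. ennreal (t x ^ N) \<partial>lborel)))"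
      by (simp add: nn_integral_cmult nn_integral_add \<sigma>)
    also have "\<dots> \<le> ennreal P * (ennreal ((1 / s) ^ (N - 1)) * ennreal \<tau> + ennreal (s * 2 ^ N) * (ennreal \<sigma> + ennreal \<tau>))"
      by (intro mult_left_mono add_mono tB) auto
    also have "\<dots> = ennreal (P * ((1 / s) ^ (N - 1) * \<tau> + s * 2 ^ N * (\<sigma> + \<tau>)))"
      using P0 s \<tau> \<sigma>(2) by (simp add: ennreal_mult ennreal_plus)
    finally show ?thesis .
  qed
  have "ennreal (L d) \<le> ennreal (\<bar>L v - L d\<bar> + L v)" by (rule ennreal_leI) linarith
  also have "\<dots> \<le> ennreal \<bar>L v - L d\<bar> + ennreal (L v)"
    by (cases "L v \<ge> 0") (auto simp: ennreal_plus ennreal_neg not_le intro: ennreal_leI)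
  also have "\<dots> \<le> ennreal (P * ((1 / s) ^ (N - 1) * \<tau> + s * 2 ^ N * (\<sigma> + \<tau>))) + ennreal (C * 2 ^ N) * (I + ennreal \<tau>)"
    by (intro add_mono diff Lv)
  also have "\<dots> = ennreal (C * 2 ^ N) * I + ennreal (Q * \<tau> + P * (s * 2 ^ N * \<sigma>))"
  proof -
    have "Q * \<tau> + P * (s * 2 ^ N * \<sigma>) = P * ((1 / s) ^ (N - 1) * \<tau> + s * 2 ^ N * (\<sigma> + \<tau>)) + C * 2 ^ N * \<tau>"
      unfolding Q_def by (simp add: algebra_simps)
    then have "ennreal (Q * \<tau> + P * (s * 2 ^ N * \<sigma>)) = ennreal (P * ((1 / s) ^ (N - 1) * \<tau> + s * 2 ^ N * (\<sigma> + \<tau>))) + ennreal (C * 2 ^ N) * ennreal \<tau>"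
      using P0 C0 s \<tau> \<sigma>(2) by (simp only:) (subst ennreal_plus, auto simp: ennreal_mult)
    then show ?thesis by (simp add: distrib_left add_ac)
  qed
  also have "\<dots> \<le> ennreal (C * 2 ^ N) * I + ennreal e"
    using Q\<tau> s\<sigma> by (intro add_mono ennreal_leI order_refl) linarith
  finally show "ennreal (LINT x|lborel. cutoff r x * \<omega> (\<lambda>i. d i x)) \<le>
    ennreal (caccioppoli_const CARD('n) (covector_bound \<omega>) * 2 ^ CARD('n)) *
    (\<integral>\<^sup>+x\<in>layer r. ennreal ((\<Sum>i\<in>UNIV. norm (d i x)) ^ CARD('n)) \<partial>lborel) + ennreal e"
    by (simp add: L_def C_def W_def N_def I_def S_def)
qed

section \<open>Growth of quasiregular curves\<close>

definition cube :: "real \<Rightarrow> (real^'n::finite) set" where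
  "cube r = {x. \<forall>k. \<bar>x $ k\<bar> < r}"

lemma cube_borel [measurable]: "cube r \<in> sets borel"
  unfolding cube_def by measurable

lemma cube_subset_ball: "cube r \<subseteq> ball (0::real^'n::finite) (real CARD('n) * r)"
proof
  fix x :: "real^'n" assume x: "x \<in> cube r"
  have "norm x \<le> (\<Sum>k\<in>UNIV. \<bar>x $ k\<bar>)" by (rule norm_le_l1_cart)
  also have "\<dots> < (\<Sum>k\<in>(UNIV :: 'n set). r)"
    by (rule sum_strict_mono) (use x in \<open>auto simp: cube_def\<close>)
  finally show "x \<in> ball 0 (real CARD('n) * r)" by simp
qed

lemma cube_Un_layer:
  assumes "r > 0"
  shows "cube r \<union> layer r \<subseteq> cube (3 * r)" "cube r \<inter> layer r = {}"
proof -
  show "cube r \<union> layer r \<subseteq> cube (3 * r)"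
    using assms unfolding cube_def layer_def by (auto intro: less_le_trans le_less_trans)
  show "cube r \<inter> layer r = {}"
    unfolding cube_def layer_def by (auto simp: not_less[symmetric])
qed

text \<open>The estimate is iterated along \<open>3 ^ k * r0\<close>; rounding \<open>r / r0\<close> down to a power of 3 costs the
  factor \<open>1 / \<mu>\<close>.\<close>

lemma power_growth:
  fixes E :: "real \<Rightarrow> real"
  assumes mono: "\<And>r s. 0 < r \<Longrightarrow> r \<le> s \<Longrightarrow> E r \<le> E s"
    and step: "\<And>r. r > 0 \<Longrightarrow> \<mu> * E r \<le> E (3 * r)" and \<mu>: "\<mu> > 1"
    and r0: "r0 > 0" "E r0 > 0" and r: "r \<ge> r0"
  shows "E r \<ge> E r0 / \<mu> * (r / r0) powr log 3 \<mu>"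
proof -
  have iter: "\<mu> ^ k * E r0 \<le> E (3 ^ k * r0)" for k
  proof (induction k)
    case (Suc k)
    have "\<mu> ^ Suc k * E r0 \<le> \<mu> * E (3 ^ k * r0)" using mult_left_mono[OF Suc, of \<mu>] \<mu> by (simp add: mult.assoc)
    also have "\<dots> \<le> E (3 * (3 ^ k * r0))" by (rule step) (use r0 in simp)
    finally show ?case by (simp add: mult.assoc)
  qed simp
  define q where "q = r / r0"
  have q: "q \<ge> 1" using r r0 by (simp add: q_def)
  define k where "k = nat \<lfloor>log 3 q\<rfloor>"
  have lq: "log 3 q \<ge> 0" using q by (simp add: zero_le_log_cancel_iff)
  then have k: "real k \<le> log 3 q" "log 3 q \<le> real (k + 1)" by (auto simp: k_def) linarith
  have "3 ^ k \<le> q"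
    using k(1) q by (simp add: le_log_iff powr_realpow)
  then have "3 ^ k * r0 \<le> r" using r0 by (simp add: q_def field_simps)
  then have "E (3 ^ k * r0) \<le> E r" using r0 by (intro mono) auto
  moreover have "q powr log 3 \<mu> \<le> \<mu> ^ (k + 1)"
  proof -
    have "q powr log 3 \<mu> = \<mu> powr log 3 q"
      using q \<mu> by (simp add: powr_def log_def field_simps)
    also have "\<dots> \<le> \<mu> powr real (k + 1)" using k(2) \<mu> by (intro powr_mono) auto
    also have "\<dots> = \<mu> ^ (k + 1)" using \<mu> by (intro powr_realpow) auto
    finally show ?thesis .
  qed
  then have "E r0 / \<mu> * q powr log 3 \<mu> \<le> E r0 / \<mu> * \<mu> ^ (k + 1)"
    using r0 \<mu> by (intro mult_left_mono) auto
  moreover have "E r0 / \<mu> * \<mu> ^ (k + 1) = \<mu> ^ k * E r0" using \<mu> by simp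
  ultimately show ?thesis using iter[of k] by (simp add: q_def)
qed

text \<open>Every mollification of \<open>f\<close> has derivative zero, hence is constant, and mollifications converge
  to the continuous map \<open>f\<close> pointwise.\<close>

lemma constant_if_weak_columns_0:
  fixes f :: "real^'n::finite \<Rightarrow> real^'m::finite"
  assumes fd: "has_weak_columns f d" and 0: "AE x in lborel. \<forall>i. d i x = 0"
  shows "f constant_on UNIV"
proof -
  have f: "continuous_on UNIV f" and dm: "\<And>i. d i \<in> borel_measurable borel"
    and conv: "\<And>i \<delta> \<kappa>. mollifier \<delta> \<kappa> \<Longrightarrow> convolve (\<kappa> ((\<lambda>_. 0)(i := 1))) f = convolve (\<kappa> (\<lambda>_. 0)) (d i)"
    using fd unfolding has_weak_columns_def by blast+
  have "f x = f 0" for x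
  proof (rule ccontr)
    assume "f x \<noteq> f 0"
    define e where "e = norm (f x - f 0) / 3"
    have e: "e > 0" using \<open>f x \<noteq> f 0\<close> by (simp add: e_def)
    obtain \<delta>1 where \<delta>1: "\<delta>1 > 0" "\<And>\<delta> \<kappa>. \<delta> \<le> \<delta>1 \<Longrightarrow> mollifier \<delta> \<kappa> \<Longrightarrow> norm (convolve (\<kappa> (\<lambda>_. 0)) f x - f x) \<le> e"
      using convolve_tendsto[OF f e, of x] by blast
    obtain \<delta>2 where \<delta>2: "\<delta>2 > 0" "\<And>\<delta> \<kappa>. \<delta> \<le> \<delta>2 \<Longrightarrow> mollifier \<delta> \<kappa> \<Longrightarrow> norm (convolve (\<kappa> (\<lambda>_. 0)) f 0 - f 0) \<le> e"
      using convolve_tendsto[OF f e, of 0] by blast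
    define \<delta> where "\<delta> = min \<delta>1 \<delta>2"
    have \<delta>: "\<delta> > 0" "\<delta> \<le> \<delta>1" "\<delta> \<le> \<delta>2" using \<delta>1 \<delta>2 by (auto simp: \<delta>_def)
    obtain \<kappa> :: "('n \<Rightarrow> nat) \<Rightarrow> real^'n \<Rightarrow> real" where \<kappa>: "mollifier \<delta> \<kappa>" using mollifier_exists[OF \<delta>(1)] .
    define g where "g = convolve (\<kappa> (\<lambda>_. 0)) f"
    have "convolve (\<kappa> (\<lambda>_. 0)) (d i) y = 0" for i y
      unfolding convolve_def by (rule integral_eq_zero_AE, use 0 in eventually_elim) simp
    then have "(g has_derivative (\<lambda>h. 0)) (at y)" for y
      using C2_mapD(1)[OF C2_map_convolve[OF \<kappa> f], of y] by (simp add: g_def conv[OF \<kappa>] del: One_nat_def)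
    then have "g x = g 0"
      using has_derivative_zero_unique[of UNIV g 0 x] by (auto intro: convex_UNIV)
    have "norm (f x - f 0) \<le> norm (g x - f x) + norm (g 0 - f 0)"
      using norm_triangle_ineq4[of "g 0 - f 0" "g x - f x"] \<open>g x = g 0\<close> by simp
    also have "\<dots> \<le> e + e" unfolding g_def by (intro add_mono \<delta>1(2)[OF \<delta>(2) \<kappa>] \<delta>2(2)[OF \<delta>(3) \<kappa>])
    finally show False using e by (simp add: e_def)
  qed
  then show ?thesis by (auto simp: constant_on_def)
qed

lemma hodge_star_pullback_constant:
  assumes "covector \<omega>"
  shows "hodge_star (pullback f (constant_form \<omega>)) x = \<omega> (\<lambda>i. column i (weak_differential f x))"
proof -
  have "covector (pullback f (constant_form \<omega>) x)"
    by (rule covector_pullback) (simp add: constant_form_def assms)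
  then show ?thesis
    by (simp add: hodge_star_eq pullback_def constant_form_def matrix_vector_mult_basis)
qed

theorem corollary1p6:
  fixes K :: real and \<omega> :: "('n::finite \<Rightarrow> real^'m::finite) \<Rightarrow> real"
  assumes "CARD('n) \<ge> 2" and "CARD('m) \<ge> CARD('n)" and "K \<ge> 1"
    and "covector \<omega>" and "\<omega> \<noteq> (\<lambda>_. 0)"
  shows "\<exists>\<epsilon>>0. \<forall>f :: real^'n \<Rightarrow> real^'m.
           quasiregular_curve K (constant_form \<omega>) f \<and> \<not> f constant_on UNIV \<longrightarrow>
           fast_growth \<epsilon> (constant_form \<omega>) f"
proof -
  note n = assms(1) and K = assms(3) and cov = assms(4)
  define N where "N = CARD('n)"
  have N: "N \<ge> 1" "real N > 0" using n by (auto simp: N_def)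
  have com: "comass \<omega> > 0" by (rule comass_pos[OF cov assms(5)])
  define W where "W = covector_bound \<omega>"
  have W0: "W \<ge> 0" unfolding W_def by (rule covector_bound_nonneg)
  define K' where "K' = real N ^ N * K / comass \<omega>"
  have K': "K' > 0" using K com N by (simp add: K'_def)
  define C where "C = caccioppoli_const N W * 2 ^ N"
  have C0: "C \<ge> 0" unfolding C_def caccioppoli_const_def using W0 layer_const_nonneg[of N] by simp
  \<comment> \<open>The summand 1 keeps the divisor \<open>M\<close> of \<open>\<mu>\<close> positive when \<open>C = 0\<close>.\<close>
  define M where "M = C * K' + 1"
  have M: "M \<ge> 1" using C0 K' by (simp add: M_def)
  define \<mu> where "\<mu> = (1 + M) / M"
  have \<mu>: "\<mu> > 1" using M by (simp add: \<mu>_def field_simps)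
  define \<epsilon> where "\<epsilon> = log 3 \<mu>"
  have \<epsilon>: "\<epsilon> > 0" using \<mu> by (simp add: \<epsilon>_def)
  show ?thesis
  proof (intro exI[of _ \<epsilon>] conjI allI impI \<epsilon>)
    fix f :: "real^'n \<Rightarrow> real^'m"
    assume "quasiregular_curve K (constant_form \<omega>) f \<and> \<not> f constant_on UNIV"
    then have qr: "quasiregular_curve K (constant_form \<omega>) f" and nonconst: "\<not> f constant_on UNIV" by auto
    define D where "D = weak_differential f"
    have f: "continuous_on UNIV f" and sob: "sobolev_W1_loc N f"
      and ae: "AE x in lebesgue. comass \<omega> * onorm (\<lambda>v. D x *v v) ^ N \<le> K * \<omega> (\<lambda>i. column i (D x))"
      using qr unfolding quasiregular_curve_def hodge_star_pullback_constant[OF cov]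
      by (auto simp: D_def N_def constant_form_def)
    have Dw: "has_weak_differential f D" and DL: "Lp_loc N D"
      using sob someI_ex[of "has_weak_differential f"]
      unfolding sobolev_W1_loc_def D_def weak_differential_def by blast+
    obtain d where fd: "has_weak_columns f d" and dD: "AE x in lborel. \<forall>i. column i (D x) = d i x"
      using weak_columns_exist[OF f Dw] DL unfolding N_def by blast
    have dm[measurable]: "\<And>i. d i \<in> borel_measurable borel"
      and fin: "\<And>i R. (\<integral>\<^sup>+x\<in>cball 0 R. ennreal (norm (d i x) ^ N) \<partial>lborel) < \<infinity>"
      using fd unfolding has_weak_columns_def N_def by blast+
    define S where "S x = (\<Sum>i\<in>UNIV. norm (d i x))" for x
    have S0: "S x \<ge> 0" for x unfolding S_def by (intro sum_nonneg) auto
    have [measurable]: "S \<in> borel_measurable borel" unfolding S_def by measurable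
    define J where "J x = \<omega> (\<lambda>i. d i x)" for x
    have Jm[measurable]: "J \<in> borel_measurable borel" unfolding J_def by (rule borel_measurable_covector[OF cov dm])
    have SJ: "AE x in lborel. S x ^ N \<le> K' * J x"
      using ae[unfolded AE_completion_iff] dD
    proof eventually_elim
      case (elim x)
      have bl: "bounded_linear (\<lambda>v. D x *v v)" by (rule matrix_vector_mul_bounded_linear)
      have "S x \<le> (\<Sum>i\<in>(UNIV :: 'n set). onorm (\<lambda>v. D x *v v))"
        unfolding S_def using elim(2) norm_column_le_onorm[of _ "D x"] by (intro sum_mono) metis
      then have "S x \<le> real N * onorm (\<lambda>v. D x *v v)" by (simp add: N_def)
      then have "S x ^ N \<le> (real N * onorm (\<lambda>v. D x *v v)) ^ N" by (rule power_mono[OF _ S0])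
      also have "\<dots> = real N ^ N / comass \<omega> * (comass \<omega> * onorm (\<lambda>v. D x *v v) ^ N)"
        using com by (simp add: power_mult_distrib)
      also have "\<dots> \<le> real N ^ N / comass \<omega> * (K * \<omega> (\<lambda>i. column i (D x)))"
        using elim(1) com by (intro mult_left_mono) auto
      also have "(\<lambda>i. column i (D x)) = (\<lambda>i. d i x)" using elim(2) by auto
      finally show ?case by (simp add: K'_def J_def)
    qed
    have J0: "AE x in lborel. J x \<ge> 0"
      using SJ
    proof eventually_elim
      case (elim x)
      then have "0 \<le> K' * J x" using S0[of x] by (meson order_trans zero_le_power)
      then show ?case using K' by (simp add: zero_le_mult_iff)
    qed
    have JS: "\<bar>J x\<bar> \<le> W * S x ^ N" for x
      unfolding J_def W_def S_def N_def by (rule abs_covector_le_power[OF cov])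
    have J_bounded: "(\<integral>\<^sup>+x\<in>A. ennreal \<bar>J x\<bar> \<partial>lborel) < \<infinity>" if A: "A \<subseteq> cball 0 R" for A R
    proof -
      have "(\<integral>\<^sup>+x\<in>A. ennreal \<bar>J x\<bar> \<partial>lborel) \<le> (\<integral>\<^sup>+x. ennreal W * (ennreal (S x ^ N) * indicator (cball 0 R) x) \<partial>lborel)"
      proof (rule nn_integral_mono)
        fix x
        have "ennreal \<bar>J x\<bar> \<le> ennreal W * ennreal (S x ^ N)"
          using ennreal_leI[OF JS[of x]] W0 S0 by (simp add: ennreal_mult)
        then show "ennreal \<bar>J x\<bar> * indicator A x \<le> ennreal W * (ennreal (S x ^ N) * indicator (cball 0 R) x)"
          using A by (cases "x \<in> A") auto
      qed
      also have "\<dots> = ennreal W * (\<integral>\<^sup>+x\<in>cball 0 R. ennreal (S x ^ N) \<partial>lborel)"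
      proof (rule nn_integral_cmult)
        have "(indicator (cball 0 R) :: real^'n \<Rightarrow> ennreal) \<in> borel_measurable lborel"
          by (rule borel_measurable_indicator) simp
        moreover have "(\<lambda>x. ennreal (S x ^ N)) \<in> borel_measurable lborel" by simp
        ultimately show "(\<lambda>x. ennreal (S x ^ N) * indicator (cball 0 R) x) \<in> borel_measurable lborel"
          by (rule borel_measurable_times_ennreal[rotated])
      qed
      also have "(\<integral>\<^sup>+x\<in>cball 0 R. ennreal (S x ^ N) \<partial>lborel) \<le> ennreal (real N ^ N) * (\<Sum>i\<in>UNIV. \<integral>\<^sup>+x\<in>cball 0 R. ennreal (norm (d i x) ^ N) \<partial>lborel)"
        unfolding S_def using nn_integral_sum_norm_power_le[where B = "cball 0 R" and p = N, OF dm] by (simp add: N_def)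
      also have "ennreal W * (ennreal (real N ^ N) * (\<Sum>i\<in>UNIV. \<integral>\<^sup>+x\<in>cball 0 R. ennreal (norm (d i x) ^ N) \<partial>lborel)) < \<infinity>"
        using fin by (simp add: ennreal_mult_less_top less_top)
      finally show ?thesis by (simp add: mult_left_mono)
    qed
    define E where "E r = enn2real (\<integral>\<^sup>+x\<in>cube r. ennreal (J x) \<partial>lborel)" for r
    have cube_cball: "cube r \<subseteq> cball (0::real^'n) (real N * r)" for r
      using cube_subset_ball[of r] ball_subset_cball unfolding N_def by blast
    have E: "(\<integral>\<^sup>+x\<in>cube r. ennreal (J x) \<partial>lborel) = ennreal (E r)" for r
    proof -
      have "(\<integral>\<^sup>+x\<in>cube r. ennreal (J x) \<partial>lborel) \<le> (\<integral>\<^sup>+x\<in>cube r. ennreal \<bar>J x\<bar> \<partial>lborel)"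
        by (intro nn_integral_mono mult_right_mono ennreal_leI) auto
      also have "\<dots> < \<infinity>" by (rule J_bounded[OF cube_cball])
      finally show ?thesis by (simp add: E_def)
    qed
    have E0: "E r \<ge> 0" for r by (simp add: E_def)
    have E_mono: "E r \<le> E s" if "r \<le> s" for r s
    proof -
      have "(cube r :: (real^'n) set) \<subseteq> cube s" using that by (auto simp: cube_def intro: less_le_trans)
      then have "ennreal (E r) \<le> ennreal (E s)" unfolding E[symmetric] by (rule nn_set_integral_set_mono)
      then show ?thesis using E0 by simp
    qed
    have E_step: "\<mu> * E r \<le> E (3 * r)" if r: "r > 0" for r
    proof -
      define l where "l = (\<integral>\<^sup>+x\<in>layer r. ennreal (J x) \<partial>lborel)"
      have sum: "ennreal (E r) + l \<le> ennreal (E (3 * r))"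
      proof -
        have "ennreal (E r) + l = (\<integral>\<^sup>+x. ennreal (J x) * indicator (cube r) x + ennreal (J x) * indicator (layer r) x \<partial>lborel)"
          unfolding E[symmetric] l_def by (rule nn_integral_add[symmetric]) auto
        also have "\<dots> \<le> (\<integral>\<^sup>+x\<in>cube (3 * r). ennreal (J x) \<partial>lborel)"
          using cube_Un_layer[OF r] by (intro nn_integral_mono) (auto simp: indicator_def)
        finally show ?thesis unfolding E .
      qed
      have "ennreal (E r) \<le> (\<integral>\<^sup>+x. ennreal (cutoff r x * J x) \<partial>lborel)"
        unfolding E[symmetric]
      proof (rule nn_integral_mono)
        fix x
        show "ennreal (J x) * indicator (cube r) x \<le> ennreal (cutoff r x * J x)"
        proof (cases "x \<in> cube r")
          case True
          then have "cutoff r x = 1" by (intro cutoff_eq_1 r) (auto simp: cube_def less_imp_le)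
          then show ?thesis using True by simp
        qed simp
      qed
      also have "\<dots> = ennreal (LINT x|lborel. cutoff r x * J x)"
      proof (rule nn_integral_eq_integral)
        have cm[measurable]: "(cutoff r :: real^'n \<Rightarrow> real) \<in> borel_measurable borel"
          by (rule borel_measurable_continuous_onI, rule has_derivative_imp_continuous_on, rule cutoff_has_derivative)
        show "integrable lborel (\<lambda>x. cutoff r x * J x)"
        proof (rule integrableI_bounded)
          have "(\<integral>\<^sup>+x. ennreal (norm (cutoff r x * J x)) \<partial>lborel) \<le> (\<integral>\<^sup>+x\<in>cball 0 (2 * r * real N). ennreal \<bar>J x\<bar> \<partial>lborel)"
          proof (rule nn_integral_mono)
            fix x :: "real^'n"
            show "ennreal (norm (cutoff r x * J x)) \<le> ennreal \<bar>J x\<bar> * indicator (cball 0 (2 * r * real N)) x"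
            proof (cases "x \<in> cball 0 (2 * r * real N)")
              case True
              have "\<bar>cutoff r x\<bar> * \<bar>J x\<bar> \<le> 1 * \<bar>J x\<bar>" using cutoff_bounds[of r x] by (intro mult_right_mono) auto
              then show ?thesis using True by (simp add: abs_mult ennreal_leI)
            next
              case False
              then show ?thesis using cutoff_support[OF r, of x] by (simp add: N_def)
            qed
          qed
          also have "\<dots> < \<infinity>" by (rule J_bounded[OF order_refl])
          finally show "(\<integral>\<^sup>+x. ennreal (norm (cutoff r x * J x)) \<partial>lborel) < \<infinity>" .
        qed measurable
        show "AE x in lborel. 0 \<le> cutoff r x * J x"
          using J0 by eventually_elim (auto simp: cutoff_bounds)
      qed
      also have "\<dots> \<le> ennreal C * (\<integral>\<^sup>+x\<in>layer r. ennreal (S x ^ N) \<partial>lborel)"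
        using cutoff_integral_le_sobolev[OF cov fd r n] by (simp add: J_def C_def W_def N_def S_def)
      also have "\<dots> \<le> ennreal C * (\<integral>\<^sup>+x. ennreal K' * (ennreal (J x) * indicator (layer r) x) \<partial>lborel)"
      proof (intro mult_left_mono nn_integral_mono_AE)
        show "AE x in lborel. ennreal (S x ^ N) * indicator (layer r) x \<le> ennreal K' * (ennreal (J x) * indicator (layer r) x)"
          using SJ J0
        proof eventually_elim
          case (elim x)
          then show ?case using K' ennreal_leI[OF elim(1)] by (cases "x \<in> layer r") (auto simp: ennreal_mult)
        qed
      qed simp
      also have "\<dots> = ennreal (C * K') * l"
        using C0 K' by (simp add: nn_integral_cmult l_def ennreal_mult mult.assoc)
      also have "\<dots> \<le> ennreal M * l"
        by (intro mult_right_mono ennreal_leI) (auto simp: M_def)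
      \<comment> \<open>Filling the hole: once \<open>M * E r\<close> is added, the layer and its hole lie in a larger cube.\<close>
      finally have "ennreal (E r) + ennreal M * ennreal (E r) \<le> ennreal M * l + ennreal M * ennreal (E r)"
        by (rule add_right_mono)
      also have "\<dots> = ennreal M * (ennreal (E r) + l)" by (simp add: distrib_left add.commute)
      also have "\<dots> \<le> ennreal M * ennreal (E (3 * r))" by (intro mult_left_mono sum) simp
      finally have "ennreal (E r + M * E r) \<le> ennreal (M * E (3 * r))"
        using M E0 by (simp add: ennreal_mult ennreal_plus)
      then have "E r + M * E r \<le> M * E (3 * r)" by (subst (asm) ennreal_le_iff) (use M E0 in auto)
      then show ?thesis using M by (simp add: \<mu>_def field_simps)
    qed
    have "\<exists>r0>0. E r0 > 0"
    proof (rule ccontr)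
      assume "\<not> (\<exists>r0>0. E r0 > 0)"
      then have Ez: "E r = 0" if "r > 0" for r using E0[of r] that by (meson antisym not_less)
      have "AE x in lborel. \<forall>k. x \<in> cube (real (Suc k)) \<longrightarrow> J x \<le> 0"
      proof (subst AE_all_countable, intro allI)
        fix k
        have "(\<integral>\<^sup>+x\<in>cube (real (Suc k)). ennreal (J x) \<partial>lborel) = 0" unfolding E using Ez[of "real (Suc k)"] by simp
        then have "AE x in lborel. ennreal (J x) * indicator (cube (real (Suc k))) x = 0"
          by (subst (asm) nn_integral_0_iff_AE) auto
        then show "AE x in lborel. x \<in> cube (real (Suc k)) \<longrightarrow> J x \<le> 0"
          by eventually_elim (auto simp: ennreal_eq_0_iff)
      qed
      then have "AE x in lborel. \<forall>i. d i x = 0"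
        using SJ
      proof eventually_elim
        case (elim x)
        obtain k where "norm x < real (Suc k)" using reals_Archimedean2[of "norm x"] by (metis less_Suc_eq of_nat_less_iff order_less_trans)
        then have "x \<in> cube (real (Suc k))" unfolding cube_def using component_le_norm_cart[of x] by (auto intro: le_less_trans)
        then have "J x \<le> 0" using elim(1) by blast
        then have "S x ^ N \<le> 0" using elim(2) K' by (smt (verit) mult_nonneg_nonpos)
        then have "S x = 0" using S0[of x] by (metis antisym power_eq_0_iff zero_le_power)
        then show ?case unfolding S_def by (subst (asm) sum_nonneg_eq_0_iff) auto
      qed
      with constant_if_weak_columns_0[OF fd] nonconst show False by blast
    qed
    then obtain r0 where r0: "r0 > 0" "E r0 > 0" by blast
    \<comment> \<open>The ball of radius \<open>R\<close> contains the cube of half side \<open>R / n\<close>.\<close>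
    have integral_ge: "E (R / real N) \<le> form_integral (ball 0 R) (pullback f (constant_form \<omega>))" for R
    proof -
      have Jint: "integrable lborel (\<lambda>x. indicator A x * J x)" if "A \<in> sets borel" "A \<subseteq> cball 0 R'" for A R'
      proof (rule integrableI_bounded)
        show "(\<integral>\<^sup>+x. ennreal (norm (indicator A x * J x)) \<partial>lborel) < \<infinity>"
          using J_bounded[OF that(2)] by (simp add: abs_mult ennreal_mult ennreal_indicator mult.commute)
      qed (use that in measurable)
      have ballJ: "(\<lambda>x. indicator (ball 0 R) x * J x) \<in> borel_measurable lborel"
        by (intro borel_measurable_times borel_measurable_indicator) (simp_all add: Jm)
      have Dm: "D \<in> borel_measurable lebesgue" using DL by (simp add: Lp_loc_def)
      have colm: "(\<lambda>x. column i (D x)) \<in> borel_measurable lebesgue" for i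
        using measurable_compose[OF Dm borel_measurable_continuous_onI[of "column i"]]
        by (simp add: column_def continuous_on_vec_lambda continuous_on_component continuous_on_id)
      have "E (R / real N) = (LINT x|lborel. indicator (cube (R / real N)) x * J x)"
      proof -
        have "(LINT x|lborel. indicator (cube (R / real N)) x * J x) = enn2real (\<integral>\<^sup>+x. ennreal (indicator (cube (R / real N)) x * J x) \<partial>lborel)"
          by (rule integral_eq_nn_integral) (use J0 in \<open>auto elim: eventually_mono\<close>)
        moreover have "ennreal (indicator (cube (R / real N)) x * J x) = ennreal (J x) * indicator (cube (R / real N)) x" for x
          by (simp add: indicator_def)
        ultimately show ?thesis by (simp only: E_def)
      qed
      also have "\<dots> \<le> (LINT x|lborel. indicator (ball 0 R) x * J x)"
      proof (rule integral_mono_AE)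
        show "integrable lborel (\<lambda>x. indicator (cube (R / real N)) x * J x)" by (rule Jint[OF cube_borel cube_cball])
        show "integrable lborel (\<lambda>x. indicator (ball 0 R) x * J x)" by (rule Jint[OF _ ball_subset_cball]) simp
        show "AE x in lborel. indicator (cube (R / real N)) x * J x \<le> indicator (ball 0 R) x * J x"
          using J0
        proof eventually_elim
          case (elim x)
          have "(cube (R / real N) :: (real^'n) set) \<subseteq> ball 0 R" using cube_subset_ball[of "R / real N", where 'n = 'n] N by (simp add: N_def)
          then show ?case using elim by (auto simp: indicator_def)
        qed
      qed
      also have "\<dots> = (LINT x|lebesgue. indicator (ball 0 R) x * J x)"
        by (rule integral_completion[symmetric, OF ballJ])
      also have "\<dots> = form_integral (ball 0 R) (pullback f (constant_form \<omega>))"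
        unfolding form_integral_def set_lebesgue_integral_def hodge_star_pullback_constant[OF cov] real_scaleR_def D_def[symmetric]
      proof (rule integral_cong_AE)
        show "(\<lambda>x. indicator (ball 0 R) x * J x) \<in> borel_measurable lebesgue"
          by (rule measurable_completion[OF ballJ])
        show "(\<lambda>x. indicator (ball 0 R) x * \<omega> (\<lambda>i. column i (D x))) \<in> borel_measurable lebesgue"
          by (intro borel_measurable_times borel_measurable_covector[OF cov colm] borel_measurable_indicator) simp
        show "AE x in lebesgue. indicator (ball 0 R) x * J x = indicator (ball 0 R) x * \<omega> (\<lambda>i. column i (D x))"
          using AE_completion[OF dD] by eventually_elim (simp add: J_def)
      qed
      finally show ?thesis .
    qed
    define c where "c = E r0 / \<mu> * (1 / (real N * r0)) powr \<epsilon>"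
    have c: "c > 0" using r0 \<mu> N by (simp add: c_def)
    have "ereal c \<le> Liminf at_top (\<lambda>r::real. ereal (1 / r powr \<epsilon> * form_integral (ball 0 r) (pullback f (constant_form \<omega>))))"
    proof (rule Liminf_bounded)
      show "\<forall>\<^sub>F r in at_top. ereal c \<le> ereal (1 / r powr \<epsilon> * form_integral (ball 0 r) (pullback f (constant_form \<omega>)))"
        using eventually_ge_at_top[of "real N * r0"]
      proof eventually_elim
        case (elim r)
        have r: "r > 0" using elim r0 N by (meson less_le_trans mult_pos_pos)
        have "r / real N \<ge> r0" using elim N by (simp add: field_simps)
        from power_growth[OF E_mono E_step \<mu> r0 this]
        have "E r0 / \<mu> * (r / real N / r0) powr \<epsilon> \<le> E (r / real N)" by (simp add: \<epsilon>_def)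
        also have "\<dots> \<le> form_integral (ball 0 r) (pullback f (constant_form \<omega>))" by (rule integral_ge)
        also have "(r / real N / r0) powr \<epsilon> = r powr \<epsilon> * (1 / (real N * r0)) powr \<epsilon>"
          using r r0 N by (subst powr_mult[symmetric]) auto
        finally have "c * r powr \<epsilon> \<le> form_integral (ball 0 r) (pullback f (constant_form \<omega>))" by (simp add: c_def mult_ac)
        then show ?case using r by (simp add: field_simps)
      qed
    qed
    then show "fast_growth \<epsilon> (constant_form \<omega>) f"
      unfolding fast_growth_def using c by (meson ereal_less(2) less_le_trans)
  qed
qed

end
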